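(* Let $\mathbb{F}$ be a field of characteristic zero and let $I\subset R=\mathbb{F}[x_1,x_2]$ be a height two ideal minimally generated by three homogeneous polynomials $f_1,f_2,f_3$ of the same degree $d$. Let $g_1,g_2$ be the equations of the symmetric algebra of $I$, let $L_1=\mathcal{F}(g_1)$ and $L_2=\mathcal{F}(g_2)$ be their Fourier transforms, and let $\mathcal{K}$ be the kernel of the canonical map $\mathrm{Sym}(I)\to \mathrm{Rees}(I)$ (all as defined in the context). Then there is an isomorphism of bigraded $S$-modules $$\mathcal{K}\cong \mathrm{Sol}(L_1,L_2;S)_{\mathcal{F}}(-2,-d+2),$$ where $\mathrm{Sol}(L_1,L_2;S)=\{h\in S\mid L_1\bullet h=0 \text{ and } L_2\bullet h=0\}$ and the subscript $\mathcal{F}$ denotes the bigraded $S$-module structure obtained by twisting by the Fourier transform.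
   Context: By the Hilbert–Burch theorem $I$ has a graded free resolution $0\to R(-d-\mu)\oplus R(-2d+\mu)\xrightarrow{\varphi}R(-d)^3\xrightarrow{[f_1,f_2,f_3]}I\to 0$, where $\varphi$ is a $3\times 2$ matrix whose first column has homogeneous entries of degree $\mu$ and whose second column has homogeneous entries of degree $d-\mu$ (one may order the columns so that $0<\mu\le d-\mu$). Let $U=\mathbb{F}[T_1,T_2,T_3]$ and $S=R[T_1,T_2,T_3]$, bigraded by $\mathrm{bideg}(T_i)=(1,0)$, $\mathrm{bideg}(x_i)=(0,1)$. Put $[g_1,g_2]=[T_1,T_2,T_3]\cdot\varphi$, so that $\mathrm{bideg}(g_1)=(1,\mu)$, $\mathrm{bideg}(g_2)=(1,d-\mu)$, and $\mathrm{Sym}(I)\cong S/(g_1,g_2)$. Let $\mathrm{Rees}(I)=R[It]=\bigoplus_{i\ge0}I^it^i$, which is a quotient of $S$ via $T_i\mapsto f_it$ (bihomogeneous when $\mathrm{bideg}(t)=(1,-d)$), and let $\mathcal{K}$ be the kernel of the canonical surjection $\mathrm{Sym}(I)\to\mathrm{Rees}(I)$; it is a bigraded $S$-module. Let $D=A_2(\mathbb{F})=\mathbb{F}\langle x_1,x_2,\partial_1,\partial_2\rangle$ be the Weyl algebra (relations $x_ix_j=x_jx_i$, $\partial_i\partial_j=\partial_j\partial_i$, $\partial_ix_j=x_j\partial_i+\delta_{ij}$) and $\mathcal{T}=D[T_1,T_2,T_3]$ the polynomial ring over $D$ with central variables $T_i$. The ring $\mathcal{T}$ acts on $S$ by $x_i,T_i$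 acting by multiplication and $\partial_i\bullet h=\partial h/\partial x_i$; the action is denoted $\bullet$. The Fourier transform is the automorphism $\mathcal{F}$ of $\mathcal{T}$ with $\mathcal{F}(x_i)=\partial_i$, $\mathcal{F}(\partial_i)=-x_i$, $\mathcal{F}(T_i)=T_i$. The bigraded $S$-module $\mathrm{Sol}(L_1,L_2;S)_{\mathcal{F}}$ is the vector space $\mathrm{Sol}(L_1,L_2;S)$ with $S$-action $f\cdot h=\mathcal{F}(f)\bullet h$ for $f\in S$ and bigraded pieces $\mathrm{Sol}(L_1,L_2;S)_{i,j}=\mathrm{Sol}(L_1,L_2;S)\cap S_{i,-j}$ for $i\ge0$, $j\le 0$. For a bigraded module $N$, $N(a,b)_{p,q}=N_{p+a,q+b}$. *)

theory Defs
  imports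
    "HOL-Algebra.QuotRing"
    "HOL-Algebra.Ideal_Product"
    "HOL-Algebra.Module"
    "HOL-Computational_Algebra.Polynomial"
    "HOL-Library.Poly_Mapping"
    "HOL-Library.Numeral_Type"
    "HOL-Library.Extended_Nat"
begin

section \<open>Polynomial rings\<close>

text \<open>
  \<open>'a xpoly\<close> is \<open>R = F[x\<^sub>1,x\<^sub>2]\<close> and \<open>'a spoly\<close> is \<open>S = R[T\<^sub>1,T\<^sub>2,T\<^sub>3]\<close>: finitely supported maps from
  exponent vectors to coefficients, with the convolution product of \<^theory>\<open>HOL-Library.Poly_Mapping\<close>.
  Variables are indexed by the numeral types \<open>2\<close> and \<open>3\<close>, whose elements are \<open>1, 2\<close> and \<open>1, 2, 3\<close>
  (in these types \<open>2 = 0\<close> and \<open>3 = 0\<close> respectively).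
\<close>

type_synonym 'a xpoly = "(2 \<Rightarrow>\<^sub>0 nat) \<Rightarrow>\<^sub>0 'a"
type_synonym 'a spoly = "(3 \<Rightarrow>\<^sub>0 nat) \<Rightarrow>\<^sub>0 'a xpoly"

abbreviation const_mp :: "'r::zero \<Rightarrow> ('v \<Rightarrow>\<^sub>0 nat) \<Rightarrow>\<^sub>0 'r" where
  "const_mp c \<equiv> Poly_Mapping.single 0 c"

definition var_mp :: "'v \<Rightarrow> ('v \<Rightarrow>\<^sub>0 nat) \<Rightarrow>\<^sub>0 'r::zero_neq_one" where
  "var_mp v = Poly_Mapping.single (Poly_Mapping.single v 1) 1"

definition eval_mp :: "('r::zero \<Rightarrow> 's::comm_ring_1) \<Rightarrow> ('v \<Rightarrow> 's) \<Rightarrow> (('v \<Rightarrow>\<^sub>0 nat) \<Rightarrow>\<^sub>0 'r) \<Rightarrow> 's" where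
  "eval_mp c y p =
     (\<Sum>m\<in>Poly_Mapping.keys p. c (Poly_Mapping.lookup p m) *
        (\<Prod>v\<in>Poly_Mapping.keys m. y v ^ Poly_Mapping.lookup m v))"

definition mdeg :: "('v \<Rightarrow>\<^sub>0 nat) \<Rightarrow> nat" where
  "mdeg m = (\<Sum>v\<in>Poly_Mapping.keys m. Poly_Mapping.lookup m v)"

definition homogeneous :: "nat \<Rightarrow> (('v \<Rightarrow>\<^sub>0 nat) \<Rightarrow>\<^sub>0 'r::zero) \<Rightarrow> bool" where
  "homogeneous n p \<longleftrightarrow> (\<forall>m\<in>Poly_Mapping.keys p. mdeg m = n)"

text \<open>\<open>S\<^sub>i\<^sub>,\<^sub>j\<close>; it is \<open>{0}\<close> if \<open>i\<close> or \<open>j\<close> is negative.\<close>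

definition S_piece :: "int \<Rightarrow> int \<Rightarrow> 'a::zero spoly set" where
  "S_piece i j =
     {s. \<forall>m\<in>Poly_Mapping.keys s. int (mdeg m) = i \<and>
           (\<forall>u\<in>Poly_Mapping.keys (Poly_Mapping.lookup s m). int (mdeg u) = j)}"


section \<open>Height of an ideal\<close>

definition type_ring :: "'r::comm_ring_1 ring" where
  "type_ring = \<lparr>carrier = UNIV, monoid.mult = (*), one = 1, zero = 0, add = (+)\<rparr>"

definition prime_height :: "('r, 'm) ring_scheme \<Rightarrow> 'r set \<Rightarrow> enat" where
  "prime_height R P =
     Sup {enat n | n C. (\<forall>i\<le>n. primeideal (C i) R) \<and> (\<forall>i<n. C i \<subset> C (Suc i)) \<and> C n = P}"

definition ideal_height :: "('r, 'm) ring_scheme \<Rightarrow> 'r set \<Rightarrow> enat" where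
  "ideal_height R I = Inf {prime_height R P | P. primeideal P R \<and> I \<subseteq> P}"


section \<open>Symmetric algebra and Rees algebra of an ideal\<close>

text \<open>
  For an ideal \<open>I\<close> of the ring \<open>'r\<close>, \<open>Sym(I)\<close> is \<open>R[X\<^sub>a | a \<in> I]\<close> modulo the relations
  \<open>X\<^sub>a\<^sub>+\<^sub>b = X\<^sub>a + X\<^sub>b\<close> and \<open>X\<^sub>r\<^sub>a = r X\<^sub>a\<close>.
\<close>

definition gen_poly_ring :: "'r::comm_ring_1 set \<Rightarrow> (('r \<Rightarrow>\<^sub>0 nat) \<Rightarrow>\<^sub>0 'r) ring" where
  "gen_poly_ring I = type_ring \<lparr>carrier := {p. \<forall>m\<in>Poly_Mapping.keys p. Poly_Mapping.keys m \<subseteq> I}\<rparr>"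

definition sym_rels :: "'r::comm_ring_1 set \<Rightarrow> (('r \<Rightarrow>\<^sub>0 nat) \<Rightarrow>\<^sub>0 'r) set" where
  "sym_rels I =
     {var_mp (a + b) - var_mp a - var_mp b | a b. a \<in> I \<and> b \<in> I} \<union>
     {var_mp (r * a) - const_mp r * var_mp a | r a. a \<in> I}"

definition sym_ideal :: "'r::comm_ring_1 set \<Rightarrow> (('r \<Rightarrow>\<^sub>0 nat) \<Rightarrow>\<^sub>0 'r) set" where
  "sym_ideal I = genideal (gen_poly_ring I) (sym_rels I)"

definition Sym :: "'r::comm_ring_1 set \<Rightarrow> (('r \<Rightarrow>\<^sub>0 nat) \<Rightarrow>\<^sub>0 'r) set ring" where
  "Sym I = gen_poly_ring I Quot sym_ideal I"

primrec ideal_power :: "'r::comm_ring_1 set \<Rightarrow> nat \<Rightarrow> 'r set" where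
  "ideal_power I 0 = UNIV"
| "ideal_power I (Suc n) = ideal_prod type_ring I (ideal_power I n)"

text \<open>\<open>Rees(I) = R[It]\<close> as a subring of \<open>R[t]\<close>.\<close>

definition Rees :: "'r::comm_ring_1 set \<Rightarrow> 'r poly ring" where
  "Rees I = type_ring \<lparr>carrier := {p. \<forall>n. coeff p n \<in> ideal_power I n}\<rparr>"

text \<open>
  The canonical map \<open>Sym(I) \<rightarrow> Rees(I)\<close> is induced by \<open>X\<^sub>a \<mapsto> a t\<close>: a residue class is sent to the
  common value of its members.
\<close>

definition Sym_to_Rees :: "(('r::comm_ring_1 \<Rightarrow>\<^sub>0 nat) \<Rightarrow>\<^sub>0 'r) set \<Rightarrow> 'r poly" where
  "Sym_to_Rees A = the_elem (eval_mp (\<lambda>r. [:r:]) (\<lambda>a. Polynomial.monom a 1) ` A)"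

text \<open>The map \<open>S \<rightarrow> Sym(I)\<close>, \<open>T\<^sub>i \<mapsto> X(f\<^sub>i)\<close>, defined by generators \<open>f\<^sub>i\<close> of \<open>I\<close>.\<close>

definition S_to_Sym ::
  "'a::field xpoly set \<Rightarrow> (3 \<Rightarrow> 'a xpoly) \<Rightarrow> 'a spoly \<Rightarrow> (('a xpoly \<Rightarrow>\<^sub>0 nat) \<Rightarrow>\<^sub>0 'a xpoly) set" where
  "S_to_Sym I f s =
     a_r_coset (gen_poly_ring I) (sym_ideal I) (eval_mp const_mp (\<lambda>i. var_mp (f i)) s)"


section \<open>Bigraded modules over \<open>S\<close>\<close>

record ('s, 'm) bigraded_module = "('s, 'm) module" +
  piece :: "int \<Rightarrow> int \<Rightarrow> 'm set"

definition is_bigraded_module :: "('a::field spoly, 'm) bigraded_module \<Rightarrow> bool" where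
  "is_bigraded_module M \<longleftrightarrow>
     Module.module type_ring M \<and>
     (\<forall>p q. subgroup (piece M p q) (add_monoid M)) \<and>
     (\<forall>i j p q. \<forall>s\<in>S_piece i j. \<forall>m\<in>piece M p q. s \<odot>\<^bsub>M\<^esub> m \<in> piece M (i + p) (j + q)) \<and>
     (\<forall>m\<in>carrier M. \<exists>!c :: int \<times> int \<Rightarrow> 'm.
        (\<forall>p q. c (p, q) \<in> piece M p q) \<and> finite {k. c k \<noteq> \<zero>\<^bsub>M\<^esub>} \<and>
        m = (\<Oplus>\<^bsub>M\<^esub>k\<in>{k. c k \<noteq> \<zero>\<^bsub>M\<^esub>}. c k))"

definition bg_shift :: "('s, 'm) bigraded_module \<Rightarrow> int \<Rightarrow> int \<Rightarrow> ('s, 'm) bigraded_module" where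
  "bg_shift N a b = N \<lparr>piece := \<lambda>p q. piece N (p + a) (q + b)\<rparr>"

definition bigraded_iso ::
  "('a::field spoly, 'm) bigraded_module \<Rightarrow> ('a spoly, 'n) bigraded_module \<Rightarrow> bool" where
  "bigraded_iso M N \<longleftrightarrow>
     is_bigraded_module M \<and> is_bigraded_module N \<and>
     (\<exists>\<psi>. bij_betw \<psi> (carrier M) (carrier N) \<and>
          (\<forall>x\<in>carrier M. \<forall>y\<in>carrier M. \<psi> (x \<oplus>\<^bsub>M\<^esub> y) = \<psi> x \<oplus>\<^bsub>N\<^esub> \<psi> y) \<and>
          (\<forall>s. \<forall>x\<in>carrier M. \<psi> (s \<odot>\<^bsub>M\<^esub> x) = s \<odot>\<^bsub>N\<^esub> \<psi> x) \<and>
          (\<forall>p q. \<psi> ` piece M p q = piece N p q))"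

text \<open>
  The kernel \<open>\<K>\<close> of \<open>Sym(I) \<rightarrow> Rees(I)\<close>, with the \<open>S\<close>-action and the bigrading that \<open>Sym(I)\<close>
  inherits from the surjection \<open>S \<rightarrow> Sym(I)\<close>. The fields \<open>mult\<close> and \<open>one\<close> of the record play no role
  in a module.
\<close>

definition K_module ::
  "'a::field xpoly set \<Rightarrow> (3 \<Rightarrow> 'a xpoly) \<Rightarrow>
   ('a spoly, (('a xpoly \<Rightarrow>\<^sub>0 nat) \<Rightarrow>\<^sub>0 'a xpoly) set) bigraded_module" where
  "K_module I f =
     \<lparr>carrier = a_kernel (Sym I) (Rees I) Sym_to_Rees,
      monoid.mult = undefined, one = undefined,
      zero = \<zero>\<^bsub>Sym I\<^esub>, add = (\<oplus>\<^bsub>Sym I\<^esub>),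
      module.smult = (\<lambda>s A. S_to_Sym I f s \<otimes>\<^bsub>Sym I\<^esub> A),
      piece = (\<lambda>p q. a_kernel (Sym I) (Rees I) Sym_to_Rees \<inter> S_to_Sym I f ` S_piece p q)\<rparr>"


section \<open>The equations of the symmetric algebra\<close>

text \<open>
  \<open>\<phi> i 1\<close> and \<open>\<phi> i 2\<close> are the two columns of \<open>\<phi>\<close>. The two conditions on the linear map given by \<open>\<phi>\<close>
  say that \<open>0 \<rightarrow> R\<^sup>2 \<rightarrow> R\<^sup>3 \<rightarrow> I \<rightarrow> 0\<close> is exact on the left and in the middle; exactness on the right
  is that the \<open>f\<^sub>i\<close> generate \<open>I\<close>. The degree conditions say that it is graded with the shifts
  \<open>R(-d-\<mu>) \<oplus> R(-2d+\<mu>)\<close> and \<open>R(-d)\<^sup>3\<close>.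
\<close>

definition hilbert_burch :: "(3 \<Rightarrow> 'a::field xpoly) \<Rightarrow> nat \<Rightarrow> nat \<Rightarrow> (3 \<Rightarrow> 2 \<Rightarrow> 'a xpoly) \<Rightarrow> bool" where
  "hilbert_burch f d \<mu> \<phi> \<longleftrightarrow>
     0 < \<mu> \<and> \<mu> \<le> d - \<mu> \<and>
     (\<forall>i. homogeneous \<mu> (\<phi> i 1)) \<and> (\<forall>i. homogeneous (d - \<mu>) (\<phi> i 2)) \<and>
     inj (\<lambda>(v :: 2 \<Rightarrow> 'a xpoly) i. \<Sum>k\<in>UNIV. \<phi> i k * v k) \<and>
     range (\<lambda>(v :: 2 \<Rightarrow> 'a xpoly) i. \<Sum>k\<in>UNIV. \<phi> i k * v k) =
       {w. (\<Sum>i\<in>UNIV. f i * w i) = 0}"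

definition sym_eq :: "(3 \<Rightarrow> 2 \<Rightarrow> 'a::field xpoly) \<Rightarrow> 2 \<Rightarrow> 'a spoly" where
  "sym_eq \<phi> k = (\<Sum>i\<in>UNIV. var_mp i * const_mp (\<phi> i k))"


section \<open>The Weyl algebra\<close>

definition pdiff :: "2 \<Rightarrow> 'a::field xpoly \<Rightarrow> 'a xpoly" where
  "pdiff i h =
     (\<Sum>m\<in>Poly_Mapping.keys h.
        Poly_Mapping.single (m - Poly_Mapping.single i 1)
          (of_nat (Poly_Mapping.lookup m i) * Poly_Mapping.lookup h m))"

lemma lookup_pdiff:
  "Poly_Mapping.lookup (pdiff i h) m =
     of_nat (Suc (Poly_Mapping.lookup m i)) * Poly_Mapping.lookup h (m + Poly_Mapping.single i 1)"
proof -
  have eq: "(k - Poly_Mapping.single i 1 = m \<and> Poly_Mapping.lookup k i \<noteq> 0) \<longleftrightarrow>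
      k = m + Poly_Mapping.single i 1" for k :: "2 \<Rightarrow>\<^sub>0 nat"
  proof safe
    assume nz: "Poly_Mapping.lookup k i > 0"
    show "k = k - Poly_Mapping.single i 1 + Poly_Mapping.single i 1"
      using nz by (intro poly_mapping_eqI) (auto simp: lookup_add lookup_minus lookup_single when_def)
  qed (auto simp: lookup_add)
  have "Poly_Mapping.lookup (pdiff i h) m =
     (\<Sum>k\<in>Poly_Mapping.keys h. (of_nat (Poly_Mapping.lookup k i) * Poly_Mapping.lookup h k
        when k - Poly_Mapping.single i 1 = m))"
    by (simp add: pdiff_def lookup_sum lookup_single)
  also have "\<dots> = (\<Sum>k\<in>Poly_Mapping.keys h. if k = m + Poly_Mapping.single i 1
      then of_nat (Poly_Mapping.lookup k i) * Poly_Mapping.lookup h k else 0)"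
  proof (rule sum.cong[OF refl])
    fix k
    show "(of_nat (Poly_Mapping.lookup k i) * Poly_Mapping.lookup h k
            when k - Poly_Mapping.single i 1 = m) =
          (if k = m + Poly_Mapping.single i 1
           then of_nat (Poly_Mapping.lookup k i) * Poly_Mapping.lookup h k else 0)"
      using eq[of k] by (cases "Poly_Mapping.lookup k i = 0") (auto simp: when_def)
  qed
  also have "\<dots> = of_nat (Suc (Poly_Mapping.lookup m i)) *
      Poly_Mapping.lookup h (m + Poly_Mapping.single i 1)"
    by (simp add: sum.delta lookup_add in_keys_iff)
  finally show ?thesis .
qed

lemma pdiff_add: "pdiff i (p + q) = pdiff i p + pdiff i q"
  by (rule poly_mapping_eqI) (simp add: lookup_pdiff lookup_add algebra_simps)

lemma lookup_single_mult_add: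
  fixes p :: "'v::cancel_comm_monoid_add \<Rightarrow>\<^sub>0 'a::semiring_0"
  shows "Poly_Mapping.lookup (Poly_Mapping.single u c * p) (u + m) = c * Poly_Mapping.lookup p m"
proof -
  have "(\<Sum>q. Poly_Mapping.lookup p q when u + m = u + q) = Poly_Mapping.lookup p m"
    by (simp add: when_def)
  then show ?thesis
    by (simp add: lookup_mult lookup_single when_mult)
qed

lemma lookup_const_mult:
  "Poly_Mapping.lookup (const_mp c * p) m = c * Poly_Mapping.lookup p m"
  for p :: "('v \<Rightarrow>\<^sub>0 nat) \<Rightarrow>\<^sub>0 'a::semiring_0"
  using lookup_single_mult_add[of 0 c p m] by simp

lemma pdiff_const_mult: "pdiff i (const_mp c * p) = const_mp c * pdiff i p"
  by (rule poly_mapping_eqI) (simp add: lookup_pdiff lookup_const_mult del: of_nat_Suc)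

lemma pdiff_commute: "pdiff i (pdiff j p) = pdiff j (pdiff i p)"
  by (cases "i = j")
     (auto intro!: poly_mapping_eqI
        simp: lookup_pdiff lookup_add lookup_single when_def add_ac mult_ac simp del: of_nat_Suc)

lemma lookup_var_mult:
  "Poly_Mapping.lookup (var_mp j * p) m =
     (if Poly_Mapping.lookup m j = 0 then 0 else Poly_Mapping.lookup p (m - Poly_Mapping.single j 1))"
  for p :: "('v \<Rightarrow>\<^sub>0 nat) \<Rightarrow>\<^sub>0 'a::semiring_1"
proof (cases "Poly_Mapping.lookup m j = 0")
  case True
  have "m \<noteq> Poly_Mapping.single j 1 + q" for q
    using True by (auto simp: lookup_add)
  then have "(\<Sum>q. Poly_Mapping.lookup p q when m = Poly_Mapping.single j 1 + q) = 0"
    by simp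
  then show ?thesis
    using True by (simp add: var_mp_def lookup_mult lookup_single when_mult)
next
  case False
  then have m: "m = Poly_Mapping.single j 1 + (m - Poly_Mapping.single j 1)"
    by (intro poly_mapping_eqI) (auto simp: lookup_add lookup_minus lookup_single when_def)
  show ?thesis
    using False lookup_single_mult_add[of "Poly_Mapping.single j 1" 1 p "m - Poly_Mapping.single j 1"]
    by (subst m) (simp add: var_mp_def)
qed

lemma pdiff_var_mult:
  "pdiff i (var_mp j * p) = var_mp j * pdiff i p + const_mp (if i = j then 1 else 0) * p"
proof (rule poly_mapping_eqI)
  fix m
  show "Poly_Mapping.lookup (pdiff i (var_mp j * p)) m = Poly_Mapping.lookup
      (var_mp j * pdiff i p + const_mp (if i = j then 1 else 0) * p) m"
  proof (cases "Poly_Mapping.lookup m j")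
    case 0
    then show ?thesis
      by (auto simp: lookup_add lookup_pdiff lookup_var_mult lookup_const_mult lookup_single when_def)
  next
    case (Suc n)
    then have "m - Poly_Mapping.single j 1 + Poly_Mapping.single i 1 =
        m + Poly_Mapping.single i 1 - Poly_Mapping.single j 1"
      by (intro poly_mapping_eqI) (auto simp: lookup_add lookup_minus lookup_single when_def)
    with Suc show ?thesis
      by (auto simp: lookup_add lookup_pdiff lookup_var_mult lookup_const_mult lookup_minus
            lookup_single when_def ring_distribs)
  qed
qed

text \<open>
  The Weyl algebra is the \<open>F\<close>-algebra presented by the generators \<open>x\<^sub>i\<close>, \<open>\<partial>\<^sub>i\<close> and the Weyl
  relations: the quotient of the algebra expressions in the generators by the least
  congruence containing the axioms of an \<open>F\<close>-algebra and these relations.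
\<close>

datatype 'a wexp =
    WConst 'a | WX "2" | WD "2" | WPlus "'a wexp" "'a wexp" | WTimes "'a wexp" "'a wexp"

inductive weyl_eq :: "'a::field wexp \<Rightarrow> 'a wexp \<Rightarrow> bool" where
  refl: "weyl_eq p p"
| sym: "weyl_eq p q \<Longrightarrow> weyl_eq q p"
| trans: "weyl_eq p q \<Longrightarrow> weyl_eq q r \<Longrightarrow> weyl_eq p r"
| plus_cong: "weyl_eq p p' \<Longrightarrow> weyl_eq q q' \<Longrightarrow> weyl_eq (WPlus p q) (WPlus p' q')"
| times_cong: "weyl_eq p p' \<Longrightarrow> weyl_eq q q' \<Longrightarrow> weyl_eq (WTimes p q) (WTimes p' q')"
| plus_assoc: "weyl_eq (WPlus (WPlus p q) r) (WPlus p (WPlus q r))"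
| plus_comm: "weyl_eq (WPlus p q) (WPlus q p)"
| plus_zero: "weyl_eq (WPlus (WConst 0) p) p"
| plus_inv: "weyl_eq (WPlus (WTimes (WConst (- 1)) p) p) (WConst 0)"
| times_assoc: "weyl_eq (WTimes (WTimes p q) r) (WTimes p (WTimes q r))"
| times_one_left: "weyl_eq (WTimes (WConst 1) p) p"
| times_one_right: "weyl_eq (WTimes p (WConst 1)) p"
| distrib_left: "weyl_eq (WTimes p (WPlus q r)) (WPlus (WTimes p q) (WTimes p r))"
| distrib_right: "weyl_eq (WTimes (WPlus p q) r) (WPlus (WTimes p r) (WTimes q r))"
| const_plus: "weyl_eq (WConst (a + b)) (WPlus (WConst a) (WConst b))"
| const_times: "weyl_eq (WConst (a * b)) (WTimes (WConst a) (WConst b))"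
| const_central: "weyl_eq (WTimes (WConst a) p) (WTimes p (WConst a))"
| x_x: "weyl_eq (WTimes (WX i) (WX j)) (WTimes (WX j) (WX i))"
| d_d: "weyl_eq (WTimes (WD i) (WD j)) (WTimes (WD j) (WD i))"
| d_x: "weyl_eq (WTimes (WD i) (WX j))
          (WPlus (WTimes (WX j) (WD i)) (WConst (if i = j then 1 else 0)))"

quotient_type (overloaded) 'a weyl = "'a::field wexp" / weyl_eq
  by (intro equivpI reflpI sympI transpI) (fact weyl_eq.refl weyl_eq.sym weyl_eq.trans)+

primrec wexp_act :: "'a::field wexp \<Rightarrow> 'a xpoly \<Rightarrow> 'a xpoly" where
  "wexp_act (WConst c) h = const_mp c * h"
| "wexp_act (WX i) h = var_mp i * h"
| "wexp_act (WD i) h = pdiff i h"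
| "wexp_act (WPlus p q) h = wexp_act p h + wexp_act q h"
| "wexp_act (WTimes p q) h = wexp_act p (wexp_act q h)"

lemma wexp_act_add: "wexp_act p (g + h) = wexp_act p g + wexp_act p h"
  by (induction p arbitrary: g h) (simp_all add: pdiff_add ring_distribs add_ac)

lemma wexp_act_const: "wexp_act p (const_mp c * h) = const_mp c * wexp_act p h"
  by (induction p arbitrary: h) (simp_all add: pdiff_const_mult ring_distribs mult.left_commute)

lemma wexp_act_cong: "weyl_eq p q \<Longrightarrow> wexp_act p h = wexp_act q h"
proof (induction arbitrary: h rule: weyl_eq.induct)
  case (plus_inv p)
  have "const_mp (- 1) * g + g = 0" for g :: "'a xpoly"
    by (simp add: single_uminus)
  then show ?case by simp
next
  case (const_plus a b)
  then show ?case by (simp add: single_add ring_distribs)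
next
  case (const_times a b)
  then show ?case by (simp add: mult_single flip: mult.assoc)
next
  case (x_x i j)
  then show ?case by (simp add: mult.left_commute)
next
  case (d_x i j)
  then show ?case by (simp only: wexp_act.simps pdiff_var_mult)
qed (simp_all add: wexp_act_add wexp_act_const pdiff_commute add_ac)

lift_definition weyl_act :: "'a::field weyl \<Rightarrow> 'a xpoly \<Rightarrow> 'a xpoly" is wexp_act
  using wexp_act_cong by blast

lift_definition weyl_const :: "'a::field \<Rightarrow> 'a weyl" is WConst .
lift_definition weyl_x :: "2 \<Rightarrow> 'a::field weyl" is WX .
lift_definition weyl_d :: "2 \<Rightarrow> 'a::field weyl" is WD .

instantiation weyl :: (field) ring_1
begin

lift_definition zero_weyl :: "'a weyl" is "WConst 0" .
lift_definition one_weyl :: "'a weyl" is "WConst 1" .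
lift_definition plus_weyl :: "'a weyl \<Rightarrow> 'a weyl \<Rightarrow> 'a weyl" is WPlus
  by (rule weyl_eq.plus_cong)
lift_definition times_weyl :: "'a weyl \<Rightarrow> 'a weyl \<Rightarrow> 'a weyl" is WTimes
  by (rule weyl_eq.times_cong)
lift_definition uminus_weyl :: "'a weyl \<Rightarrow> 'a weyl" is "WTimes (WConst (- 1))"
  by (intro weyl_eq.times_cong weyl_eq.refl)
definition minus_weyl :: "'a weyl \<Rightarrow> 'a weyl \<Rightarrow> 'a weyl" where "minus_weyl p q = p + - q"

instance
proof (intro_classes)
  fix p q r :: "'a weyl"
  show "p + q + r = p + (q + r)" by transfer (rule weyl_eq.plus_assoc)
  show "p + q = q + p" by transfer (rule weyl_eq.plus_comm)
  show "0 + p = p" by transfer (rule weyl_eq.plus_zero)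
  show "- p + p = 0" by transfer (rule weyl_eq.plus_inv)
  show "p - q = p + - q" by (rule minus_weyl_def)
  show "p * q * r = p * (q * r)" by transfer (rule weyl_eq.times_assoc)
  show "1 * p = p" by transfer (rule weyl_eq.times_one_left)
  show "p * 1 = p" by transfer (rule weyl_eq.times_one_right)
  show "(p + q) * r = p * r + q * r" by transfer (rule weyl_eq.distrib_right)
  show "p * (q + r) = p * q + p * r" by transfer (rule weyl_eq.distrib_left)
next
  have "weyl_act (0 :: 'a weyl) 1 = 0" by transfer simp
  moreover have "weyl_act (1 :: 'a weyl) 1 = 1" by transfer simp
  ultimately show "(0 :: 'a weyl) \<noteq> 1" by auto
qed

end

lemma weyl_const_0: "weyl_const 0 = 0" and weyl_const_1: "weyl_const 1 = 1"
  by (transfer, rule weyl_eq.refl)+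

lemma weyl_relations:
  "weyl_x i * weyl_x j = weyl_x j * weyl_x i"
  "weyl_d i * weyl_d j = weyl_d j * weyl_d i"
  "weyl_d i * weyl_x j = weyl_x j * weyl_d i + (if i = j then 1 else 0)"
proof -
  show "weyl_x i * weyl_x j = weyl_x j * weyl_x i" by transfer (rule weyl_eq.x_x)
  show "weyl_d i * weyl_d j = weyl_d j * weyl_d i" by transfer (rule weyl_eq.d_d)
  have "weyl_d i * weyl_x j = weyl_x j * weyl_d i + weyl_const (if i = j then 1 else 0)"
    by transfer (rule weyl_eq.d_x)
  then show "weyl_d i * weyl_x j = weyl_x j * weyl_d i + (if i = j then 1 else 0)"
    by (simp add: weyl_const_0 weyl_const_1 split: if_splits)
qed

primrec wexp_fourier :: "'a::field wexp \<Rightarrow> 'a wexp" where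
  "wexp_fourier (WConst c) = WConst c"
| "wexp_fourier (WX i) = WD i"
| "wexp_fourier (WD i) = WTimes (WConst (- 1)) (WX i)"
| "wexp_fourier (WPlus p q) = WPlus (wexp_fourier p) (wexp_fourier q)"
| "wexp_fourier (WTimes p q) = WTimes (wexp_fourier p) (wexp_fourier q)"

lemma wexp_fourier_cong: "weyl_eq p q \<Longrightarrow> weyl_eq (wexp_fourier p) (wexp_fourier q)"
proof (induction rule: weyl_eq.induct)
  case (sym p q)
  then show ?case by (blast intro: weyl_eq.sym)
next
  case (trans p q r)
  then show ?case by (blast intro: weyl_eq.trans)
next
  case (d_d i j)
  have "- weyl_x i * - weyl_x j = - weyl_x j * (- weyl_x i :: 'a weyl)"
    by (simp add: weyl_relations(1))
  then show ?case unfolding wexp_fourier.simps by transfer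
next
  case (d_x i j)
  have "- weyl_x i * weyl_d j = weyl_d j * - weyl_x i +
      (weyl_const (if i = j then 1 else 0) :: 'a weyl)"
    by (simp add: weyl_relations(3) weyl_const_0 weyl_const_1)
  then show ?case unfolding wexp_fourier.simps by transfer
qed (simp_all add: weyl_eq.refl weyl_eq.plus_cong weyl_eq.times_cong weyl_eq.plus_assoc
      weyl_eq.plus_comm weyl_eq.plus_zero weyl_eq.plus_inv weyl_eq.times_assoc
      weyl_eq.times_one_left weyl_eq.times_one_right weyl_eq.distrib_left weyl_eq.distrib_right
      weyl_eq.const_plus weyl_eq.const_times weyl_eq.const_central weyl_eq.d_d)

lift_definition weyl_fourier :: "'a::field weyl \<Rightarrow> 'a weyl" is wexp_fourier
  by (rule wexp_fourier_cong)

lemma weyl_fourier_simps: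
  "weyl_fourier (weyl_const c) = weyl_const c"
  "weyl_fourier (weyl_x i) = weyl_d i"
  "weyl_fourier (weyl_d i) = - weyl_x i"
  "weyl_fourier (p + q) = weyl_fourier p + weyl_fourier q"
  "weyl_fourier (p * q) = weyl_fourier p * weyl_fourier q"
  "weyl_fourier (- p) = - weyl_fourier p"
  by (transfer, simp add: weyl_eq.refl)+

lemma weyl_induct [case_names const x d plus times]:
  assumes "\<And>c. P (weyl_const c)" "\<And>i. P (weyl_x i)" "\<And>i. P (weyl_d i)"
    and "\<And>p q. P p \<Longrightarrow> P q \<Longrightarrow> P (p + q)" "\<And>p q. P p \<Longrightarrow> P q \<Longrightarrow> P (p * q)"
  shows "P p"
proof -
  have "P (abs_weyl e)" for e
  proof (induction e)
    case (WPlus e1 e2)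
    then show ?case using assms(4) by (metis plus_weyl.abs_eq)
  next
    case (WTimes e1 e2)
    then show ?case using assms(5) by (metis times_weyl.abs_eq)
  qed (use assms(1-3) in \<open>simp_all add: weyl_const_def weyl_x_def weyl_d_def\<close>)
  then show ?thesis by (induction p rule: weyl.abs_induct)
qed

lemma bij_weyl_fourier: "bij (weyl_fourier :: 'a::field weyl \<Rightarrow> 'a weyl)"
proof -
  have "weyl_fourier (weyl_fourier (weyl_fourier (weyl_fourier p))) = p" for p :: "'a weyl"
    by (induction p rule: weyl_induct) (simp_all add: weyl_fourier_simps)
  then show ?thesis
    by (intro o_bij[of "weyl_fourier \<circ> weyl_fourier \<circ> weyl_fourier"]) (simp_all add: fun_eq_iff)
qed

lemma weyl_act_simps:
  "weyl_act (weyl_const c) h = const_mp c * h"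
  "weyl_act (weyl_x i) h = var_mp i * h"
  "weyl_act (weyl_d i) h = pdiff i h"
  by (simp_all add: weyl_const_def weyl_x_def weyl_d_def weyl_act.abs_eq)

lemma weyl_act_plus: "weyl_act (p + q) h = weyl_act p h + weyl_act q h"
  by (induction p rule: weyl.abs_induct, induction q rule: weyl.abs_induct)
     (simp add: plus_weyl.abs_eq weyl_act.abs_eq)

lemma weyl_act_times: "weyl_act (p * q) h = weyl_act p (weyl_act q h)"
  by (induction p rule: weyl.abs_induct, induction q rule: weyl.abs_induct)
     (simp add: times_weyl.abs_eq weyl_act.abs_eq)

lemma weyl_act_add: "weyl_act p (g + h) = weyl_act p g + weyl_act p h"
  by (induction p rule: weyl.abs_induct) (simp add: weyl_act.abs_eq wexp_act_add)


section \<open>The ring \<open>\<T>\<close> and its action on \<open>S\<close>\<close>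

text \<open>\<open>\<T>\<close> is the polynomial ring over the Weyl algebra in the central variables \<open>T\<^sub>i\<close>.\<close>

type_synonym 'a weyl_T = "(3 \<Rightarrow>\<^sub>0 nat) \<Rightarrow>\<^sub>0 'a weyl"

definition xpoly_to_weyl :: "'a::field xpoly \<Rightarrow> 'a weyl" where
  "xpoly_to_weyl p =
     (\<Sum>m\<in>Poly_Mapping.keys p. weyl_const (Poly_Mapping.lookup p m) *
        weyl_x 1 ^ Poly_Mapping.lookup m 1 * weyl_x 2 ^ Poly_Mapping.lookup m 2)"

text \<open>
  The inclusion \<open>S \<subseteq> \<T>\<close>, the Fourier transform of \<open>\<T>\<close> and the action of \<open>\<T>\<close> on \<open>S\<close> are the
  \<open>T\<close>-linear extensions of the corresponding maps for the Weyl algebra.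
\<close>

definition S_to_T :: "'a::field spoly \<Rightarrow> 'a weyl_T" where
  "S_to_T = Poly_Mapping.map xpoly_to_weyl"

definition fourier :: "'a::field weyl_T \<Rightarrow> 'a weyl_T" where
  "fourier = Poly_Mapping.map weyl_fourier"

definition T_act :: "'a::field weyl_T \<Rightarrow> 'a spoly \<Rightarrow> 'a spoly" where
  "T_act P h =
     (\<Sum>m\<in>Poly_Mapping.keys P. \<Sum>n\<in>Poly_Mapping.keys h.
        Poly_Mapping.single (m + n) (weyl_act (Poly_Mapping.lookup P m) (Poly_Mapping.lookup h n)))"

definition Sol :: "'a::field weyl_T \<Rightarrow> 'a weyl_T \<Rightarrow> 'a spoly set" where
  "Sol L1 L2 = {h. T_act L1 h = 0 \<and> T_act L2 h = 0}"

definition Sol_module :: "'a::field weyl_T \<Rightarrow> 'a weyl_T \<Rightarrow> ('a spoly, 'a spoly) bigraded_module" where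
  "Sol_module L1 L2 =
     \<lparr>carrier = Sol L1 L2,
      monoid.mult = undefined, one = undefined,
      zero = 0, add = (+),
      module.smult = (\<lambda>s h. T_act (fourier (S_to_T s)) h),
      piece = (\<lambda>i j. Sol L1 L2 \<inter> S_piece i (- j))\<rparr>"

end

theory Submission
  imports Defs "HOL-Computational_Algebra.Polynomial_Factorial"
begin

text \<open>
  Let \<open>\<mm> = (x\<^sub>1, x\<^sub>2)\<close>. The kernel \<open>\<K>\<close> is the \<open>\<mm>\<close>-torsion of \<open>Sym(I) = S/(g\<^sub>1, g\<^sub>2)\<close>, and torsion is
  zeroth local cohomology. Since \<open>g\<^sub>1, g\<^sub>2\<close> is a regular sequence, its Koszul complex resolves
  \<open>Sym(I)\<close>; as \<open>H\<^sup>0\<close> and \<open>H\<^sup>1\<close> of \<open>S\<close> with support in \<open>\<mm>\<close> vanish, the torsion of \<open>Sym(I)\<close> is,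
  up to the shift by the bidegree \<open>(2, d)\<close> of \<open>g\<^sub>1g\<^sub>2\<close>, the submodule of \<open>H\<^sup>2\<^sub>\<mm>(S)\<close> killed by \<open>g\<^sub>1\<close> and \<open>g\<^sub>2\<close>.
  That module has the basis \<open>x\<^sup>-\<^sup>1\<^sup>-\<^sup>k\<close> over \<open>F[T]\<close>. In characteristic zero \<open>x\<^sup>-\<^sup>1\<^sup>-\<^sup>k \<mapsto> x\<^sup>k/k!\<close> identifies
  it with \<open>S\<close>, up to the degree \<open>-2\<close> of the generator \<open>x\<^sup>-\<^sup>1\<close>, so that multiplication by \<open>x\<^sub>j\<close> turns
  into \<open>\<partial>\<^sub>j\<close>: this is Macaulay's inverse system. Hence being killed by \<open>g\<^sub>k\<close> turns into being a solution of \<open>L\<^sub>k = \<F>(g\<^sub>k)\<close>.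

  The proof makes the isomorphism of local cohomology explicit. A torsion class \<open>s\<close> has expressions
  \<open>x\<^sub>1\<^sup>N s = a g\<^sub>1 + b g\<^sub>2\<close> and \<open>x\<^sub>2\<^sup>N s = a' g\<^sub>1 + b' g\<^sub>2\<close>. Comparing them yields a syzygy of \<open>g\<^sub>1, g\<^sub>2\<close>, that is,
  \<open>x\<^sub>2\<^sup>N a - x\<^sub>1\<^sup>N a' = c g\<^sub>2\<close> and \<open>x\<^sub>2\<^sup>N b - x\<^sub>1\<^sup>N b' = - c g\<^sub>1\<close>, and \<open>s\<close> corresponds to the class of
  \<open>c / (x\<^sub>1x\<^sub>2)\<^sup>N\<close>. The relation \<open>corr\<close> records this without choices; it is additive, \<open>S\<close>-linear and
  graded by construction. It is total on the kernel of \<open>S \<rightarrow> Rees(I)\<close> (\<open>corr_total\<close>), reaches every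
  solution (\<open>corr_surj\<close>), and matches \<open>(g\<^sub>1, g\<^sub>2)\<close> with \<open>0\<close> (\<open>corr_zero_iff_mem\<close>).

  Two facts about \<open>I\<close> feed this. Height two puts powers of \<open>x\<^sub>1\<close> and \<open>x\<^sub>2\<close> into \<open>I\<close>
  (\<open>X_power_in_height_two_ideal\<close>). As the columns of \<open>\<phi>\<close> generate the syzygies of the \<open>f\<^sub>i\<close>,
  the sequence \<open>g\<^sub>1, g\<^sub>2\<close> is regular (\<open>regular_sequence\<close>) and the kernel is torsion
  (\<open>kernel_to_Rees_torsion\<close>); both follow from the substitution argument
  \<open>power_mult_mem_of_graded_eval_zero\<close>. The presentation \<open>Sym(I) = S/(g\<^sub>1, g\<^sub>2)\<close> is \<open>carrier_Sym\<close> together with \<open>\<pi>_eq_iff\<close>.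
\<close>


section \<open>Polynomials as finitely supported maps\<close>

abbreviation lookup :: "('k \<Rightarrow>\<^sub>0 'b::zero) \<Rightarrow> 'k \<Rightarrow> 'b" where
  "lookup \<equiv> Poly_Mapping.lookup"
abbreviation single :: "'k \<Rightarrow> 'b \<Rightarrow> 'k \<Rightarrow>\<^sub>0 'b::zero" where
  "single \<equiv> Poly_Mapping.single"
abbreviation keys :: "('k \<Rightarrow>\<^sub>0 'b::zero) \<Rightarrow> 'k set" where
  "keys \<equiv> Poly_Mapping.keys"

lemma sum_singles_superset:
  assumes "finite A" "keys p \<subseteq> A"
  shows "p = (\<Sum>k\<in>A. single k (lookup p k))"
proof (rule poly_mapping_eqI)
  fix k
  have "(\<Sum>l\<in>A. lookup (single l (lookup p l)) k) = (\<Sum>l\<in>A. if l = k then lookup p k else 0)"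
    by (rule sum.cong) (auto simp: lookup_single)
  also have "\<dots> = lookup p k"
    using assms by (auto simp: sum.delta in_keys_iff)
  finally show "lookup p k = lookup (\<Sum>k\<in>A. single k (lookup p k)) k"
    by (simp add: lookup_sum)
qed

lemma poly_mapping_induct [case_names single add]:
  fixes p :: "'k \<Rightarrow>\<^sub>0 'b::comm_monoid_add"
  assumes single: "\<And>k v. P (single k v)"
    and add: "\<And>p q. P p \<Longrightarrow> P q \<Longrightarrow> P (p + q)"
  shows "P p"
proof -
  have "P (\<Sum>k\<in>A. single k (lookup p k))" if "finite A" for A
    using that
  proof induction
    case empty
    show ?case using single[of undefined 0] by simp
  qed (simp add: single add)
  then have "P (\<Sum>k\<in>keys p. single k (lookup p k))" by simp
  then show ?thesis by (subst sum_singles_superset[of "keys p" p]) auto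
qed

lemma spoly_induct [case_names monomial add]:
  fixes s :: "'a::field spoly"
  assumes monomial: "\<And>m k a. P (single m (single k a))"
    and add: "\<And>p q. P p \<Longrightarrow> P q \<Longrightarrow> P (p + q)"
  shows "P s"
proof (induction s rule: poly_mapping_induct)
  case (single m p)
  show ?case
    by (induction p rule: poly_mapping_induct) (simp_all add: monomial add single_add)
qed (rule add)

locale unital_hom =
  fixes h :: "'r::comm_ring_1 \<Rightarrow> 's::comm_ring_1"
  assumes add: "h (a + b) = h a + h b"
    and mult: "h (a * b) = h a * h b"
    and one: "h 1 = 1"
begin

lemma zero: "h 0 = 0"
  using add[of 0 0] by simp

lemma uminus: "h (- a) = - h a"
  using add[of a "- a"] by (simp add: zero eq_neg_iff_add_eq_0 add.commute)

lemma diff: "h (a - b) = h a - h b"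
  using add[of a "- b"] by (simp add: uminus)

lemma sum: "h (sum f A) = (\<Sum>x\<in>A. h (f x))"
  by (induction A rule: infinite_finite_induct) (simp_all add: zero add)

lemma prod: "h (prod f A) = (\<Prod>x\<in>A. h (f x))"
  by (induction A rule: infinite_finite_induct) (simp_all add: one mult)

lemma power: "h (a ^ n) = h a ^ n"
  by (induction n) (simp_all add: one mult)

end

lemma unital_hom_comp: "unital_hom g \<Longrightarrow> unital_hom h \<Longrightarrow> unital_hom (\<lambda>x. g (h x))"
  by (simp add: unital_hom_def)

lemma unital_hom_const_mp:
  "unital_hom (const_mp :: 'r::comm_ring_1 \<Rightarrow> ('v \<Rightarrow>\<^sub>0 nat) \<Rightarrow>\<^sub>0 'r)"
  by standard (simp_all add: single_add mult_single)

lemma unital_hom_const_poly: "unital_hom (\<lambda>r::'r::comm_ring_1. [:r:])"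
  by standard (simp_all add: one_pCons)


section \<open>Evaluation homomorphisms\<close>

definition monom_val :: "('v \<Rightarrow> 's::comm_ring_1) \<Rightarrow> ('v \<Rightarrow>\<^sub>0 nat) \<Rightarrow> 's" where
  "monom_val y m = (\<Prod>v\<in>keys m. y v ^ lookup m v)"

lemma monom_val_superset:
  "finite A \<Longrightarrow> keys m \<subseteq> A \<Longrightarrow> monom_val y m = (\<Prod>v\<in>A. y v ^ lookup m v)"
  unfolding monom_val_def by (rule prod.mono_neutral_left) (auto simp: in_keys_iff)

lemma monom_val_zero [simp]: "monom_val y 0 = 1"
  by (simp add: monom_val_def)

lemma monom_val_add: "monom_val y (m + n) = monom_val y m * monom_val y n"
proof -
  let ?A = "keys m \<union> keys n"
  have "keys (m + n) \<subseteq> ?A" by (rule keys_add)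
  then show ?thesis
    by (simp add: monom_val_superset[of ?A] lookup_add power_add prod.distrib)
qed

lemma monom_val_single: "monom_val y (single v n) = y v ^ n"
  by (simp add: monom_val_def)

lemma monom_val_var: "monom_val var_mp m = (single m 1 :: ('v \<Rightarrow>\<^sub>0 nat) \<Rightarrow>\<^sub>0 'r::comm_ring_1)"
proof -
  have pow: "var_mp v ^ n = (single (single v n) 1 :: ('v \<Rightarrow>\<^sub>0 nat) \<Rightarrow>\<^sub>0 'r)" for v n
    by (induction n) (simp_all add: var_mp_def mult_single flip: single_add)
  have "(\<Prod>v\<in>A. single (single v (lookup m v)) 1) =
      (single (\<Sum>v\<in>A. single v (lookup m v)) 1 :: ('v \<Rightarrow>\<^sub>0 nat) \<Rightarrow>\<^sub>0 'r)" for A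
    by (induction A rule: infinite_finite_induct) (simp_all add: mult_single)
  then show ?thesis
    by (simp add: monom_val_def pow flip: sum_singles_superset)
qed

lemma single_eq_const_times_monom:
  "single m r = const_mp r * (monom_val var_mp m :: ('v \<Rightarrow>\<^sub>0 nat) \<Rightarrow>\<^sub>0 'r::comm_ring_1)"
  by (simp add: monom_val_var mult_single)

context
  fixes c :: "'r::comm_ring_1 \<Rightarrow> 's::comm_ring_1" and y :: "'v \<Rightarrow> 's"
  assumes c: "unital_hom c"
begin

interpretation c: unital_hom c by (rule c)

lemma eval_mp_superset:
  "finite A \<Longrightarrow> keys p \<subseteq> A \<Longrightarrow> eval_mp c y p = (\<Sum>m\<in>A. c (lookup p m) * monom_val y m)"
  unfolding eval_mp_def monom_val_def
  by (rule sum.mono_neutral_left) (auto simp: in_keys_iff c.zero)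

lemma eval_mp_single: "eval_mp c y (single m r) = c r * monom_val y m"
  by (simp add: eval_mp_superset[of "{m}"])

lemma eval_mp_const: "eval_mp c y (const_mp r) = c r"
  by (simp add: eval_mp_single)

lemma eval_mp_var: "eval_mp c y (var_mp v) = y v"
  by (simp add: var_mp_def eval_mp_single monom_val_single c.one)

lemma eval_mp_add: "eval_mp c y (p + q) = eval_mp c y p + eval_mp c y q"
  using keys_add[of p q]
  by (simp add: eval_mp_superset[of "keys p \<union> keys q"] lookup_add c.add ring_distribs sum.distrib)

lemma unital_hom_eval_mp: "unital_hom (eval_mp c y)"
proof
  show "eval_mp c y (p + q) = eval_mp c y p + eval_mp c y q" for p q by (rule eval_mp_add)
  show "eval_mp c y (p * q) = eval_mp c y p * eval_mp c y q" for p q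
  proof (induction p rule: poly_mapping_induct)
    case (single m r)
    show ?case
      by (induction q rule: poly_mapping_induct)
         (simp_all add: mult_single eval_mp_single eval_mp_add monom_val_add c.mult ring_distribs mult_ac)
  qed (simp add: eval_mp_add ring_distribs)
  show "eval_mp c y 1 = 1" using eval_mp_const[of 1] by (simp add: c.one)
qed

end

lemma unital_hom_monom_val: "unital_hom h \<Longrightarrow> h (monom_val y m) = monom_val (\<lambda>v. h (y v)) m"
  by (simp add: monom_val_def unital_hom.prod unital_hom.power)

lemma unital_hom_eqI:
  fixes g h :: "(('v \<Rightarrow>\<^sub>0 nat) \<Rightarrow>\<^sub>0 'r::comm_ring_1) \<Rightarrow> 's::comm_ring_1"
  assumes g: "unital_hom g" and h: "unital_hom h"
    and const: "\<And>r. g (const_mp r) = h (const_mp r)" and var: "\<And>v. g (var_mp v) = h (var_mp v)"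
  shows "g p = h p"
proof (induction p rule: poly_mapping_induct)
  case (single m r)
  have "monom_val (\<lambda>v. g (var_mp v)) m = monom_val (\<lambda>v. h (var_mp v)) m" by (simp add: var)
  then have "g (const_mp r * monom_val var_mp m) = h (const_mp r * monom_val var_mp m)"
    by (simp only: unital_hom.mult[OF g] unital_hom.mult[OF h] const
        unital_hom_monom_val[OF g] unital_hom_monom_val[OF h])
  then show ?case by (simp add: mult_single monom_val_var)
next
  case (add p q)
  then show ?case by (simp add: unital_hom.add[OF g] unital_hom.add[OF h])
qed

section \<open>Coefficientwise operations on \<open>S\<close>\<close>

abbreviation cf :: "'a::zero spoly \<Rightarrow> (3 \<Rightarrow>\<^sub>0 nat) \<Rightarrow> (2 \<Rightarrow>\<^sub>0 nat) \<Rightarrow> 'a" where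
  "cf s m k \<equiv> lookup (lookup s m) k"

lemma spoly_eqI: "(\<And>m k. cf s m k = cf t m k) \<Longrightarrow> s = t"
  by (intro poly_mapping_eqI)

definition supp :: "'a::zero spoly \<Rightarrow> ((3 \<Rightarrow>\<^sub>0 nat) \<times> (2 \<Rightarrow>\<^sub>0 nat)) set" where
  "supp s = {(m, k). cf s m k \<noteq> 0}"

lemma finite_supp: "finite (supp s)"
proof -
  have "supp s \<subseteq> (SIGMA m : keys s. keys (lookup s m))"
    by (auto simp: supp_def in_keys_iff)
  then show ?thesis by (rule finite_subset) simp
qed

text \<open>
  Every coefficientwise operation below moves exponents of the \<open>x\<^sub>j\<close> injectively and rescales
  coefficients; this one operator covers shifts, homogeneous components and the
  inverse-system reflection.
\<close>

definition recoeff ::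
  "((3 \<Rightarrow>\<^sub>0 nat) \<Rightarrow> (2 \<Rightarrow>\<^sub>0 nat) \<Rightarrow> 'a) \<Rightarrow> ((2 \<Rightarrow>\<^sub>0 nat) \<Rightarrow> (2 \<Rightarrow>\<^sub>0 nat)) \<Rightarrow> 'a::field spoly \<Rightarrow> 'a spoly"
where
  "recoeff w e s = Abs_poly_mapping (\<lambda>m. Abs_poly_mapping (\<lambda>k. w m k * cf s m (e k)))"

lemma cf_recoeff:
  assumes inj: "inj_on e {k. \<exists>m. w m k \<noteq> 0}"
  shows "cf (recoeff w e s) m k = w m k * cf s m (e k)"
proof -
  have fin: "finite {(m, k). w m k * cf s m (e k) \<noteq> 0}" (is "finite ?A")
  proof (rule finite_imageD)
    show "finite ((\<lambda>(m, k). (m, e k)) ` ?A)"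
      by (rule finite_subset[OF _ finite_supp[of s]]) (auto simp: supp_def)
    show "inj_on (\<lambda>(m, k). (m, e k)) ?A"
      using inj by (auto simp: inj_on_def)
  qed
  have inner: "finite {k. w m k * cf s m (e k) \<noteq> 0}" for m
    by (rule finite_subset[OF _ finite_imageI[OF fin, of snd]]) force
  then have look: "lookup (Abs_poly_mapping (\<lambda>k. w m k * cf s m (e k))) = (\<lambda>k. w m k * cf s m (e k))" for m
    by simp
  have "finite {m. Abs_poly_mapping (\<lambda>k. w m k * cf s m (e k)) \<noteq> 0}"
  proof (rule finite_subset[OF _ finite_imageI[OF fin, of fst]], safe)
    fix m assume "Abs_poly_mapping (\<lambda>k. w m k * cf s m (e k)) \<noteq> 0"
    then obtain k where "lookup (Abs_poly_mapping (\<lambda>k. w m k * cf s m (e k))) k \<noteq> 0"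
      using poly_mapping_eqI[of "Abs_poly_mapping (\<lambda>k. w m k * cf s m (e k))" 0] by auto
    then have "(m, k) \<in> ?A" unfolding look by simp
    then show "m \<in> fst ` ?A" by force
  qed
  then show ?thesis
    unfolding recoeff_def by (simp add: look)
qed

definition X :: "2 \<Rightarrow> 'a::field spoly" where
  "X j = const_mp (var_mp j)"

lemma cf_X_mult:
  "cf (X j * s) m k = (if lookup k j = 0 then 0 else cf s m (k - single j 1))"
  by (simp add: X_def lookup_const_mult lookup_var_mult)

lemma cf_X_power_mult:
  "cf (X j ^ N * s) m k = (if lookup k j < N then 0 else cf s m (k - single j N))"
proof (induction N arbitrary: s k)
  case (Suc N)
  have "X j ^ Suc N * s = X j ^ N * (X j * s)" by (simp add: mult_ac)
  then have "cf (X j ^ Suc N * s) m k = (if lookup k j < N then 0 else cf (X j * s) m (k - single j N))"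
    by (simp only: Suc.IH)
  moreover have "k - single j N - single j 1 = k - single j (Suc N)"
    by (simp add: diff_diff_eq flip: single_add)
  moreover have "lookup (k - single j N) j = lookup k j - N" by (simp add: lookup_minus)
  ultimately show ?case
    by (auto simp: cf_X_mult simp del: power_Suc)
qed simp

text \<open>
  Reading divisibility off the coefficients avoids any appeal to unique factorization in \<open>S\<close>.
\<close>

lemma X_power_dvd_iff: "X j ^ N dvd s \<longleftrightarrow> (\<forall>m k. lookup k j < N \<longrightarrow> cf s m k = 0)"
proof
  assume "X j ^ N dvd s"
  then show "\<forall>m k. lookup k j < N \<longrightarrow> cf s m k = 0"
    by (auto elim!: dvdE simp: cf_X_power_mult)
next
  assume *: "\<forall>m k. lookup k j < N \<longrightarrow> cf s m k = 0"
  define q where "q = recoeff (\<lambda>_ _. 1) (\<lambda>k. k + single j N) s"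
  have q: "cf q m k = cf s m (k + single j N)" for m k
    by (simp add: q_def cf_recoeff)
  have "s = X j ^ N * q"
  proof (rule spoly_eqI)
    fix m k
    have "k - single j N + single j N = k" if "\<not> lookup k j < N"
      using that by (intro poly_mapping_eqI) (auto simp: lookup_add lookup_minus lookup_single when_def)
    then show "cf s m k = cf (X j ^ N * q) m k"
      using * by (auto simp: cf_X_power_mult q)
  qed
  then show "X j ^ N dvd s" by simp
qed

text \<open>
  Multiplication by \<open>x\<^sub>j\<^sup>N\<close> leaves the exponents of \<open>x\<^sub>i\<close> alone.
\<close>

lemma X_power_coprime:
  assumes "i \<noteq> j" and "X i ^ M dvd X j ^ N * s"
  shows "X i ^ M dvd s"
  unfolding X_power_dvd_iff
proof safe
  fix m k assume k: "lookup k i < M"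
  then have "cf (X j ^ N * s) m (k + single j N) = 0"
    using assms by (simp add: X_power_dvd_iff lookup_add lookup_single when_def)
  then show "cf s m k = 0" by (simp add: cf_X_power_mult lookup_add)
qed

lemma X_neq_0: "X j \<noteq> (0 :: 'a::field spoly)"
proof
  assume "X j = (0 :: 'a spoly)"
  then have "cf (X j * (1 :: 'a spoly)) 0 (single j 1) = 0" by simp
  then show False unfolding cf_X_mult by simp
qed


text \<open>The ideal \<open>(x\<^sub>i\<^sup>N, x\<^sub>j\<^sup>N)\<close> is spanned by the monomials outside the box of exponents below \<open>N\<close>.\<close>

lemma mem_ideal_X_powers_iff:
  assumes "i \<noteq> j"
  shows "(\<exists>a b. s = X i ^ N * a + X j ^ N * b) \<longleftrightarrow>
    (\<forall>m k. lookup k i < N \<and> lookup k j < N \<longrightarrow> cf s m k = 0)"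
proof
  assume "\<forall>m k. lookup k i < N \<and> lookup k j < N \<longrightarrow> cf s m k = 0"
  define p where "p = recoeff (\<lambda>_ k. if lookup k i < N then 0 else 1) (\<lambda>k. k) s"
  have p: "cf p m k = (if lookup k i < N then 0 else cf s m k)" for m k
    by (simp add: p_def cf_recoeff)
  have "X i ^ N dvd p" by (simp add: X_power_dvd_iff p)
  moreover have "X j ^ N dvd s - p"
    using \<open>\<forall>m k. _\<close> by (simp add: X_power_dvd_iff p lookup_minus)
  ultimately obtain a b where "p = X i ^ N * a" "s - p = X j ^ N * b" by (auto elim!: dvdE)
  then show "\<exists>a b. s = X i ^ N * a + X j ^ N * b" by (metis add.commute diff_add_cancel)
qed (auto simp: lookup_add cf_X_power_mult)

lemma UNIV_2: "(UNIV :: 2 set) = {1, 2}" and one_neq_two: "(1 :: 2) \<noteq> 2"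
proof -
  show "(1 :: 2) \<noteq> 2" by simp
  have "card {1, 2 :: 2} = 2" by simp
  then have "card {1, 2 :: 2} = card (UNIV :: 2 set)" by simp
  then show "(UNIV :: 2 set) = {1, 2}"
    by (metis card_subset_eq finite_class.finite_UNIV subset_UNIV)
qed

lemma exhaust_2: "i = 1 \<or> i = 2" for i :: 2
  using UNIV_2 by blast


lemma spoly_sum_monomials:
  fixes s :: "'a::field spoly"
  shows "s = (\<Sum>(m, k)\<in>supp s. single m (single k (cf s m k)))"
proof (rule spoly_eqI)
  fix m k
  have "cf (\<Sum>(m, k)\<in>supp s. single m (single k (cf s m k))) m k =
      (\<Sum>p\<in>supp s. if p = (m, k) then cf s m k else 0)"
    by (auto simp: lookup_sum lookup_single when_def intro!: sum.cong)
  also have "\<dots> = cf s m k"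
    using finite_supp[of s] by (auto simp: sum.delta' supp_def)
  finally show "cf s m k = cf (\<Sum>(m, k)\<in>supp s. single m (single k (cf s m k))) m k" ..
qed

lemma monomial_eq:
  "single m (single k a) =
    (single m 1 :: 'a::field spoly) * (const_mp (const_mp a) * (X 1 ^ lookup k 1 * X 2 ^ lookup k 2))"
proof -
  interpret unital_hom "const_mp :: 'a xpoly \<Rightarrow> 'a spoly" by (rule unital_hom_const_mp)
  have "single k 1 = var_mp 1 ^ lookup k 1 * (var_mp 2 ^ lookup k 2 :: 'a xpoly)"
    using monom_val_superset[of UNIV k "var_mp :: 2 \<Rightarrow> 'a xpoly"]
    by (simp add: monom_val_var) (simp add: UNIV_2)
  then have "single k a = const_mp a * (var_mp 1 ^ lookup k 1 * (var_mp 2 ^ lookup k 2))"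
    using mult_single[of 0 a k 1] by simp
  then have "(const_mp (single k a) :: 'a spoly) =
      const_mp (const_mp a) * (X 1 ^ lookup k 1 * X 2 ^ lookup k 2)"
    by (simp add: X_def mult power)
  moreover have "single m (single k a) = (single m 1 :: 'a spoly) * const_mp (single k a)"
    by (simp add: mult_single)
  ultimately show ?thesis by simp
qed

text \<open>
  Multiplicative properties need to be checked only on constants, the variables \<open>x\<^sub>j\<close> and the
  monomials in \<open>T\<close>.
\<close>

lemma spoly_generator_induct [case_names const X T add mult]:
  fixes s :: "'a::field spoly"
  assumes const: "\<And>a. P (const_mp (const_mp a))" and X: "\<And>j. P (X j)" and T: "\<And>m. P (single m 1)"
    and add: "\<And>s t. P s \<Longrightarrow> P t \<Longrightarrow> P (s + t)" and mult: "\<And>s t. P s \<Longrightarrow> P t \<Longrightarrow> P (s * t)"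
  shows "P s"
proof (induction s rule: spoly_induct)
  case (monomial m k a)
  have "P (X j ^ n)" for j n
    using const[of 1] by (induction n) (simp_all add: X mult)
  then show ?case by (subst monomial_eq) (intro mult T const)
qed (rule add)


section \<open>The action of polynomials as constant-coefficient differential operators\<close>

text \<open>
  This is the scalar multiplication of \<open>Sol(L\<^sub>1, L\<^sub>2; S)\<^sub>\<F>\<close>. The Weyl algebra is eliminated from it
  below: \<open>\<F>(S)\<close> is commutative, and \<open>x\<^sub>j\<close> acts as \<open>\<partial>\<^sub>j\<close>.
\<close>

definition act :: "'a::field spoly \<Rightarrow> 'a spoly \<Rightarrow> 'a spoly" where
  "act s h = T_act (fourier (S_to_T s)) h"

definition xact :: "'a::field xpoly \<Rightarrow> 'a xpoly \<Rightarrow> 'a xpoly" where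
  "xact p h = weyl_act (weyl_fourier (xpoly_to_weyl p)) h"

definition pdiffs :: "(2 \<Rightarrow>\<^sub>0 nat) \<Rightarrow> 'a::field xpoly \<Rightarrow> 'a xpoly" where
  "pdiffs k h = (pdiff 1 ^^ lookup k 1) ((pdiff 2 ^^ lookup k 2) h)"

lemma weyl_fourier_0: "weyl_fourier 0 = 0" and weyl_fourier_1: "weyl_fourier 1 = 1"
  using weyl_fourier_simps(1)[of 0] weyl_fourier_simps(1)[of 1]
  by (simp_all add: weyl_const_0 weyl_const_1)

lemma weyl_fourier_sum: "weyl_fourier (sum f A) = (\<Sum>x\<in>A. weyl_fourier (f x))"
  by (induction A rule: infinite_finite_induct) (simp_all add: weyl_fourier_0 weyl_fourier_simps)

lemma weyl_fourier_power: "weyl_fourier (p ^ n) = weyl_fourier p ^ n"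
  by (induction n) (simp_all add: weyl_fourier_1 weyl_fourier_simps)

lemma weyl_act_0: "weyl_act 0 h = 0" and weyl_act_1: "weyl_act 1 h = h"
  using weyl_act_simps(1)[of 0 h] weyl_act_simps(1)[of 1 h]
  by (simp_all add: weyl_const_0 weyl_const_1)

lemma weyl_act_sum: "weyl_act (sum f A) h = (\<Sum>x\<in>A. weyl_act (f x) h)"
  by (induction A rule: infinite_finite_induct) (simp_all add: weyl_act_0 weyl_act_plus)

lemma weyl_act_power: "weyl_act (p ^ n) h = (weyl_act p ^^ n) h"
  by (induction n) (simp_all add: weyl_act_1 weyl_act_times)

text \<open>
  The sum may run over any finite set containing the support, so that sums for two polynomials
  can be compared termwise.
\<close>

lemma xact_superset:
  assumes "finite A" "keys p \<subseteq> A"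
  shows "xact p h = (\<Sum>k\<in>A. const_mp (lookup p k) * pdiffs k h)"
proof -
  have *: "weyl_act (weyl_d j) = pdiff j" for j by (simp add: fun_eq_iff weyl_act_simps)
  have "xact p h = (\<Sum>k\<in>keys p. const_mp (lookup p k) * pdiffs k h)"
    by (simp add: xact_def xpoly_to_weyl_def weyl_fourier_sum weyl_act_sum weyl_fourier_simps
        weyl_fourier_power weyl_act_times weyl_act_power weyl_act_simps * pdiffs_def)
  also have "\<dots> = (\<Sum>k\<in>A. const_mp (lookup p k) * pdiffs k h)"
    by (rule sum.mono_neutral_left) (use assms in \<open>auto simp: in_keys_iff\<close>)
  finally show ?thesis .
qed

lemma xact_add_left: "xact (p + q) h = xact p h + xact q h"
  using keys_add[of p q]
  by (simp add: xact_superset[of "keys p \<union> keys q"] lookup_add single_add ring_distribs sum.distrib)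

lemma xact_add_right: "xact p (g + h) = xact p g + xact p h"
  by (simp add: xact_def weyl_act_add)

lemma xact_0_right: "xact p 0 = 0"
  by (metis xact_add_right add_cancel_right_right)

lemma xact_single: "xact (single k a) h = const_mp a * pdiffs k h"
  by (simp add: xact_superset[of "{k}"])

lemma xact_const_mult: "xact p (const_mp a * h) = const_mp a * xact p h"
proof (induction p rule: poly_mapping_induct)
  case (single k b)
  have "(pdiff j ^^ n) (const_mp a * g) = const_mp a * (pdiff j ^^ n) g" for j n and g :: "'a xpoly"
    by (induction n) (simp_all add: pdiff_const_mult)
  then show ?case by (simp add: xact_single pdiffs_def mult.left_commute)
qed (simp add: xact_add_left ring_distribs)

lemma pdiffs_add: "pdiffs (k + l) h = pdiffs k (pdiffs l h)"
proof -
  have "pdiff 1 ((pdiff 2 ^^ n) g) = (pdiff 2 ^^ n) (pdiff 1 g)" for n and g :: "'a xpoly"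
    by (induction n) (simp_all add: pdiff_commute[of 1 2])
  then have "(pdiff 1 ^^ n) ((pdiff 2 ^^ l) g) = (pdiff 2 ^^ l) ((pdiff 1 ^^ n) g)" for n l and g :: "'a xpoly"
    by (induction n) simp_all
  then show ?thesis by (simp add: pdiffs_def lookup_add funpow_add)
qed

lemma xact_mult: "xact (p * q) h = xact p (xact q h)"
proof (induction p rule: poly_mapping_induct)
  case (single k a)
  show ?case
  proof (induction q rule: poly_mapping_induct)
    case (single l b)
    have "xact (single k a) (xact (single l b) h) = const_mp b * (const_mp a * pdiffs k (pdiffs l h))"
      by (simp only: xact_single[of l] xact_const_mult) (simp only: xact_single)
    also have "\<dots> = xact (single k a * single l b) h"
      by (simp only: mult_single xact_single pdiffs_add mult.assoc[symmetric] add_0) (simp only: mult.commute)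
    finally show ?case ..
  qed (simp add: ring_distribs xact_add_left xact_add_right)
qed (simp add: ring_distribs xact_add_left)

lemma xact_var: "xact (var_mp j) h = pdiff j h"
proof -
  consider "j = 1" | "j = 2" using exhaust_2 by blast
  then show ?thesis
    by cases (simp_all add: var_mp_def xact_single pdiffs_def lookup_single_not_eq)
qed

lemma act_superset:
  assumes A: "finite A" "keys s \<subseteq> A" and B: "finite B" "keys h \<subseteq> B"
  shows "act s h = (\<Sum>m\<in>A. \<Sum>n\<in>B. single (m + n) (xact (lookup s m) (lookup h n)))"
proof -
  let ?P = "fourier (S_to_T s)"
  have look: "weyl_act (lookup ?P m) g = xact (lookup s m) g" for m g
    by (auto simp: fourier_def S_to_T_def Poly_Mapping.map.rep_eq xact_def when_def weyl_act_0
        xpoly_to_weyl_def weyl_fourier_0)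
  have keys: "keys ?P \<subseteq> A"
    using A by (auto simp: fourier_def S_to_T_def Poly_Mapping.map.rep_eq in_keys_iff)
  have "act s h = (\<Sum>m\<in>keys ?P. \<Sum>n\<in>keys h. single (m + n) (xact (lookup s m) (lookup h n)))"
    by (simp add: act_def T_act_def look)
  also have "\<dots> = (\<Sum>m\<in>keys ?P. \<Sum>n\<in>B. single (m + n) (xact (lookup s m) (lookup h n)))"
    using B by (intro sum.cong sum.mono_neutral_left) (auto simp: in_keys_iff xact_0_right)
  also have "\<dots> = (\<Sum>m\<in>A. \<Sum>n\<in>B. single (m + n) (xact (lookup s m) (lookup h n)))"
    using A keys
    by (intro sum.mono_neutral_left) (auto simp: in_keys_iff weyl_act_0 simp flip: look)
  finally show ?thesis .
qed

lemma act_add_left: "act (s + t) h = act s h + act t h"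
  using keys_add[of s t]
  by (simp add: act_superset[of "keys s \<union> keys t" _ "keys h"] lookup_add xact_add_left single_add sum.distrib)

lemma act_add_right: "act s (g + h) = act s g + act s h"
  using keys_add[of g h]
  by (simp add: act_superset[of "keys s" _ "keys g \<union> keys h"] lookup_add xact_add_right single_add sum.distrib)

lemma act_0_left: "act 0 h = 0" and act_0_right: "act s 0 = 0"
  by (metis act_add_left act_add_right add_cancel_right_right)+

lemma act_single: "act (single m p) (single n h) = single (m + n) (xact p h)"
  by (simp add: act_superset[of "{m}" _ "{n}"])

lemma act_mult: "act (s * t) h = act s (act t h)"
proof (induction s rule: poly_mapping_induct)
  case (single m p)
  show ?case
  proof (induction t rule: poly_mapping_induct)
    case (single n q)
    show ?case
      by (induction h rule: poly_mapping_induct)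
         (simp_all add: mult_single act_single act_add_right xact_mult add.assoc)
  qed (simp add: ring_distribs act_add_left act_add_right)
qed (simp add: ring_distribs act_add_left)

lemma lookup_act_const_mp: "lookup (act (const_mp p) h) m = xact p (lookup h m)"
proof (induction h rule: poly_mapping_induct)
  case (single n g)
  then show ?case by (auto simp: act_single lookup_single when_def xact_0_right)
qed (simp add: act_add_right lookup_add xact_add_right)

lemma cf_act_X: "cf (act (X j) h) m k = of_nat (Suc (lookup k j)) * cf h m (k + single j 1)"
  by (simp only: X_def lookup_act_const_mp xact_var lookup_pdiff)

lemma act_const: "act (const_mp (const_mp a)) h = const_mp (const_mp a) * h"
  by (rule poly_mapping_eqI) (simp add: lookup_act_const_mp xact_single pdiffs_def lookup_const_mult)

lemma act_T: "act (single m 1) h = single m 1 * h"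
proof (induction h rule: poly_mapping_induct)
  case (single n g)
  have "xact 1 g = g" using xact_single[of 0 1 g] by (simp add: pdiffs_def)
  then show ?case by (simp add: act_single mult_single)
qed (simp add: act_add_right ring_distribs)

lemma act_one: "act 1 h = h"
  using act_const[of 1 h] by simp


section \<open>Macaulay inverse systems\<close>

definition box :: "nat \<Rightarrow> (2 \<Rightarrow>\<^sub>0 nat) \<Rightarrow> bool" where
  "box N k \<longleftrightarrow> (\<forall>v. lookup k v < N)"

definition flip_exp :: "nat \<Rightarrow> (2 \<Rightarrow>\<^sub>0 nat) \<Rightarrow> (2 \<Rightarrow>\<^sub>0 nat)" where
  "flip_exp N k = Abs_poly_mapping (\<lambda>v. N - 1 - lookup k v)"

definition exp_fact :: "(2 \<Rightarrow>\<^sub>0 nat) \<Rightarrow> 'a::field_char_0" where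
  "exp_fact k = (\<Prod>v\<in>UNIV. fact (lookup k v))"

lemma lookup_flip_exp [simp]: "lookup (flip_exp N k) v = N - 1 - lookup k v"
  by (simp add: flip_exp_def)

lemma flip_exp_flip_exp: "box N k \<Longrightarrow> flip_exp N (flip_exp N k) = k"
proof (rule poly_mapping_eqI)
  fix v assume "box N k"
  then have "lookup k v < N" by (simp add: box_def)
  then show "lookup (flip_exp N (flip_exp N k)) v = lookup k v" by simp
qed

lemma box_flip_exp: "box N k \<Longrightarrow> box N (flip_exp N k)"
  unfolding box_def lookup_flip_exp
proof
  fix v assume "\<forall>v. lookup k v < N"
  then have "lookup k v < N" ..
  then show "N - 1 - lookup k v < N" by linarith
qed

lemma exp_fact_nonzero [simp]: "exp_fact k \<noteq> 0"
  by (simp add: exp_fact_def)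

lemma exp_fact_add_single: "exp_fact (k + single j 1) = of_nat (Suc (lookup k j)) * exp_fact k"
proof -
  have "exp_fact (k + single j 1) =
      (\<Prod>v\<in>UNIV. (if v = j then of_nat (Suc (lookup k j)) else 1) * fact (lookup k v) :: 'a)"
    unfolding exp_fact_def by (rule prod.cong) (auto simp: lookup_add lookup_single when_def)
  then show ?thesis by (simp add: prod.distrib exp_fact_def)
qed

lemma box_iff: "i \<noteq> j \<Longrightarrow> box N k \<longleftrightarrow> lookup k i < N \<and> lookup k j < N" for i j :: 2
proof
  assume "i \<noteq> j" and *: "lookup k i < N \<and> lookup k j < N"
  then have "v = i \<or> v = j" for v using exhaust_2[of i] exhaust_2[of j] exhaust_2[of v] by auto
  then show "box N k" unfolding box_def using * by metis
qed (simp add: box_def)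

text \<open>
  \<open>inv_sys N c\<close> represents the class of \<open>c / (x\<^sub>1x\<^sub>2)\<^sup>N\<close> in the second local cohomology module: the Laurent
  monomial \<open>x\<^sup>-\<^sup>1\<^sup>-\<^sup>k\<close> becomes the divided power \<open>x\<^sup>k/k!\<close>, on which multiplication by \<open>x\<^sub>j\<close> is \<open>\<partial>\<^sub>j\<close>.
\<close>

definition inv_sys :: "nat \<Rightarrow> 'a::field_char_0 spoly \<Rightarrow> 'a spoly" where
  "inv_sys N = recoeff (\<lambda>_ k. if box N k then 1 / exp_fact k else 0) (flip_exp N)"

text \<open>
  A section of \<open>inv_sys N\<close> on polynomials whose exponents lie in the box.
\<close>

definition inv_sys_lift :: "nat \<Rightarrow> 'a::field_char_0 spoly \<Rightarrow> 'a spoly" where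
  "inv_sys_lift N = recoeff (\<lambda>_ k. if box N k then exp_fact (flip_exp N k) else 0) (flip_exp N)"

lemma inj_on_flip_exp: "inj_on (flip_exp N) {k. box N k}"
  by (rule inj_on_inverseI[of _ "flip_exp N"]) (simp add: flip_exp_flip_exp)

lemma cf_inv_sys: "cf (inv_sys N c) m k = (if box N k then cf c m (flip_exp N k) / exp_fact k else 0)"
  unfolding inv_sys_def by (subst cf_recoeff) (auto intro: inj_on_subset[OF inj_on_flip_exp])

lemma cf_inv_sys_lift:
  "cf (inv_sys_lift N c) m k = (if box N k then exp_fact (flip_exp N k) * cf c m (flip_exp N k) else 0)"
  unfolding inv_sys_lift_def by (subst cf_recoeff) (auto intro: inj_on_subset[OF inj_on_flip_exp])

lemma inv_sys_add: "inv_sys N (c + c') = inv_sys N c + inv_sys N c'"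
  by (rule spoly_eqI) (simp add: cf_inv_sys lookup_add add_divide_distrib)

lemma inv_sys_lift:
  assumes "\<And>m k. cf h m k \<noteq> 0 \<Longrightarrow> box N k"
  shows "inv_sys N (inv_sys_lift N h) = h"
  by (rule spoly_eqI) (use assms in \<open>auto simp: cf_inv_sys cf_inv_sys_lift flip_exp_flip_exp box_flip_exp\<close>)

lemma inv_sys_eq_0_iff: "inv_sys N c = 0 \<longleftrightarrow> (\<forall>m k. box N k \<longrightarrow> cf c m k = 0)"
proof
  assume *: "inv_sys N c = 0"
  show "\<forall>m k. box N k \<longrightarrow> cf c m k = 0"
  proof safe
    fix m k assume "box N k"
    then show "cf c m k = 0"
      using arg_cong[OF *, of "\<lambda>h. cf h m (flip_exp N k)"]
      by (simp add: cf_inv_sys box_flip_exp flip_exp_flip_exp)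
  qed
next
  assume "\<forall>m k. box N k \<longrightarrow> cf c m k = 0"
  then show "inv_sys N c = 0"
    by (intro spoly_eqI) (simp add: cf_inv_sys box_flip_exp)
qed

lemma inv_sys_eq_0_iff_mem_ideal:
  "inv_sys N c = 0 \<longleftrightarrow> (\<exists>a b. c = X 1 ^ N * a + X 2 ^ N * b)"
  using mem_ideal_X_powers_iff[of 1 2 c N] by (simp add: inv_sys_eq_0_iff box_iff[of 1 2])

text \<open>
  On \<open>x\<^sup>k/k!\<close> the operator \<open>\<partial>\<^sub>j\<close> is a pure shift, matching the shift of \<open>x\<^sup>-\<^sup>1\<^sup>-\<^sup>k\<close> by \<open>x\<^sub>j\<close>. At the edge of the
  box, where \<open>k\<^sub>j = N - 1\<close>, both sides vanish.
\<close>

lemma inv_sys_X_mult: "inv_sys N (X j * c) = act (X j) (inv_sys N c)"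
proof (rule spoly_eqI)
  fix m k
  have box: "box N (k + single j 1) \<longleftrightarrow> box N k \<and> Suc (lookup k j) < N"
  proof
    assume *: "box N (k + single j 1)"
    have "lookup k v \<le> lookup (k + single j 1) v" for v by (simp add: lookup_add)
    with * have "box N k" unfolding box_def by (meson le_less_trans)
    moreover have "lookup (k + single j 1) j < N" using * unfolding box_def by blast
    ultimately show "box N k \<and> Suc (lookup k j) < N" by (simp add: lookup_add)
  next
    assume *: "box N k \<and> Suc (lookup k j) < N"
    show "box N (k + single j 1)" unfolding box_def
    proof
      fix v
      show "lookup (k + single j 1) v < N"
        using * unfolding box_def by (cases "v = j") (simp_all add: lookup_add lookup_single_not_eq)
    qed
  qed
  have "flip_exp N k - single j 1 = flip_exp N (k + single j 1)"
    by (rule poly_mapping_eqI) (simp add: lookup_minus lookup_add diff_diff_eq)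
  moreover have "lookup k j < N" if "box N k" using that by (simp add: box_def)
  moreover have "(of_nat (Suc n) :: 'a) * (a / (of_nat (Suc n) * b)) = a / b" for n a b
    by (simp del: of_nat_Suc)
  ultimately show "cf (inv_sys N (X j * c)) m k = cf (act (X j) (inv_sys N c)) m k"
    unfolding cf_inv_sys cf_act_X cf_X_mult box exp_fact_add_single lookup_flip_exp
    by (cases "box N k"; cases "Suc (lookup k j) < N") auto
qed

lemma inv_sys_mult: "inv_sys N (s * c) = act s (inv_sys N c)"
proof (induction s arbitrary: c rule: spoly_generator_induct)
  case (const a)
  show ?case by (rule spoly_eqI) (simp add: act_const cf_inv_sys lookup_const_mult)
next
  case (X j)
  show ?case by (rule inv_sys_X_mult)
next
  case (T n)
  have lookup_T: "lookup (single n 1 * s) m = (if m = n + (m - n) then lookup s (m - n) else 0)"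
    for s :: "'a spoly" and m
  proof (cases "m = n + (m - n)")
    case True
    then show ?thesis using lookup_single_mult_add[of n 1 s "m - n"] by simp
  next
    case False
    then have "m \<noteq> n + l" for l by auto
    then have "m \<notin> keys (single n 1 * s)" using keys_mult[of "single n 1" s] by auto
    then show ?thesis using False by (simp add: in_keys_iff)
  qed
  show ?case by (rule spoly_eqI) (simp add: act_T cf_inv_sys lookup_T)
qed (simp_all add: ring_distribs inv_sys_add act_add_left act_mult mult.assoc)

text \<open>
  The fraction \<open>c / (x\<^sub>1x\<^sub>2)\<^sup>N\<close> may be expanded by \<open>(x\<^sub>1x\<^sub>2)\<^sup>M\<close>.
\<close>

lemma inv_sys_raise: "inv_sys (N + M) (X 1 ^ M * (X 2 ^ M * c)) = inv_sys N c"
proof (rule spoly_eqI)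
  fix m k
  have "flip_exp (N + M) k - single 1 M - single 2 M = flip_exp N k" if "box N k"
  proof (rule poly_mapping_eqI)
    fix v :: 2
    show "lookup (flip_exp (N + M) k - single 1 M - single 2 M) v = lookup (flip_exp N k) v"
      using that exhaust_2[of v] by (auto simp: lookup_minus box_iff[of 1 2] lookup_single_not_eq)
  qed
  then show "cf (inv_sys (N + M) (X 1 ^ M * (X 2 ^ M * c))) m k = cf (inv_sys N c) m k"
    by (auto simp: cf_inv_sys cf_X_power_mult box_iff[of 1 2] lookup_minus lookup_single_not_eq)
qed


section \<open>The bigrading of \<open>S\<close>\<close>

lemma mdeg_finite: "mdeg m = (\<Sum>v\<in>UNIV. lookup m v)" for m :: "'v::finite \<Rightarrow>\<^sub>0 nat"
  unfolding mdeg_def by (rule sum.mono_neutral_left) (auto simp: in_keys_iff)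

lemma mdeg_add: "mdeg (m + n) = mdeg m + mdeg n" for m n :: "'v::finite \<Rightarrow>\<^sub>0 nat"
  by (simp add: mdeg_finite lookup_add sum.distrib)

lemma mdeg_single [simp]: "mdeg (single v n) = n"
  by (simp add: mdeg_def)

lemma mdeg_zero [simp]: "mdeg 0 = 0"
  by (simp add: mdeg_def)

lemma mem_S_piece_iff:
  "s \<in> S_piece i j \<longleftrightarrow> (\<forall>m k. cf s m k \<noteq> 0 \<longrightarrow> int (mdeg m) = i \<and> int (mdeg k) = j)"
proof -
  have "\<exists>k. cf s m k \<noteq> 0" if "lookup s m \<noteq> 0" for m
    using that poly_mapping_eqI[of "lookup s m" 0] by auto
  then have "lookup s m \<noteq> 0 \<longleftrightarrow> (\<exists>k. cf s m k \<noteq> 0)" for m by force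
  then show ?thesis unfolding S_piece_def mem_Collect_eq Ball_def in_keys_iff by blast
qed

lemma S_piece_zero: "0 \<in> S_piece i j"
  and S_piece_add: "s \<in> S_piece i j \<Longrightarrow> t \<in> S_piece i j \<Longrightarrow> s + t \<in> S_piece i j"
  and S_piece_uminus: "s \<in> S_piece i j \<Longrightarrow> - s \<in> S_piece i j"
  for s t :: "'a::field spoly"
proof -
  show "s \<in> S_piece i j \<Longrightarrow> t \<in> S_piece i j \<Longrightarrow> s + t \<in> S_piece i j"
    unfolding mem_S_piece_iff lookup_add by (intro allI impI) (metis add.right_neutral)
qed (simp_all add: mem_S_piece_iff)

lemma S_piece_sum: "(\<And>x. x \<in> A \<Longrightarrow> f x \<in> S_piece i j) \<Longrightarrow> sum f A \<in> S_piece i j"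
  for f :: "_ \<Rightarrow> 'a::field spoly"
  by (induction A rule: infinite_finite_induct) (auto intro: S_piece_zero S_piece_add)

lemma S_piece_monomial: "single m (single k a) \<in> S_piece (int (mdeg m)) (int (mdeg k))"
  by (auto simp: mem_S_piece_iff lookup_single when_def split: if_splits)

lemma S_piece_induct [consumes 1, case_names zero monomial add]:
  fixes s :: "'a::field spoly"
  assumes s: "s \<in> S_piece i j" and zero: "P 0"
    and monomial: "\<And>m k a. int (mdeg m) = i \<Longrightarrow> int (mdeg k) = j \<Longrightarrow> P (single m (single k a))"
    and add: "\<And>p q. P p \<Longrightarrow> P q \<Longrightarrow> P (p + q)"
  shows "P s"
proof -
  have "P (\<Sum>(m, k)\<in>A. single m (single k (cf s m k)))" if "finite A" "A \<subseteq> supp s" for A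
    using that
  proof induction
    case (insert p A)
    obtain m k where [simp]: "p = (m, k)" by (cases p)
    have "P (single m (single k (cf s m k)))"
      using s insert.prems by (intro monomial) (auto simp: mem_S_piece_iff supp_def)
    then show ?case using insert by (simp add: add)
  qed (simp add: zero)
  from this[OF finite_supp order_refl] show ?thesis
    using spoly_sum_monomials[of s] by argo
qed

lemma S_piece_mult:
  fixes s t :: "'a::field spoly"
  assumes "s \<in> S_piece i j" "t \<in> S_piece p q"
  shows "s * t \<in> S_piece (i + p) (j + q)"
  using assms(1)
proof (induction rule: S_piece_induct)
  case (monomial m k a)
  show ?case using assms(2)
  proof (induction rule: S_piece_induct)
    case (monomial n l b)
    then show ?case
      using \<open>int (mdeg m) = i\<close> \<open>int (mdeg k) = j\<close> S_piece_monomial[of "m + n" "k + l" "a * b"]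
      by (simp add: mult_single mdeg_add)
  qed (auto simp: S_piece_zero ring_distribs intro: S_piece_add)
qed (auto simp: S_piece_zero ring_distribs intro: S_piece_add)

text \<open>
  Each \<open>\<partial>\<^sub>j\<close> lowers the degree in \<open>x\<close>, whence the sign in the bigrading of the twisted module.
\<close>

lemma S_piece_act:
  fixes s h :: "'a::field spoly"
  assumes s: "s \<in> S_piece i j" and h: "h \<in> S_piece p q"
  shows "act s h \<in> S_piece (i + p) (q - j)"
  using s
proof (induction rule: S_piece_induct)
  case zero
  show ?case by (simp add: act_0_left S_piece_zero)
next
  case (add s t)
  then show ?case by (simp add: act_add_left S_piece_add)
next
  case (monomial m k a)
  have X: "act (X v) g \<in> S_piece p (r - 1)" if "g \<in> S_piece p r" for v r and g :: "'a spoly"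
    using that by (fastforce simp: mem_S_piece_iff cf_act_X mdeg_add)
  have Xs: "act (X v ^ n) g \<in> S_piece p (r - int n)" if "g \<in> S_piece p r" for v r n and g :: "'a spoly"
  proof (induction n)
    case (Suc n)
    from X[OF Suc] show ?case by (simp add: act_mult algebra_simps)
  qed (use that in \<open>simp add: act_one\<close>)
  have "act (X 1 ^ lookup k 1 * X 2 ^ lookup k 2) h \<in> S_piece p (q - int (lookup k 2) - int (lookup k 1))"
    unfolding act_mult by (intro Xs h)
  moreover have "q - int (lookup k 2) - int (lookup k 1) = q - j"
    using monomial by (simp add: mdeg_finite UNIV_2)
  moreover have "(single m 1 :: 'a spoly) \<in> S_piece i 0" "(const_mp (const_mp a) :: 'a spoly) \<in> S_piece 0 0"
    using S_piece_monomial[of m 0 "1 :: 'a"] S_piece_monomial[of 0 0 a] monomial by simp_all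
  ultimately show ?case
    by (subst monomial_eq, simp only: act_mult[of "single m 1"] act_mult[of "const_mp (const_mp a)"]
        act_T act_const) (metis S_piece_mult add_0 add.right_neutral)
qed

definition bipart :: "int \<Rightarrow> int \<Rightarrow> 'a::field spoly \<Rightarrow> 'a spoly" where
  "bipart i j = recoeff (\<lambda>m k. if int (mdeg m) = i \<and> int (mdeg k) = j then 1 else 0) (\<lambda>k. k)"

lemma cf_bipart: "cf (bipart i j s) m k = (if int (mdeg m) = i \<and> int (mdeg k) = j then cf s m k else 0)"
  by (simp add: bipart_def cf_recoeff)

lemma bipart_add: "bipart i j (s + t) = bipart i j s + bipart i j t"
  by (rule spoly_eqI) (simp add: cf_bipart lookup_add)

lemma bipart_zero [simp]: "bipart i j 0 = 0"
  by (metis bipart_add add_cancel_right_right)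

lemma bipart_uminus: "bipart i j (- s) = - bipart i j s"
  by (rule spoly_eqI) (simp add: cf_bipart)

lemma bipart_diff: "bipart i j (s - t) = bipart i j s - bipart i j t"
  using bipart_add[of i j s "- t"] by (simp add: bipart_uminus)

lemma bipart_sum: "bipart i j (sum f A) = (\<Sum>x\<in>A. bipart i j (f x))"
  by (induction A rule: infinite_finite_induct) (simp_all add: bipart_add)

lemma bipart_in_S_piece: "bipart i j s \<in> S_piece i j"
  by (simp add: mem_S_piece_iff cf_bipart)

lemma bipart_of_piece: "s \<in> S_piece p q \<Longrightarrow> bipart i j s = (if i = p \<and> j = q then s else 0)"
  by (rule spoly_eqI) (auto simp: mem_S_piece_iff cf_bipart)

definition bidegs :: "'a::field spoly \<Rightarrow> (int \<times> int) set" where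
  "bidegs s = (\<lambda>(m, k). (int (mdeg m), int (mdeg k))) ` supp s"

lemma finite_bidegs: "finite (bidegs s)"
  by (simp add: bidegs_def finite_supp)

lemma bipart_nonzero_bidegs: "bipart i j s \<noteq> 0 \<Longrightarrow> (i, j) \<in> bidegs s"
proof -
  assume "bipart i j s \<noteq> 0"
  then obtain m k where "cf (bipart i j s) m k \<noteq> 0"
    using spoly_eqI[of "bipart i j s" 0] by auto
  then show ?thesis by (force simp: cf_bipart bidegs_def supp_def split: if_splits)
qed

lemma sum_biparts:
  assumes "finite D" "bidegs s \<subseteq> D"
  shows "s = (\<Sum>(i, j)\<in>D. bipart i j s)"
proof (rule spoly_eqI)
  fix m :: "3 \<Rightarrow>\<^sub>0 nat" and k :: "2 \<Rightarrow>\<^sub>0 nat"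
  let ?d = "(int (mdeg m), int (mdeg k))"
  have "cf (\<Sum>(i, j)\<in>D. bipart i j s) m k = (\<Sum>p\<in>D. if p = ?d then cf s m k else 0)"
    by (auto simp: lookup_sum cf_bipart intro!: sum.cong)
  also have "\<dots> = cf s m k"
    using assms by (force simp: sum.delta' bidegs_def supp_def)
  finally show "cf s m k = cf (\<Sum>(i, j)\<in>D. bipart i j s) m k" ..
qed

text \<open>
  Covers multiplication by a bihomogeneous element, its action by differential operators and the
  inverse system, which reverses degrees in \<open>x\<close>.
\<close>

lemma bipart_graded_map:
  fixes \<Phi> :: "'a::field spoly \<Rightarrow> 'a spoly"
  assumes add: "\<And>s t. \<Phi> (s + t) = \<Phi> s + \<Phi> t"
    and piece: "\<And>i j s. s \<in> S_piece i j \<Longrightarrow> \<Phi> s \<in> S_piece (\<alpha> i) (\<beta> j)"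
    and inj: "inj \<alpha>" "inj \<beta>"
  shows "bipart (\<alpha> i) (\<beta> j) (\<Phi> s) = \<Phi> (bipart i j s)"
proof -
  have zero: "\<Phi> 0 = 0" by (metis add add_cancel_right_right)
  have sum: "\<Phi> (sum f A) = (\<Sum>x\<in>A. \<Phi> (f x))" for f :: "int \<times> int \<Rightarrow> 'a spoly" and A
    by (induction A rule: infinite_finite_induct) (simp_all add: zero add)
  let ?D = "insert (i, j) (bidegs s)"
  have fin: "finite ?D" by (simp add: finite_bidegs)
  have "\<Phi> s = \<Phi> (\<Sum>(i, j)\<in>?D. bipart i j s)"
    by (rule arg_cong[OF sum_biparts[OF fin]]) auto
  also have "\<dots> = (\<Sum>p\<in>?D. \<Phi> (bipart (fst p) (snd p) s))"
    by (simp only: sum case_prod_beta)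
  finally have "bipart (\<alpha> i) (\<beta> j) (\<Phi> s) = (\<Sum>p\<in>?D. bipart (\<alpha> i) (\<beta> j) (\<Phi> (bipart (fst p) (snd p) s)))"
    by (simp only: bipart_sum)
  also have "\<dots> = (\<Sum>p\<in>?D. if p = (i, j) then \<Phi> (bipart i j s) else 0)"
  proof (rule sum.cong[OF HOL.refl])
    fix p :: "int \<times> int"
    show "bipart (\<alpha> i) (\<beta> j) (\<Phi> (bipart (fst p) (snd p) s)) = (if p = (i, j) then \<Phi> (bipart i j s) else 0)"
      using bipart_of_piece[OF piece[OF bipart_in_S_piece[of "fst p" "snd p" s]], of "\<alpha> i" "\<beta> j"] inj
      by (auto simp: inj_eq prod_eq_iff)
  qed
  also have "\<dots> = \<Phi> (bipart i j s)" using fin by (simp add: sum.delta')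
  finally show ?thesis .
qed

lemma bipart_mult:
  fixes s t :: "'a::field spoly"
  assumes "s \<in> S_piece i j"
  shows "bipart (i + p) (j + q) (s * t) = s * bipart p q t"
  by (rule bipart_graded_map[where \<Phi> = "(*) s"])
     (auto simp: ring_distribs inj_def intro: S_piece_mult[OF assms])

lemma bipart_act:
  fixes s h :: "'a::field spoly"
  assumes "s \<in> S_piece i j"
  shows "bipart (i + p) (q - j) (act s h) = act s (bipart p q h)"
  by (rule bipart_graded_map[where \<Phi> = "act s" and \<beta> = "\<lambda>q. q - j"])
     (auto simp: act_add_right inj_def intro: S_piece_act[OF assms])

lemma X_power_in_S_piece: "(X j ^ N :: 'a::field spoly) \<in> S_piece 0 (int N)"
proof (induction N)
  case 0
  show ?case using S_piece_monomial[of 0 0 "1 :: 'a"] by simp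
next
  case (Suc N)
  have "(X j :: 'a spoly) \<in> S_piece 0 1" using S_piece_monomial[of 0 "single j 1" "1 :: 'a"] by (simp add: X_def var_mp_def)
  from S_piece_mult[OF this Suc] show ?case by simp
qed

text \<open>
  The exponent \<open>k\<close> becomes \<open>N - 1 - k\<close> in each of the two variables.
\<close>

lemma bipart_inv_sys:
  fixes c :: "'a::field_char_0 spoly"
  shows "bipart i (2 * int N - 2 - j) (inv_sys N c) = inv_sys N (bipart i j c)"
proof (rule bipart_graded_map[where \<Phi> = "inv_sys N" and \<alpha> = "\<lambda>i. i" and \<beta> = "\<lambda>j. 2 * int N - 2 - j"])
  fix i j and s :: "'a spoly"
  assume s: "s \<in> S_piece i j"
  show "inv_sys N s \<in> S_piece i (2 * int N - 2 - j)"
    unfolding mem_S_piece_iff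
  proof (intro allI impI)
    fix m k assume "cf (inv_sys N s) m k \<noteq> 0"
    then have box: "box N k" and "cf s m (flip_exp N k) \<noteq> 0" by (auto simp: cf_inv_sys split: if_splits)
    then have "int (mdeg m) = i" "int (mdeg (flip_exp N k)) = j" using s by (auto simp: mem_S_piece_iff)
    then show "int (mdeg m) = i \<and> int (mdeg k) = 2 * int N - 2 - j"
      using box by (auto simp: mdeg_finite UNIV_2 box_iff[of 1 2] of_nat_diff)
  qed
qed (auto simp: inv_sys_add inj_def)


section \<open>Ideals of height two in a polynomial ring in two variables\<close>

lemma type_ring_simps [simp]:
  "carrier type_ring = UNIV" "x \<otimes>\<^bsub>type_ring\<^esub> y = x * y" "\<one>\<^bsub>type_ring\<^esub> = 1"
  "\<zero>\<^bsub>type_ring\<^esub> = 0" "x \<oplus>\<^bsub>type_ring\<^esub> y = x + y"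
  by (simp_all add: type_ring_def)

text \<open>
  Ideals occur in full rings and in the ring of polynomials over the symbols \<open>X\<^sub>a\<close> with \<open>a \<in> I\<close>, which
  is a subring of a full ring; closed subrings cover both.
\<close>

definition closed_subring :: "'r::comm_ring_1 set \<Rightarrow> bool" where
  "closed_subring C \<longleftrightarrow> 1 \<in> C \<and> (\<forall>a\<in>C. \<forall>b\<in>C. a + b \<in> C \<and> a * b \<in> C) \<and> (\<forall>a\<in>C. - a \<in> C)"

lemma cring_subring:
  assumes C: "closed_subring C"
  shows "cring (type_ring\<lparr>carrier := C\<rparr>)"
proof (intro cringI abelian_groupI comm_monoidI)
  fix x assume x: "x \<in> carrier (type_ring\<lparr>carrier := C\<rparr>)"
  then show "\<exists>y\<in>carrier (type_ring\<lparr>carrier := C\<rparr>).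
      y \<oplus>\<^bsub>type_ring\<lparr>carrier := C\<rparr>\<^esub> x = \<zero>\<^bsub>type_ring\<lparr>carrier := C\<rparr>\<^esub>"
    using C by (intro bexI[of _ "- x"]) (auto simp: closed_subring_def type_ring_def)
next
  have "1 + - 1 \<in> C" using C unfolding closed_subring_def by blast
  then show "\<zero>\<^bsub>type_ring\<lparr>carrier := C\<rparr>\<^esub> \<in> carrier (type_ring\<lparr>carrier := C\<rparr>)"
    by (simp add: type_ring_def)
qed (use C in \<open>auto simp: closed_subring_def type_ring_def algebra_simps\<close>)

lemma ideal_subring_iff:
  assumes C: "closed_subring C"
  shows "ideal J (type_ring\<lparr>carrier := C\<rparr>) \<longleftrightarrow>
    J \<subseteq> C \<and> 0 \<in> J \<and> (\<forall>a\<in>J. \<forall>b\<in>J. a + b \<in> J) \<and> (\<forall>r\<in>C. \<forall>a\<in>J. r * a \<in> J)"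
    (is "ideal J ?R \<longleftrightarrow> _")
proof -
  interpret cring ?R by (rule cring_subring) (rule C)
  show ?thesis
  proof
    assume "ideal J ?R"
    then interpret J: ideal J ?R .
    show "J \<subseteq> C \<and> 0 \<in> J \<and> (\<forall>a\<in>J. \<forall>b\<in>J. a + b \<in> J) \<and> (\<forall>r\<in>C. \<forall>a\<in>J. r * a \<in> J)"
      using J.a_subset additive_subgroup.zero_closed[OF ideal.axioms(1)[OF J.ideal_axioms]] J.a_closed J.I_l_closed by (simp add: type_ring_def)
  next
    assume J: "J \<subseteq> C \<and> 0 \<in> J \<and> (\<forall>a\<in>J. \<forall>b\<in>J. a + b \<in> J) \<and> (\<forall>r\<in>C. \<forall>a\<in>J. r * a \<in> J)"
    have "- 1 \<in> C" using C by (auto simp: closed_subring_def)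
    then have neg: "- a \<in> J" if "a \<in> J" for a using J that by (metis mult_minus1)
    have inv: "inv\<^bsub>add_monoid ?R\<^esub> x = - x" if "x \<in> C" for x
    proof -
      have "\<ominus>\<^bsub>?R\<^esub> x = - x"
        by (rule minus_equality) (use that C in \<open>auto simp: type_ring_def closed_subring_def\<close>)
      then show ?thesis by (simp add: a_inv_def)
    qed
    have "a * x \<in> J" if "a \<in> J" "x \<in> C" for a x using J that by (metis mult.commute)
    then show "ideal J ?R"
    proof (intro idealI[OF ring_axioms])
      show "subgroup J (add_monoid ?R)"
      proof
        fix x assume "x \<in> J"
        then show "inv\<^bsub>add_monoid ?R\<^esub> x \<in> J" using J neg inv by (metis subsetD)
      qed (use J in \<open>auto simp: type_ring_def\<close>)
    qed (use J in \<open>auto simp: type_ring_def\<close>)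
  qed
qed

lemma type_ring_UNIV: "type_ring\<lparr>carrier := UNIV\<rparr> = type_ring"
  by (simp add: type_ring_def)

lemma cring_type_ring: "cring (type_ring :: 'r::comm_ring_1 ring)"
  using cring_subring[of "UNIV :: 'r set"] by (simp add: closed_subring_def type_ring_UNIV)

lemma ideal_type_ring_iff:
  "ideal J (type_ring :: 'r::comm_ring_1 ring) \<longleftrightarrow>
    0 \<in> J \<and> (\<forall>a\<in>J. \<forall>b\<in>J. a + b \<in> J) \<and> (\<forall>r. \<forall>a\<in>J. r * a \<in> J)"
  using ideal_subring_iff[of "UNIV :: 'r set" J] by (simp add: closed_subring_def type_ring_UNIV)

lemma genideal_type_ring_range:
  fixes f :: "'i::finite \<Rightarrow> 'r::comm_ring_1"
  shows "genideal type_ring (range f) = {\<Sum>i\<in>UNIV. r i * f i | r. True}" (is "_ = ?J")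
proof
  interpret cring "type_ring :: 'r ring" by (rule cring_type_ring)
  have "ideal ?J type_ring"
    unfolding ideal_type_ring_iff
  proof (safe, goal_cases)
    case 1
    show ?case by (rule exI[of _ "\<lambda>_. 0"]) simp
  next
    case (2 _ _ r s)
    show ?case by (rule exI[of _ "\<lambda>i. r i + s i"]) (simp add: ring_distribs sum.distrib)
  next
    case (3 t _ r)
    show ?case by (rule exI[of _ "\<lambda>i. t * r i"]) (simp add: sum_distrib_left mult.assoc)
  qed
  moreover have "range f \<subseteq> ?J"
  proof safe
    fix i
    have "f i = (\<Sum>l\<in>UNIV. (if l = i then 1 else 0) * f l)"
      by (simp add: if_distrib[of "\<lambda>x. x * _"] cong: if_cong)
    then show "\<exists>r. f i = (\<Sum>l\<in>UNIV. r l * f l) \<and> True" by (intro exI conjI TrueI)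
  qed
  ultimately show "genideal type_ring (range f) \<subseteq> ?J" by (rule genideal_minimal)
  have "ideal (genideal type_ring (range f)) type_ring" by (rule genideal_ideal) simp
  then have closed: "0 \<in> genideal type_ring (range f)"
    "a \<in> genideal type_ring (range f) \<Longrightarrow> b \<in> genideal type_ring (range f) \<Longrightarrow> a + b \<in> genideal type_ring (range f)"
    "a \<in> genideal type_ring (range f) \<Longrightarrow> r * a \<in> genideal type_ring (range f)" for a b r
    by (auto simp: ideal_type_ring_iff)
  have "f i \<in> genideal type_ring (range f)" for i using genideal_self[of "range f"] by auto
  then have "(\<Sum>i\<in>A. r i * f i) \<in> genideal type_ring (range f)" for A r
    by (induction A rule: infinite_finite_induct) (auto intro: closed)
  then show "?J \<subseteq> genideal type_ring (range f)" by auto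
qed

text \<open>
  A zero generator could be dropped, against minimality.
\<close>

lemma generator_nonzero:
  fixes f :: "'i::finite \<Rightarrow> 'r::comm_ring_1"
  assumes "\<And>J. J \<subset> UNIV \<Longrightarrow> genideal type_ring (f ` J) \<noteq> genideal type_ring (range f)"
  shows "f i \<noteq> 0"
proof
  assume "f i = 0"
  interpret cring "type_ring :: 'r ring" by (rule cring_type_ring)
  let ?J = "UNIV - {i}"
  have id: "ideal (genideal type_ring (f ` J)) type_ring" for J by (rule genideal_ideal) simp
  have "range f \<subseteq> genideal type_ring (f ` ?J)"
  proof safe
    fix l
    show "f l \<in> genideal type_ring (f ` ?J)"
      using genideal_self[of "f ` ?J"] id[of ?J] \<open>f i = 0\<close>
      by (cases "l = i") (auto simp: ideal_type_ring_iff)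
  qed
  then have "genideal type_ring (range f) \<subseteq> genideal type_ring (f ` ?J)"
    by (rule genideal_minimal[OF id])
  moreover have "genideal type_ring (f ` ?J) \<subseteq> genideal type_ring (range f)"
    using genideal_self[of "range f"] by (intro genideal_minimal[OF id]) auto
  ultimately show False using assms[of ?J] by auto
qed

lemma ideal_height_two_chain:
  fixes J P :: "'r::comm_ring_1 set"
  assumes "ideal_height type_ring J = 2" "primeideal P type_ring" "J \<subseteq> P"
  obtains C0 C1 where "primeideal C0 type_ring" "primeideal C1 type_ring" "C0 \<subset> C1" "C1 \<subset> P"
proof -
  have "ideal_height type_ring J \<le> prime_height type_ring P"
    unfolding ideal_height_def using assms by (intro Inf_lower) auto
  then have "enat 1 < prime_height type_ring P"
    using assms(1) by (metis less_le_trans enat_ord_simps(2) numeral_eq_enat one_less_numeral_iff semiring_norm(76))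
  then obtain n C where n: "enat 1 < enat n" and C: "\<forall>i\<le>n. primeideal (C i) type_ring"
    "\<forall>i<n. C i \<subset> C (Suc i)" "C n = P"
    unfolding prime_height_def less_Sup_iff by blast
  from n have "2 \<le> n" by simp
  then obtain l where l: "n = Suc (Suc l)" by (metis One_nat_def Suc_le_D Suc_le_mono numeral_2_eq_2)
  show ?thesis
    by (rule that[of "C l" "C (Suc l)"]) (use C l in auto)
qed

text \<open>
  \<open>F[z]\<close> is a principal ideal domain: a nonzero element of least degree in the ideal of the
  \<open>F\<^sub>i\<close> divides all of them, and it is either a unit or has a prime factor. If all \<open>F\<^sub>i\<close> vanish, the prime \<open>z\<close>
  will do.
\<close>

lemma bezout_or_common_prime:
  fixes F :: "'i::finite \<Rightarrow> 'a::field poly"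
  shows "(\<exists>A. (\<Sum>i\<in>UNIV. A i * F i) = 1) \<or> (\<exists>q. prime_elem q \<and> degree q > 0 \<and> (\<forall>i. q dvd F i))"
proof (cases "\<forall>i. F i = 0")
  case True
  have "prime_elem [:0, 1 :: 'a:]" by (rule prime_elem_linear_field_poly) simp
  with True show ?thesis by (intro disjI2 exI[of _ "[:0, 1 :: 'a:]"]) simp
next
  case False
  define M where "M = {\<Sum>i\<in>UNIV. A i * F i | A. True}"
  interpret cring "type_ring :: 'a poly ring" by (rule cring_type_ring)
  have "M = genideal type_ring (range F)" by (simp add: M_def genideal_type_ring_range)
  then have M: "ideal M type_ring" and FM: "F i \<in> M" for i
    using genideal_self[of "range F"] by (auto intro: genideal_ideal)
  from False obtain i where "F i \<noteq> 0" by blast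
  with FM obtain g where g: "g \<in> M" "g \<noteq> 0" and min: "\<And>h. h \<in> M \<Longrightarrow> h \<noteq> 0 \<Longrightarrow> degree g \<le> degree h"
    using ex_has_least_nat[of "\<lambda>g. g \<in> M \<and> g \<noteq> 0" "F i" degree] by blast
  have dvd: "g dvd F i" for i
  proof (rule ccontr)
    assume "\<not> g dvd F i"
    then have ne: "F i mod g \<noteq> 0" by (simp add: dvd_eq_mod_eq_0)
    have "F i mod g = F i + (- (F i div g)) * g" by (simp add: minus_div_mult_eq_mod[symmetric])
    then have "F i mod g \<in> M" using M FM[of i] g(1) unfolding ideal_type_ring_iff by metis
    then show False using min ne degree_mod_less'[of g "F i"] g(2) by fastforce
  qed
  show ?thesis
  proof (cases "degree g = 0")
    case True
    then obtain c where c: "g = [:c:]" by (rule degree_eq_zeroE)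
    with g have "c \<noteq> 0" by simp
    have "[:inverse c:] * g \<in> M" using M g(1) unfolding ideal_type_ring_iff by blast
    moreover have "[:inverse c:] * g = 1" using c \<open>c \<noteq> 0\<close> by (simp add: one_pCons)
    ultimately have "1 \<in> M" by simp
    then show ?thesis unfolding M_def by auto
  next
    case False
    then obtain q where q: "q dvd g" "degree q > 0"
      and qmin: "\<And>h. h dvd g \<Longrightarrow> degree h > 0 \<Longrightarrow> degree q \<le> degree h"
      using ex_has_least_nat[of "\<lambda>h. h dvd g \<and> degree h > 0" g degree] by auto
    \<comment> \<open>a divisor of least positive degree cannot split\<close>
    have "irreducible q"
    proof (rule irreducibleI)
      show "q \<noteq> 0" using q by auto
      show "\<not> q dvd 1" using q by (auto simp: is_unit_poly_iff)
      fix a b assume ab: "q = a * b"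
      then have ne: "a \<noteq> 0" "b \<noteq> 0" using q by auto
      then have "degree q = degree a + degree b" by (simp add: ab degree_mult_eq)
      moreover have "a dvd g" "b dvd g" using q ab by (auto intro: dvd_trans)
      ultimately have "degree a = 0 \<or> degree b = 0" using qmin[of a] qmin[of b] q by linarith
      then show "a dvd 1 \<or> b dvd 1"
        using ne by (auto simp: is_unit_iff_degree)
    qed
    then have "prime_elem q" by (rule field_poly_irreducible_imp_prime)
    then show ?thesis using q dvd by (meson dvd_trans)
  qed
qed


text \<open>
  A bivariate polynomial with homogeneous parts \<open>h\<^sub>n\<close> becomes \<open>\<Sum> H\<^sub>n t\<^sup>n\<close>, where \<open>H\<^sub>n\<close> is \<open>h\<^sub>n\<close> with \<open>x\<^sub>j\<close> set
  to \<open>1\<close> and the other variable to \<open>z\<close>. The image consists of the \<open>\<Sum> H\<^sub>n t\<^sup>n\<close> with \<open>deg H\<^sub>n \<le> n\<close>.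
\<close>

definition dehom :: "2 \<Rightarrow> 'a::field xpoly \<Rightarrow> 'a poly poly" where
  "dehom j = eval_mp (\<lambda>c. [:[:c:]:])
     (\<lambda>i. if i = j then Polynomial.monom 1 1 else Polynomial.monom [:0, 1:] 1)"

context
  fixes j j' :: 2
  assumes j: "j \<noteq> j'"
begin

lemma exhaust_j: "i = j \<or> i = j'"
  using j exhaust_2[of i] exhaust_2[of j] exhaust_2[of j'] by auto

lemma unital_hom_dehom: "unital_hom (dehom j)"
  unfolding dehom_def
  by (intro unital_hom_eval_mp unital_hom_comp[of "\<lambda>r. [:r:]" "\<lambda>r. [:r:]"] unital_hom_const_poly)

interpretation dehom: unital_hom "dehom j" by (rule unital_hom_dehom)

lemma dehom_single:
  "dehom j (single k c) = Polynomial.monom (Polynomial.monom c (lookup k j')) (lookup k j + lookup k j')"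
proof -
  have c: "unital_hom (\<lambda>c::'a. [:[:c:]:])"
    by (intro unital_hom_comp[of "\<lambda>r. [:r:]" "\<lambda>r. [:r:]"] unital_hom_const_poly)
  have "[:0, 1 :: 'a:] ^ n = Polynomial.monom 1 n" for n
    by (simp add: monom_altdef)
  then show ?thesis
    unfolding dehom_def eval_mp_single[OF c]
    using j by (subst monom_val_superset[of "{j, j'}"])
      (use exhaust_j in \<open>auto simp: monom_power mult_monom smult_monom simp flip: monom_0\<close>)
qed

lemma exponent_eq_iff: "k = single j a + single j' b \<longleftrightarrow> lookup k j = a \<and> lookup k j' = b"
proof
  assume *: "lookup k j = a \<and> lookup k j' = b"
  show "k = single j a + single j' b"
  proof (rule poly_mapping_eqI)
    fix i
    show "lookup k i = lookup (single j a + single j' b) i"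
      using * j exhaust_j[of i] by (auto simp: lookup_add lookup_single_not_eq)
  qed
qed (use j in \<open>simp add: lookup_add lookup_single_not_eq\<close>)

lemma coeff_dehom:
  "coeff (coeff (dehom j p) n) l = (if l \<le> n then lookup p (single j (n - l) + single j' l) else 0)"
proof (induction p rule: poly_mapping_induct)
  case (single k c)
  show ?case
    by (auto simp: dehom_single lookup_single when_def exponent_eq_iff)
qed (simp add: dehom.add lookup_add)

lemma dehom_inject: "dehom j p = dehom j q \<Longrightarrow> p = q"
proof (rule poly_mapping_eqI)
  fix k :: "2 \<Rightarrow>\<^sub>0 nat" assume "dehom j p = dehom j q"
  moreover have "k = single j (lookup k j) + single j' (lookup k j')"
    by (simp add: exponent_eq_iff)
  ultimately show "lookup p k = lookup q k"
    using coeff_dehom[of p "lookup k j + lookup k j'" "lookup k j'"]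
      coeff_dehom[of q "lookup k j + lookup k j'" "lookup k j'"] by simp
qed

lemma degree_coeff_dehom: "degree (coeff (dehom j p) n) \<le> n"
  by (rule degree_le) (simp add: coeff_dehom)

lemma dehom_homogenization:
  assumes "degree q \<le> n"
  obtains p where "dehom j p = Polynomial.monom q n"
proof
  let ?p = "\<Sum>l\<le>n. single (single j (n - l) + single j' l) (coeff q l)"
  have "dehom j ?p = (\<Sum>l\<le>n. Polynomial.monom (Polynomial.monom (coeff q l) l) n)"
    using j by (simp add: dehom.sum dehom_single lookup_add lookup_single_not_eq)
  also have "\<dots> = Polynomial.monom (\<Sum>l\<le>n. Polynomial.monom (coeff q l) l) n"
    by (intro poly_eqI) (simp add: coeff_sum)
  also have "(\<Sum>l\<le>n. Polynomial.monom (coeff q l) l) = q"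
    using assms by (rule poly_as_sum_of_monoms')
  finally show "dehom j ?p = Polynomial.monom q n" .
qed

lemma dehom_surj:
  assumes "\<And>n. degree (coeff Q n) \<le> n"
  obtains p where "dehom j p = Q"
proof -
  have "\<exists>p. dehom j p = Polynomial.monom (coeff Q n) n" for n
    using assms by (meson dehom_homogenization)
  then obtain p where p: "\<And>n. dehom j (p n) = Polynomial.monom (coeff Q n) n" by metis
  have "dehom j (\<Sum>n\<le>degree Q. p n) = Q"
    by (simp add: dehom.sum p poly_as_sum_of_monoms)
  then show ?thesis by (rule that)
qed

lemma dehom_X: "dehom j (var_mp j) = Polynomial.monom 1 1"
  using j by (simp add: var_mp_def dehom_single lookup_single_not_eq one_pCons monom_0)

lemma dehom_homogeneous:
  assumes "homogeneous d p"
  shows "dehom j p = Polynomial.monom (coeff (dehom j p) d) d"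
proof (rule poly_eqI, rule poly_eqI)
  fix n l
  show "coeff (coeff (dehom j p) n) l = coeff (coeff (Polynomial.monom (coeff (dehom j p) d) d) n) l"
  proof (cases "n = d \<or> n < l")
    case False
    then have "mdeg (single j (n - l) + single j' l) \<noteq> d" by (simp add: mdeg_add)
    then have "lookup p (single j (n - l) + single j' l) = 0"
      using assms unfolding homogeneous_def by (metis in_keys_iff)
    then show ?thesis using False by (simp add: coeff_dehom)
  qed (auto simp: coeff_dehom)
qed

text \<open>
  The forms whose dehomogenizations are divisible by a prime \<open>q\<close> generate a principal prime
  ideal; descending along powers of its generator leaves no room for a nonzero prime below it.
\<close>

lemma no_chain_below_principal_prime:
  fixes q :: "'a::field poly"
  assumes q: "prime_elem q" "degree q > 0"
  defines "P \<equiv> {h. [:q:] dvd dehom j h}"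
  shows "primeideal P type_ring"
    and "primeideal C0 type_ring \<Longrightarrow> primeideal C1 type_ring \<Longrightarrow> C0 \<subset> C1 \<Longrightarrow> \<not> C1 \<subset> P"
proof -
  have prime: "prime_elem [:q:]" using q(1) by (rule lift_prime_elem_poly)
  show "primeideal P type_ring"
  proof (rule primeidealI)
    show "ideal P type_ring"
      unfolding ideal_type_ring_iff P_def by (auto simp: dehom.zero dehom.add dehom.mult)
    have "1 \<notin> P" using prime by (simp add: P_def dehom.one prime_elem_not_unit)
    then show "carrier type_ring \<noteq> P" by auto
    fix a b assume "a \<otimes>\<^bsub>type_ring\<^esub> b \<in> P"
    then show "a \<in> P \<or> b \<in> P"
      using prime_elem_dvd_multD[OF prime] by (auto simp: P_def dehom.mult)
  qed (rule cring_type_ring)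
  assume C: "primeideal C0 type_ring" "primeideal C1 type_ring" "C0 \<subset> C1"
  show "\<not> C1 \<subset> P"
  proof
    assume "C1 \<subset> P"
    interpret C0: primeideal C0 type_ring by (rule C)
    interpret C1: primeideal C1 type_ring by (rule C)
    obtain p where p: "dehom j p = Polynomial.monom q (degree q)"
      using dehom_homogenization by blast
    have "[:q:] \<noteq> 0" using q by auto
    \<comment> \<open>the degree bound leaves the cofactor of \<open>q\<close> room to be shifted down by \<open>degree q\<close> powers of \<open>t\<close>\<close>
    have principal: "\<exists>h'. h = p * h'" if "h \<in> P" for h
    proof -
      from that obtain W where W: "dehom j h = [:q:] * W" by (auto simp: P_def elim: dvdE)
      have deg: "coeff W n = 0 \<or> degree q + degree (coeff W n) \<le> n" for n
      proof -
        have "degree (q * coeff W n) \<le> n"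
          using degree_coeff_dehom[of h n] by (simp add: W)
        then show ?thesis
          using \<open>[:q:] \<noteq> 0\<close> by (cases "coeff W n = 0") (simp_all add: degree_mult_eq)
      qed
      define V where "V = poly_shift (degree q) W"
      have "degree (coeff V n) \<le> n" for n
        using deg[of "n + degree q"] by (auto simp: V_def coeff_poly_shift add.commute)
      then obtain h' where h': "dehom j h' = V" by (rule dehom_surj)
      have "W = Polynomial.monom 1 (degree q) * V"
      proof (rule poly_eqI)
        fix n show "coeff W n = coeff (Polynomial.monom 1 (degree q) * V) n"
          using deg[of n] by (auto simp: coeff_monom_mult V_def coeff_poly_shift)
      qed
      then have "dehom j h = Polynomial.monom q (degree q) * V"
        by (simp add: W mult.assoc[symmetric] smult_monom)
      then have "dehom j h = dehom j (p * h')" by (simp add: dehom.mult p h')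
      then show ?thesis using dehom_inject by blast
    qed
    have "p \<notin> C1"
    proof
      assume "p \<in> C1"
      then have "p * h \<in> C1" for h using C1.I_r_closed by simp
      then have "P \<subseteq> C1" using principal by blast
      then show False using \<open>C1 \<subset> P\<close> by blast
    qed
    have "h = 0" if "h \<in> C1" for h
      using that
    proof (induction "degree (dehom j h)" arbitrary: h rule: less_induct)
      case less
      from less.prems \<open>C1 \<subset> P\<close> obtain h' where h': "h = p * h'" using principal by blast
      then have "h' \<in> C1" using less.prems C1.I_prime[of p h'] \<open>p \<notin> C1\<close> by simp
      show "h = 0"
      proof (rule ccontr)
        assume "h \<noteq> 0"
        then have "h' \<noteq> 0" using h' by auto
        then have "dehom j h' \<noteq> 0" using dehom_inject[of h' 0] by (auto simp: dehom.zero)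
        moreover have "dehom j h = Polynomial.monom q (degree q) * dehom j h'"
          by (simp add: h' dehom.mult p)
        ultimately have "degree (dehom j h) = degree q + degree (dehom j h')"
          using q by (subst \<open>dehom j h = _\<close>, subst degree_mult_eq) (auto simp: monom_eq_0_iff degree_monom_eq)
        then have "h' = 0" using less.hyps[OF _ \<open>h' \<in> C1\<close>] q by simp
        with \<open>h' \<noteq> 0\<close> show False ..
      qed
    qed
    moreover have "0 \<in> C0" using C0.ideal_axioms by (simp add: ideal_type_ring_iff)
    ultimately show False using \<open>C0 \<subset> C1\<close> by auto
  qed
qed

text \<open>
  If the dehomogenized generators are coprime, homogenizing a Bezout relation expresses a power
  of \<open>x\<^sub>j\<close>. Otherwise a common prime factor provides a prime over the ideal below which there is no
  chain of length two. A factor \<open>x\<^sub>j\<close> turns into a unit, which does no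
  harm when a power of \<open>x\<^sub>j\<close> is sought.
\<close>

lemma X_power_in_height_two_ideal:
  fixes f :: "'i::finite \<Rightarrow> 'a::field xpoly"
  assumes hom: "\<And>i. homogeneous d (f i)"
    and height: "ideal_height type_ring (genideal type_ring (range f)) = 2"
  shows "\<exists>M r. var_mp j ^ M = (\<Sum>i\<in>UNIV. r i * f i)"
proof -
  define F where "F i = coeff (dehom j (f i)) d" for i
  have F: "dehom j (f i) = Polynomial.monom (F i) d" for i
    unfolding F_def by (rule dehom_homogeneous) (rule hom)
  show ?thesis
    using bezout_or_common_prime[of F]
  proof (elim disjE exE conjE)
    fix q assume q: "prime_elem q" "degree q > 0" "\<forall>i. q dvd F i"
    let ?P = "{h. [:q:] dvd dehom j h}"
    have "[:q:] dvd Polynomial.monom (F i) d" for i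
    proof -
      obtain s where "F i = q * s" using q(3) by (metis dvdE)
      then have "Polynomial.monom (F i) d = [:q:] * Polynomial.monom s d" by (simp add: smult_monom)
      then show ?thesis by (rule dvdI)
    qed
    then have "(\<Sum>i\<in>UNIV. r i * f i) \<in> ?P" for r
      by (auto simp: dehom.sum dehom.mult F intro: dvd_sum)
    then have "genideal type_ring (range f) \<subseteq> ?P"
      unfolding genideal_type_ring_range by blast
    then show ?thesis
      using ideal_height_two_chain[OF height no_chain_below_principal_prime(1)[OF q(1,2)]]
        no_chain_below_principal_prime(2)[OF q(1,2)] by metis
  next
    fix A assume A: "(\<Sum>i\<in>UNIV. A i * F i) = 1"
    define n where "n = Max (range (\<lambda>i. degree (A i)))"
    have "degree (A i) \<le> n" for i unfolding n_def by (rule Max_ge) auto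
    then have "\<exists>r. dehom j r = Polynomial.monom (A i) n" for i using dehom_homogenization by metis
    then obtain r where r: "\<And>i. dehom j (r i) = Polynomial.monom (A i) n" by metis
    have "dehom j (\<Sum>i\<in>UNIV. r i * f i) = (\<Sum>i\<in>UNIV. Polynomial.monom (A i * F i) (n + d))"
      by (simp add: dehom.sum dehom.mult r F mult_monom)
    also have "\<dots> = Polynomial.monom (\<Sum>i\<in>UNIV. A i * F i) (n + d)"
      by (rule poly_eqI) (simp add: coeff_sum)
    also have "\<dots> = dehom j (var_mp j ^ (n + d))"
      by (simp add: A dehom.power dehom_X monom_power)
    finally show ?thesis using dehom_inject by metis
  qed
qed

end


section \<open>Torsion modulo an ideal\<close>

lemma ideal_diff: "ideal J type_ring \<Longrightarrow> a \<in> J \<Longrightarrow> b \<in> J \<Longrightarrow> a - b \<in> J" for a b :: "'r::comm_ring_1"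
  unfolding ideal_type_ring_iff by (metis mult_minus1 diff_conv_add_uminus)

lemma ideal_sum: "ideal J type_ring \<Longrightarrow> (\<And>x. x \<in> A \<Longrightarrow> t x \<in> J) \<Longrightarrow> sum t A \<in> J"
  for t :: "'x \<Rightarrow> 'r::comm_ring_1"
  by (induction A rule: infinite_finite_induct) (auto simp: ideal_type_ring_iff)

lemma ideal_mult_cong:
  fixes x y :: "'r::comm_ring_1"
  assumes J: "ideal J type_ring" and "x - y \<in> J" "x' - y' \<in> J"
  shows "x * x' - y * y' \<in> J"
proof -
  have "x * x' - y * y' = x * (x' - y') + y' * (x - y)" by (simp add: algebra_simps)
  then show ?thesis using assms unfolding ideal_type_ring_iff by metis
qed

lemma ideal_monom_val_cong:
  fixes x y :: "'v \<Rightarrow> 'r::comm_ring_1"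
  assumes J: "ideal J type_ring" and xy: "\<And>v. x v - y v \<in> J"
  shows "monom_val x m - monom_val y m \<in> J"
proof -
  have 0: "0 \<in> J" using J by (simp add: ideal_type_ring_iff)
  have "x v ^ n - y v ^ n \<in> J" for v n
    by (induction n) (auto intro: ideal_mult_cong[OF J] xy 0)
  then have "(\<Prod>v\<in>A. x v ^ lookup m v) - (\<Prod>v\<in>A. y v ^ lookup m v) \<in> J" for A
    by (induction A rule: infinite_finite_induct) (auto intro: ideal_mult_cong[OF J] 0)
  then show ?thesis by (simp add: monom_val_def)
qed

lemma monom_val_scale:
  fixes m :: "'v::finite \<Rightarrow>\<^sub>0 nat"
  shows "monom_val (\<lambda>v. x v * c) m = monom_val x m * c ^ mdeg m"
  by (simp add: monom_val_def mdeg_def power_mult_distrib prod.distrib power_sum)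

lemma monom_val_monom_1:
  fixes m :: "'v::finite \<Rightarrow>\<^sub>0 nat" and y :: "'v \<Rightarrow> 's::comm_ring_1"
  shows "monom_val (\<lambda>v. Polynomial.monom (y v) 1) m = Polynomial.monom (monom_val y m) (mdeg m)"
proof -
  have "(\<Prod>v\<in>A. Polynomial.monom (y v) 1 ^ lookup m v) =
      Polynomial.monom (\<Prod>v\<in>A. y v ^ lookup m v) (\<Sum>v\<in>A. lookup m v)" for A
    by (induction A rule: infinite_finite_induct) (simp_all add: monom_power mult_monom one_pCons monom_0)
  then show ?thesis by (simp add: monom_val_def mdeg_def)
qed

text \<open>
  Substituting \<open>y\<^sub>v t\<close> for the variables keeps the homogeneous parts apart in the powers of \<open>t\<close>, so
  that inhomogeneous polynomials need no separate treatment.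
\<close>

definition graded_eval ::
  "('r::comm_ring_1 \<Rightarrow> 's::comm_ring_1) \<Rightarrow> ('v \<Rightarrow> 's) \<Rightarrow> (('v \<Rightarrow>\<^sub>0 nat) \<Rightarrow>\<^sub>0 'r) \<Rightarrow> 's poly" where
  "graded_eval c y = eval_mp (\<lambda>r. [:c r:]) (\<lambda>v. Polynomial.monom (y v) 1)"

lemma unital_hom_graded_eval: "unital_hom c \<Longrightarrow> unital_hom (graded_eval c y)"
  unfolding graded_eval_def
  by (intro unital_hom_eval_mp unital_hom_comp[of "\<lambda>r. [:r:]" c] unital_hom_const_poly)

lemma graded_eval_const_var:
  assumes "unital_hom c"
  shows "graded_eval c y (const_mp r) = [:c r:]" "graded_eval c y (var_mp v) = Polynomial.monom (y v) 1"
proof -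
  have "unital_hom (\<lambda>r. [:c r:])"
    using assms by (intro unital_hom_comp[of "\<lambda>r. [:r:]" c] unital_hom_const_poly)
  then show "graded_eval c y (const_mp r) = [:c r:]" "graded_eval c y (var_mp v) = Polynomial.monom (y v) 1"
    by (simp_all add: graded_eval_def eval_mp_const eval_mp_var)
qed

lemma coeff_graded_eval:
  fixes c :: "'r::comm_ring_1 \<Rightarrow> 's::comm_ring_1" and y :: "'v::finite \<Rightarrow> 's"
  assumes "unital_hom c"
  shows "coeff (graded_eval c y p) e = (\<Sum>m | m \<in> keys p \<and> mdeg m = e. c (lookup p m) * monom_val y m)"
proof -
  have "unital_hom (\<lambda>r. [:c r:])"
    using assms by (intro unital_hom_comp[of "\<lambda>r. [:r:]" c] unital_hom_const_poly)
  then have "coeff (graded_eval c y p) e = (\<Sum>m\<in>keys p. if mdeg m = e then c (lookup p m) * monom_val y m else 0)"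
    by (simp add: graded_eval_def eval_mp_superset[of _ "keys p"] coeff_sum monom_val_monom_1 smult_monom del: One_nat_def)
  then show ?thesis by (simp add: sum.inter_filter)
qed

text \<open>
  If \<open>v T\<^sub>l\<close> and \<open>y\<^sub>l\<close> agree modulo an ideal then, degree by degree, a power of \<open>v\<close> turns a polynomial
  in \<open>T\<close> into its value at \<open>y\<close>. Both the regularity of \<open>g\<^sub>1, g\<^sub>2\<close> and the torsion of the kernel
  come from this.
\<close>

lemma power_mult_mem_of_graded_eval_zero:
  fixes s :: "'a::field spoly" and v :: "'a xpoly"
  assumes J: "ideal J type_ring" and y: "\<And>l. var_mp l * const_mp v - y l \<in> J"
    and zero: "\<And>e. (\<Sum>m | m \<in> keys s \<and> mdeg m = e. const_mp (lookup s m) * monom_val y m) = 0"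
  shows "\<exists>n. const_mp v ^ n * s \<in> J"
proof -
  \<comment> \<open>any bound for the degrees of the monomials of \<open>s\<close>\<close>
  define n where "n = (\<Sum>m\<in>keys s. mdeg m)"
  have n: "mdeg m \<le> n" if "m \<in> keys s" for m
    unfolding n_def using that by (intro member_le_sum) auto
  define c :: "'a spoly" where "c = const_mp v"
  have "c ^ n * s = (\<Sum>m\<in>keys s. c ^ (n - mdeg m) * const_mp (lookup s m) * monom_val (\<lambda>l. var_mp l * c) m)"
  proof -
    have "c ^ n * s = (\<Sum>m\<in>keys s. c ^ n * single m (lookup s m))"
      by (subst sum_singles_superset[of "keys s" s]) (simp_all add: sum_distrib_left)
    also have "\<dots> = (\<Sum>m\<in>keys s. c ^ (n - mdeg m) * const_mp (lookup s m) * monom_val (\<lambda>l. var_mp l * c) m)"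
    proof (rule sum.cong[OF HOL.refl])
      fix m assume "m \<in> keys s"
      then have "c ^ n = c ^ (n - mdeg m) * c ^ mdeg m" using n by (simp flip: power_add)
      then show "c ^ n * single m (lookup s m) =
          c ^ (n - mdeg m) * const_mp (lookup s m) * monom_val (\<lambda>l. var_mp l * c) m"
        unfolding monom_val_scale by (subst single_eq_const_times_monom) (simp only: mult_ac)
    qed
    finally show ?thesis .
  qed
  moreover have "(\<Sum>m\<in>keys s. c ^ (n - mdeg m) * const_mp (lookup s m) * monom_val y m) = 0"
  proof -
    have "(\<Sum>m\<in>keys s. c ^ (n - mdeg m) * const_mp (lookup s m) * monom_val y m) =
        (\<Sum>e\<in>mdeg ` keys s. \<Sum>m | m \<in> keys s \<and> mdeg m = e.
          c ^ (n - mdeg m) * const_mp (lookup s m) * monom_val y m)"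
      by (rule sum.image_gen) simp
    also have "\<dots> = (\<Sum>e\<in>mdeg ` keys s. c ^ (n - e) *
        (\<Sum>m | m \<in> keys s \<and> mdeg m = e. const_mp (lookup s m) * monom_val y m))"
      by (intro sum.cong) (auto simp: sum_distrib_left mult.assoc)
    finally show ?thesis by (simp add: zero)
  qed
  ultimately have "c ^ n * s = (\<Sum>m\<in>keys s. c ^ (n - mdeg m) * const_mp (lookup s m) *
      (monom_val (\<lambda>l. var_mp l * c) m - monom_val y m))"
    by (simp add: right_diff_distrib sum_subtractf)
  moreover have "\<dots> \<in> J"
  proof (rule ideal_sum[OF J])
    fix m
    have "monom_val (\<lambda>l. var_mp l * c) m - monom_val y m \<in> J"
      using y by (intro ideal_monom_val_cong[OF J]) (simp add: c_def)
    then show "c ^ (n - mdeg m) * const_mp (lookup s m) *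
        (monom_val (\<lambda>l. var_mp l * c) m - monom_val y m) \<in> J"
      using J by (simp add: ideal_type_ring_iff)
  qed
  ultimately show ?thesis unfolding c_def by metis
qed

text \<open>
  The radical of the annihilator of \<open>s\<close> in \<open>S/J\<close>, contracted to \<open>R\<close>. Being an ideal of \<open>R\<close>, it contains
  powers of the variables as soon as it contains the \<open>f\<^sub>i\<close>.
\<close>

definition torsion_radical :: "'a::field spoly set \<Rightarrow> 'a spoly \<Rightarrow> 'a xpoly set" where
  "torsion_radical J s = {r. \<exists>n. const_mp r ^ n * s \<in> J}"

lemma torsion_radical_power: "r ^ k \<in> torsion_radical J s \<Longrightarrow> r \<in> torsion_radical J s"
  by (auto simp: torsion_radical_def unital_hom.power[OF unital_hom_const_mp] simp flip: power_mult)

lemma ideal_torsion_radical: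
  assumes J: "ideal J type_ring"
  shows "ideal (torsion_radical J s) type_ring"
proof -
  interpret const: unital_hom "const_mp :: 'a xpoly \<Rightarrow> 'a spoly" by (rule unital_hom_const_mp)
  have JI: "0 \<in> J" "t \<in> J \<Longrightarrow> r * t \<in> J" for t r using J by (auto simp: ideal_type_ring_iff)
  show ?thesis unfolding ideal_type_ring_iff
  proof (intro conjI ballI allI)
    have "const_mp 0 ^ 1 * s \<in> J" by (simp add: JI)
    then show "0 \<in> torsion_radical J s" unfolding torsion_radical_def by blast
  next
    fix a b assume "a \<in> torsion_radical J s" "b \<in> torsion_radical J s"
    then obtain m n where mn: "const_mp a ^ m * s \<in> J" "const_mp b ^ n * s \<in> J"
      by (auto simp: torsion_radical_def)
    have "(const_mp a + const_mp b) ^ (m + n) * s =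
        (\<Sum>k\<le>m + n. of_nat (m + n choose k) * const_mp a ^ k * const_mp b ^ (m + n - k) * s)"
      by (simp add: binomial_ring sum_distrib_right)
    also have "\<dots> \<in> J"
    proof (rule ideal_sum[OF J])
      fix k
      show "of_nat (m + n choose k) * const_mp a ^ k * const_mp b ^ (m + n - k) * s \<in> J"
      proof (cases "m \<le> k")
        case True
        then have "(const_mp a :: 'a spoly) ^ k = const_mp a ^ (k - m) * const_mp a ^ m"
          by (simp flip: power_add)
        then have "const_mp a ^ k * s = const_mp a ^ (k - m) * (const_mp a ^ m * s)"
          by (simp only: mult.assoc)
        then have "const_mp a ^ k * s \<in> J" using JI(2)[OF mn(1)] by (simp only:)
        then have "(of_nat (m + n choose k) * const_mp b ^ (m + n - k)) * (const_mp a ^ k * s) \<in> J"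
          by (rule JI)
        then show ?thesis by (simp add: mult_ac)
      next
        case False
        then have "const_mp b ^ (m + n - k) * s = const_mp b ^ (m - k) * (const_mp b ^ n * s)"
          by (simp add: mult.assoc[symmetric] flip: power_add)
        then have "const_mp b ^ (m + n - k) * s \<in> J" using JI(2)[OF mn(2)] by (simp only:)
        then have "(of_nat (m + n choose k) * const_mp a ^ k) * (const_mp b ^ (m + n - k) * s) \<in> J"
          by (rule JI)
        then show ?thesis by (simp add: mult_ac)
      qed
    qed
    finally show "a + b \<in> torsion_radical J s" by (auto simp: torsion_radical_def const.add)
  next
    fix r a assume "a \<in> torsion_radical J s"
    then obtain n where "const_mp a ^ n * s \<in> J" by (auto simp: torsion_radical_def)
    then have "const_mp r ^ n * (const_mp a ^ n * s) \<in> J" by (rule JI)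
    then show "r * a \<in> torsion_radical J s"
      by (auto simp: torsion_radical_def const.mult power_mult_distrib mult.assoc)
  qed
qed


section \<open>The equations \<open>g\<^sub>1, g\<^sub>2\<close> of the symmetric algebra\<close>

text \<open>
  The linear form in \<open>T\<close> with coefficient vector \<open>w\<close>: the value at \<open>w\<close> of \<open>R\<^sup>3 \<rightarrow> S\<close>.
\<close>

definition lin :: "(3 \<Rightarrow> 'a::field xpoly) \<Rightarrow> 'a spoly" where
  "lin w = (\<Sum>i\<in>UNIV. var_mp i * const_mp (w i))"

lemma lookup_lin: "lookup (lin w) (single i 1) = w i"
proof -
  have eq: "single l (1 :: nat) = single i 1 \<longleftrightarrow> l = i" for l :: 3
    by (metis lookup_single_eq lookup_single_not_eq one_neq_zero)
  have "lookup (lin w) (single i 1) = (\<Sum>l\<in>UNIV. if l = i then w i else 0)"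
    unfolding lin_def lookup_sum
    by (rule sum.cong) (auto simp: var_mp_def mult_single lookup_single when_def eq simp del: One_nat_def)
  then show ?thesis by simp
qed

lemma sym_eq_lin: "sym_eq \<phi> k = lin (\<lambda>i. \<phi> i k)"
  by (simp add: sym_eq_def lin_def)

lemma lin_scale_add:
  "lin (\<lambda>i. w i * r + w' i * r') = const_mp r * lin w + const_mp r' * lin w'"
  by (simp add: lin_def sum_distrib_left sum.distrib single_add mult_ac ring_distribs flip: mult_single)
     (simp add: mult_single mult_ac sum.distrib)

lemma lin_scale: "lin (\<lambda>i. w i * r) = const_mp r * lin w"
  using lin_scale_add[of w r "\<lambda>_. 0" 0] by simp

lemma distinct_third: "\<exists>k :: 3. k \<noteq> i \<and> k \<noteq> l"
proof (rule ccontr)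
  assume "\<not> ?thesis"
  then have "(UNIV :: 3 set) \<subseteq> {i, l}" by auto
  then have "card (UNIV :: 3 set) \<le> card {i, l}" by (intro card_mono) auto
  also have "\<dots> \<le> 2" by (simp add: card_insert_if)
  finally show False by simp
qed

text \<open>
  The last assumption is what the height of \<open>I\<close> contributes; nonzero generators come from
  minimality.
\<close>

locale hilbert_burch_ideal =
  fixes f :: "3 \<Rightarrow> 'a::field_char_0 xpoly" and d \<mu> :: nat and \<phi> :: "3 \<Rightarrow> 2 \<Rightarrow> 'a xpoly"
  assumes hb: "hilbert_burch f d \<mu> \<phi>"
    and f_nonzero: "\<And>i. f i \<noteq> 0"
    and X_power_in_ideal: "\<And>j. \<exists>M r. var_mp j ^ M = (\<Sum>i\<in>UNIV. r i * f i)"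
begin

definition g1 :: "'a spoly" where "g1 = sym_eq \<phi> 1"
definition g2 :: "'a spoly" where "g2 = sym_eq \<phi> 2"

definition G :: "'a spoly set" where "G = {a * g1 + b * g2 | a b. True}"

lemma ideal_G: "ideal G type_ring"
  unfolding ideal_type_ring_iff G_def mem_Collect_eq
proof (intro conjI ballI allI; clarify?)
  show "\<exists>a b. 0 = a * g1 + b * g2 \<and> True" by (intro exI[of _ 0]) simp
next
  fix a b a' b'
  have "(a * g1 + b * g2) + (a' * g1 + b' * g2) = (a + a') * g1 + (b + b') * g2"
    by (simp add: algebra_simps)
  then show "\<exists>c c'. (a * g1 + b * g2) + (a' * g1 + b' * g2) = c * g1 + c' * g2 \<and> True" by blast
next
  fix r a b
  have "r * (a * g1 + b * g2) = (r * a) * g1 + (r * b) * g2" by (simp add: algebra_simps)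
  then show "\<exists>c c'. r * (a * g1 + b * g2) = c * g1 + c' * g2 \<and> True" by blast
qed

lemma syzygy_iff:
  "(\<Sum>i\<in>UNIV. f i * w i) = 0 \<longleftrightarrow> (\<exists>p q. w = (\<lambda>i. \<phi> i 1 * p + \<phi> i 2 * q))"
proof -
  let ?\<Phi> = "\<lambda>(v :: 2 \<Rightarrow> 'a xpoly) i. \<Sum>k\<in>UNIV. \<phi> i k * v k"
  have "(\<Sum>i\<in>UNIV. f i * w i) = 0 \<longleftrightarrow> w \<in> range ?\<Phi>"
    using hb by (auto simp: hilbert_burch_def)
  also have "\<dots> \<longleftrightarrow> (\<exists>v :: 2 \<Rightarrow> 'a xpoly. w = (\<lambda>i. \<phi> i 1 * v 1 + \<phi> i 2 * v 2))"
    by (auto simp: UNIV_2 image_def)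
  also have "\<dots> \<longleftrightarrow> (\<exists>p q. w = (\<lambda>i. \<phi> i 1 * p + \<phi> i 2 * q))"
  proof safe
    fix p q
    show "\<exists>v. (\<lambda>i. \<phi> i 1 * p + \<phi> i 2 * q) = (\<lambda>i. \<phi> i 1 * v 1 + \<phi> i 2 * v (2 :: 2))"
      by (rule exI[of _ "\<lambda>k. if k = 1 then p else q"]) simp
  qed blast
  finally show ?thesis .
qed

lemma column_syzygy: "(\<Sum>i\<in>UNIV. f i * \<phi> i 1) = 0" "(\<Sum>i\<in>UNIV. f i * \<phi> i 2) = 0"
proof -
  show "(\<Sum>i\<in>UNIV. f i * \<phi> i 1) = 0"
    unfolding syzygy_iff by (intro exI[of _ 1] exI[of _ 0]) simp
  show "(\<Sum>i\<in>UNIV. f i * \<phi> i 2) = 0"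
    unfolding syzygy_iff by (intro exI[of _ 0] exI[of _ 1]) simp
qed

lemma lin_syzygy_in_G:
  assumes "(\<Sum>i\<in>UNIV. f i * w i) = 0"
  shows "lin w \<in> G"
proof -
  obtain p q where w: "w = (\<lambda>i. \<phi> i 1 * p + \<phi> i 2 * q)" using assms syzygy_iff by blast
  have "lin w = const_mp p * g1 + const_mp q * g2"
    by (simp add: w lin_scale_add g1_def g2_def sym_eq_lin)
  then show ?thesis unfolding G_def by blast
qed

lemma lin_koszul: "lin (\<lambda>l. (if l = i then r else 0) - (if l = k then t else 0)) =
    var_mp i * const_mp r - var_mp k * const_mp t"
proof -
  have "lin (\<lambda>l. (if l = i then r else 0) - (if l = k then t else 0)) =
      (\<Sum>l\<in>UNIV. (if l = i then var_mp i * const_mp r else 0) - (if l = k then var_mp k * const_mp t else 0))"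
    unfolding lin_def by (rule sum.cong) (auto simp: single_diff right_diff_distrib single_uminus)
  then show ?thesis by (simp add: sum_subtractf)
qed

lemma koszul_syzygy:
  "(\<Sum>l\<in>UNIV. f l * ((if l = i then f k else 0) - (if l = k then f i else 0))) = 0"
proof -
  have "(\<Sum>l\<in>UNIV. f l * ((if l = i then f k else 0) - (if l = k then f i else 0))) =
      (\<Sum>l\<in>UNIV. (if l = i then f i * f k else 0) - (if l = k then f k * f i else 0))"
    by (rule sum.cong) auto
  then show ?thesis by (simp add: sum_subtractf)
qed

text \<open>
  By the Hilbert--Burch theorem the minor of \<open>\<phi>\<close> omitting row \<open>k\<close> is a unit times \<open>f\<^sub>k\<close>. This weaker
  form controls zeros and radicals just as well, and it is immediate: the Koszul syzygies
  \<open>f\<^sub>k e\<^sub>i - f\<^sub>i e\<^sub>k\<close> and \<open>f\<^sub>k e\<^sub>l - f\<^sub>l e\<^sub>k\<close> have the minor \<open>f\<^sub>k\<^sup>2\<close> in the rows \<open>i, l\<close>, and they are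
  combinations of the columns of \<open>\<phi>\<close>.
\<close>

lemma minor_dvd_square:
  assumes "i \<noteq> l" "k \<noteq> i" "k \<noteq> l"
  shows "\<exists>D. f k ^ 2 = (\<phi> i 2 * \<phi> l 1 - \<phi> i 1 * \<phi> l 2) * D"
proof -
  obtain p q where 1: "(\<lambda>n. (if n = i then f k else 0) - (if n = k then f i else 0)) = (\<lambda>n. \<phi> n 1 * p + \<phi> n 2 * q)"
    using koszul_syzygy[of i k] unfolding syzygy_iff by blast
  obtain p' q' where 2: "(\<lambda>n. (if n = l then f k else 0) - (if n = k then f l else 0)) = (\<lambda>n. \<phi> n 1 * p' + \<phi> n 2 * q')"
    using koszul_syzygy[of l k] unfolding syzygy_iff by blast
  have "f k = \<phi> i 1 * p + \<phi> i 2 * q" "0 = \<phi> l 1 * p + \<phi> l 2 * q"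
    "0 = \<phi> i 1 * p' + \<phi> i 2 * q'" "f k = \<phi> l 1 * p' + \<phi> l 2 * q'"
    using fun_cong[OF 1, of i] fun_cong[OF 1, of l] fun_cong[OF 2, of i] fun_cong[OF 2, of l] assms by auto
  then have "f k * f k - 0 * 0 = (\<phi> i 1 * p + \<phi> i 2 * q) * (\<phi> l 1 * p' + \<phi> l 2 * q')
      - (\<phi> l 1 * p + \<phi> l 2 * q) * (\<phi> i 1 * p' + \<phi> i 2 * q')" by metis
  also have "\<dots> = (\<phi> i 2 * \<phi> l 1 - \<phi> i 1 * \<phi> l 2) * (q * p' - p * q')"
    by (simp add: algebra_simps)
  finally show ?thesis by (auto simp: power2_eq_square)
qed

lemma minor_nonzero: "i \<noteq> l \<Longrightarrow> \<phi> i 2 * \<phi> l 1 - \<phi> i 1 * \<phi> l 2 \<noteq> 0"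
  using distinct_third[of i l] minor_dvd_square[of i l] f_nonzero by (metis mult_zero_left power_not_zero)

lemma g2_nonzero: "g2 \<noteq> 0"
proof
  assume "g2 = 0"
  then have "\<phi> i 2 = 0" for i
    using lookup_lin[of "\<lambda>i. \<phi> i 2" i] by (simp add: g2_def sym_eq_lin)
  then show False
    using minor_nonzero distinct_third by (metis diff_zero mult_zero_left mult_zero_right)
qed

text \<open>As \<open>I\<close> contains powers of both variables, torsion with respect to \<open>I\<close> is torsion with respect to
  the variables.\<close>

lemma X_torsion:
  assumes J: "ideal J type_ring" and f: "\<And>i. f i \<in> torsion_radical J s"
  shows "\<exists>N. \<forall>j. X j ^ N * s \<in> J"
proof -
  have "\<exists>n. X j ^ n * s \<in> J" for j
  proof -
    obtain M r where "var_mp j ^ M = (\<Sum>i\<in>UNIV. r i * f i)" using X_power_in_ideal by blast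
    moreover have "(\<Sum>i\<in>UNIV. r i * f i) \<in> torsion_radical J s"
      using ideal_torsion_radical[OF J, of s] f by (intro ideal_sum) (auto simp: ideal_type_ring_iff)
    ultimately have "var_mp j \<in> torsion_radical J s" by (metis torsion_radical_power)
    then show ?thesis by (simp add: torsion_radical_def X_def)
  qed
  then obtain n where n: "\<And>j. X j ^ n j * s \<in> J" by metis
  have "X j ^ (n 1 + n 2) * s \<in> J" for j
  proof -
    obtain l where "n 1 + n 2 = l + n j" using exhaust_2[of j] by (metis add.commute)
    then have "X j ^ (n 1 + n 2) * s = X j ^ l * (X j ^ n j * s)" by (simp add: power_add mult.assoc)
    then show ?thesis using J n unfolding ideal_type_ring_iff by metis
  qed
  then show ?thesis by blast
qed

text \<open>
  The substitution \<open>T\<^sub>l \<mapsto> \<phi>\<^sub>i\<^sub>2 T\<^sub>l - \<delta>\<^sub>i\<^sub>l g\<^sub>2\<close> annihilates \<open>g\<^sub>2\<close> but not \<open>g\<^sub>1\<close>, because the minors of \<open>\<phi>\<close> do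
  not vanish; hence it annihilates \<open>a\<close>. Modulo \<open>g\<^sub>2\<close> it is multiplication by \<open>\<phi>\<^sub>i\<^sub>2\<close> on each \<open>T\<^sub>l\<close>, so
  a power of \<open>\<phi>\<^sub>i\<^sub>2\<close> moves \<open>a\<close> into \<open>(g\<^sub>2)\<close>. The entries \<open>\<phi>\<^sub>i\<^sub>2\<close> generate an ideal containing the minors, hence
  powers of the \<open>f\<^sub>k\<close> and of the variables, and \<open>S/(g\<^sub>2)\<close> has no torsion with respect to the latter.
\<close>

lemma regular_sequence:
  assumes ab: "a * g1 + b * g2 = 0"
  shows "\<exists>c. a = c * g2 \<and> b = - (c * g1)"
proof -
  let ?J = "{r * g2 | r. True}"
  have J: "ideal ?J type_ring"
    unfolding ideal_type_ring_iff
    by (auto simp: mult.assoc[symmetric] ring_distribs[symmetric])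
  have const: "unital_hom (const_mp :: 'a xpoly \<Rightarrow> 'a spoly)" by (rule unital_hom_const_mp)
  have "\<phi> i 2 \<in> torsion_radical ?J a" for i
  proof -
    define y where "y l = var_mp l * const_mp (\<phi> i 2) - (if l = i then g2 else 0)" for l
    interpret \<sigma>: unital_hom "graded_eval const_mp y" by (rule unital_hom_graded_eval) (rule const)
    have lin: "graded_eval const_mp y (lin w) =
        Polynomial.monom (lin (\<lambda>l. w l * \<phi> i 2) - g2 * const_mp (w i)) 1" for w
    proof -
      have "(\<Sum>l\<in>UNIV. y l * const_mp (w l)) =
          (\<Sum>l\<in>UNIV. var_mp l * const_mp (w l * \<phi> i 2) - (if l = i then g2 * const_mp (w i) else 0))"
        unfolding y_def
        by (rule sum.cong) (auto simp: algebra_simps mult_single)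
      also have "\<dots> = lin (\<lambda>l. w l * \<phi> i 2) - g2 * const_mp (w i)"
        by (simp add: sum_subtractf lin_def)
      finally show ?thesis
        by (simp add: lin_def \<sigma>.sum \<sigma>.mult graded_eval_const_var[OF const] mult.commute[of _ "[:_:]"]
            smult_monom mult.commute[of "const_mp _"] monom_sum[symmetric])
    qed
    have "lin (\<lambda>l. \<phi> l 2 * \<phi> i 2) = g2 * const_mp (\<phi> i 2)"
      unfolding lin_scale by (simp add: g2_def sym_eq_lin mult.commute)
    then have "graded_eval const_mp y g2 = 0"
      using lin[of "\<lambda>l. \<phi> l 2"] by (simp add: g2_def sym_eq_lin)
    moreover have "graded_eval const_mp y g1 \<noteq> 0"
    proof -
      obtain l where "l \<noteq> i" using distinct_third[of i i] by blast
      have "lin (\<lambda>l. \<phi> l 1 * \<phi> i 2) - g2 * const_mp (\<phi> i 1) =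
          lin (\<lambda>l. \<phi> l 1 * \<phi> i 2 + \<phi> l 2 * (- \<phi> i 1))"
        unfolding lin_scale_add lin_scale by (simp add: g2_def sym_eq_lin single_uminus mult.commute)
      moreover have "lookup (lin (\<lambda>l. \<phi> l 1 * \<phi> i 2 + \<phi> l 2 * (- \<phi> i 1))) (single l 1) \<noteq> 0"
        using minor_nonzero[of i l] \<open>l \<noteq> i\<close> by (simp add: lookup_lin algebra_simps del: One_nat_def)
      ultimately have "lin (\<lambda>l. \<phi> l 1 * \<phi> i 2) - g2 * const_mp (\<phi> i 1) \<noteq> 0" by force
      then show ?thesis using lin[of "\<lambda>l. \<phi> l 1"] by (simp add: g1_def sym_eq_lin monom_eq_0_iff)
    qed
    moreover have "graded_eval const_mp y a * graded_eval const_mp y g1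
        + graded_eval const_mp y b * graded_eval const_mp y g2 = 0"
      using arg_cong[OF ab, of "graded_eval const_mp y"] by (simp add: \<sigma>.add \<sigma>.mult \<sigma>.zero)
    ultimately have zero: "graded_eval const_mp y a = 0" by simp
    have "var_mp l * const_mp (\<phi> i 2) - y l \<in> ?J" for l
      by (auto simp: y_def intro: exI[of _ 0] exI[of _ 1])
    moreover have "(\<Sum>m | m \<in> keys a \<and> mdeg m = e. const_mp (lookup a m) * monom_val y m) = 0" for e
      using coeff_graded_eval[OF const, of y a e] by (simp add: zero)
    ultimately have "\<exists>n. const_mp (\<phi> i 2) ^ n * a \<in> ?J"
      by (rule power_mult_mem_of_graded_eval_zero[OF J])
    then show ?thesis by (simp add: torsion_radical_def)
  qed
  moreover have "r * t \<in> torsion_radical ?J a" if "t \<in> torsion_radical ?J a" for r t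
    using that ideal_torsion_radical[OF J, of a] by (simp add: ideal_type_ring_iff)
  ultimately have "D * \<phi> l 1 * \<phi> i 2 - D * \<phi> i 1 * \<phi> l 2 \<in> torsion_radical ?J a" for i l D
    by (intro ideal_diff[OF ideal_torsion_radical[OF J]]) simp_all
  then have minors: "(\<phi> i 2 * \<phi> l 1 - \<phi> i 1 * \<phi> l 2) * D \<in> torsion_radical ?J a" for i l D
    by (simp add: algebra_simps)
  have "f k ^ 2 \<in> torsion_radical ?J a" for k
  proof -
    obtain i where "i \<noteq> k" using distinct_third[of k k] by blast
    obtain l where "l \<noteq> i" "l \<noteq> k" using distinct_third[of i k] by blast
    then obtain D where "f k ^ 2 = (\<phi> i 2 * \<phi> l 1 - \<phi> i 1 * \<phi> l 2) * D"
      using minor_dvd_square[of i l k] \<open>i \<noteq> k\<close> by metis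
    then show ?thesis using minors by simp
  qed
  then have "f k \<in> torsion_radical ?J a" for k by (rule torsion_radical_power)
  then obtain N where "\<forall>j. X j ^ N * a \<in> ?J" using X_torsion[OF J] by blast
  \<comment> \<open>the quotients \<open>c1 / x\<^sub>1\<^sup>N\<close> and \<open>c2 / x\<^sub>2\<^sup>N\<close> coincide, so neither has a denominator\<close>
  then obtain c1 c2 where c: "X 1 ^ N * a = c1 * g2" "X 2 ^ N * a = c2 * g2" by blast
  have "X 2 ^ N * c1 * g2 = X 2 ^ N * (X 1 ^ N * a)" by (simp only: c(1) mult.assoc)
  also have "\<dots> = X 1 ^ N * (X 2 ^ N * a)" by (rule mult.left_commute)
  also have "\<dots> = X 1 ^ N * c2 * g2" by (simp only: c(2) mult.assoc)
  finally have "X 2 ^ N * c1 * g2 = X 1 ^ N * c2 * g2" .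
  then have "X 2 ^ N * c1 = X 1 ^ N * c2" using g2_nonzero by simp
  then have "X 1 ^ N dvd c1" using X_power_coprime[of 1 2 N N c1] by (simp add: dvd_def)
  then obtain e where "c1 = X 1 ^ N * e" by (auto elim: dvdE)
  then have "X 1 ^ N * a = X 1 ^ N * (e * g2)" using c by (simp add: mult_ac)
  then have a: "a = e * g2" by (simp add: X_neq_0)
  then have "(b + e * g1) * g2 = 0" using ab by (simp add: algebra_simps)
  then have "b = - (e * g1)" using g2_nonzero by (simp add: eq_neg_iff_add_eq_0)
  with a show ?thesis by blast
qed

text \<open>The map \<open>S \<rightarrow> Rees(I) \<subseteq> R[t]\<close>, \<open>T\<^sub>i \<mapsto> f\<^sub>i t\<close>.\<close>

definition to_Rees :: "'a spoly \<Rightarrow> 'a xpoly poly" where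
  "to_Rees = graded_eval (\<lambda>r. r) f"

lemma unital_hom_to_Rees: "unital_hom to_Rees"
  unfolding to_Rees_def by (rule unital_hom_graded_eval) (simp add: unital_hom_def)

sublocale to_Rees: unital_hom to_Rees by (rule unital_hom_to_Rees)

lemma to_Rees_const_var: "to_Rees (const_mp r) = [:r:]" "to_Rees (var_mp i) = Polynomial.monom (f i) 1"
  unfolding to_Rees_def by (rule graded_eval_const_var; simp add: unital_hom_def)+

lemma to_Rees_lin: "to_Rees (lin w) = Polynomial.monom (\<Sum>i\<in>UNIV. f i * w i) 1"
  by (simp add: lin_def to_Rees.sum to_Rees.mult to_Rees_const_var mult.commute[of _ "[:_:]"]
      smult_monom monom_sum mult.commute[of "f _"])

lemma to_Rees_G: "s \<in> G \<Longrightarrow> to_Rees s = 0"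
  using to_Rees_lin[of "\<lambda>i. \<phi> i 1"] to_Rees_lin[of "\<lambda>i. \<phi> i 2"]
  by (auto simp: G_def to_Rees.add to_Rees.mult g1_def g2_def sym_eq_lin column_syzygy)

text \<open>
  The Koszul syzygies give \<open>f\<^sub>i T\<^sub>l = f\<^sub>l T\<^sub>i\<close> modulo \<open>(g\<^sub>1, g\<^sub>2)\<close>. Thus \<open>f\<^sub>i\<^sup>n\<close> times a form \<open>s\<close> of degree \<open>n\<close> is
  congruent to \<open>s(f) T\<^sub>i\<^sup>n\<close>, which is \<open>0\<close> for \<open>s\<close> in the kernel.
\<close>

lemma kernel_to_Rees_torsion:
  assumes "to_Rees s = 0"
  shows "\<exists>N. \<forall>j. X j ^ N * s \<in> G"
proof (rule X_torsion[OF ideal_G])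
  fix i
  have "var_mp l * const_mp (f i) - const_mp (f l) * var_mp i \<in> G" for l
    using lin_syzygy_in_G[OF koszul_syzygy[of l i]] by (simp add: lin_koszul mult.commute)
  moreover have "(\<Sum>m | m \<in> keys s \<and> mdeg m = e. const_mp (lookup s m) *
      monom_val (\<lambda>l. const_mp (f l) * var_mp i) m) = (0 :: 'a spoly)" for e
  proof -
    have *: "monom_val (\<lambda>l. const_mp (f l) * var_mp i) m = const_mp (monom_val f m) * (var_mp i ^ mdeg m :: 'a spoly)" for m
      by (simp add: monom_val_scale unital_hom_monom_val[OF unital_hom_const_mp])
    have "(\<Sum>m | m \<in> keys s \<and> mdeg m = e. const_mp (lookup s m) *
        monom_val (\<lambda>l. const_mp (f l) * var_mp i) m) =
        (\<Sum>m | m \<in> keys s \<and> mdeg m = e. const_mp (lookup s m * monom_val f m) * (var_mp i ^ e :: 'a spoly))"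
      by (rule sum.cong) (auto simp: * mult_single simp flip: mult.assoc)
    also have "\<dots> = const_mp (coeff (to_Rees s) e) * var_mp i ^ e"
      unfolding to_Rees_def
      by (subst coeff_graded_eval)
         (simp_all add: unital_hom_def unital_hom.sum[OF unital_hom_const_mp] sum_distrib_right)
    finally show ?thesis using assms by simp
  qed
  ultimately have "\<exists>n. const_mp (f i) ^ n * s \<in> G"
    by (rule power_mult_mem_of_graded_eval_zero[OF ideal_G])
  then show "f i \<in> torsion_radical G s" by (simp add: torsion_radical_def)
qed

end


section \<open>The local cohomology correspondence\<close>

context hilbert_burch_ideal
begin

text \<open>
  The connecting homomorphisms of the Koszul complex on \<open>g\<^sub>1, g\<^sub>2\<close> against the Cech complex on
  \<open>x\<^sub>1, x\<^sub>2\<close>, with denominators cleared: \<open>s\<close> corresponds to the class of \<open>c / (x\<^sub>1x\<^sub>2)\<^sup>N\<close>.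
\<close>

definition cech_corr :: "nat \<Rightarrow> 'a spoly \<Rightarrow> 'a spoly \<Rightarrow> bool" where
  "cech_corr N s c \<longleftrightarrow> (\<exists>a b a' b'.
     X 1 ^ N * s = a * g1 + b * g2 \<and> X 2 ^ N * s = a' * g1 + b' * g2 \<and>
     X 2 ^ N * a - X 1 ^ N * a' = c * g2 \<and> X 2 ^ N * b - X 1 ^ N * b' = - (c * g1))"

lemma cech_corrI:
  assumes "X 1 ^ N * s = a * g1 + b * g2" "X 2 ^ N * s = a' * g1 + b' * g2"
    "X 2 ^ N * a - X 1 ^ N * a' = c * g2" "X 2 ^ N * b - X 1 ^ N * b' = - (c * g1)"
  shows "cech_corr N s c"
  using assms unfolding cech_corr_def by blast

lemma cech_corr_add:
  assumes "cech_corr N s c" "cech_corr N t e"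
  shows "cech_corr N (s + t) (c + e)"
proof -
  obtain a b a' b' where 1: "X 1 ^ N * s = a * g1 + b * g2" "X 2 ^ N * s = a' * g1 + b' * g2"
    "X 2 ^ N * a - X 1 ^ N * a' = c * g2" "X 2 ^ N * b - X 1 ^ N * b' = - (c * g1)"
    using assms(1) unfolding cech_corr_def by blast
  obtain p q p' q' where 2: "X 1 ^ N * t = p * g1 + q * g2" "X 2 ^ N * t = p' * g1 + q' * g2"
    "X 2 ^ N * p - X 1 ^ N * p' = e * g2" "X 2 ^ N * q - X 1 ^ N * q' = - (e * g1)"
    using assms(2) unfolding cech_corr_def by blast
  show ?thesis
  proof (rule cech_corrI)
    show "X 1 ^ N * (s + t) = (a + p) * g1 + (b + q) * g2"
      using 1(1) 2(1) by (simp add: algebra_simps)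
    show "X 2 ^ N * (s + t) = (a' + p') * g1 + (b' + q') * g2"
      using 1(2) 2(2) by (simp add: algebra_simps)
    have "X 2 ^ N * (a + p) - X 1 ^ N * (a' + p') =
        (X 2 ^ N * a - X 1 ^ N * a') + (X 2 ^ N * p - X 1 ^ N * p')" by (simp add: algebra_simps)
    then show "X 2 ^ N * (a + p) - X 1 ^ N * (a' + p') = (c + e) * g2"
      by (simp only: 1(3) 2(3) ring_distribs)
    have "X 2 ^ N * (b + q) - X 1 ^ N * (b' + q') =
        (X 2 ^ N * b - X 1 ^ N * b') + (X 2 ^ N * q - X 1 ^ N * q')" by (simp add: algebra_simps)
    then show "X 2 ^ N * (b + q) - X 1 ^ N * (b' + q') = - ((c + e) * g1)"
      by (simp only: 1(4) 2(4) ring_distribs minus_add_distrib)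
  qed
qed

lemma cech_corr_mult:
  assumes "cech_corr N s c"
  shows "cech_corr N (t * s) (t * c)"
proof -
  obtain a b a' b' where 1: "X 1 ^ N * s = a * g1 + b * g2" "X 2 ^ N * s = a' * g1 + b' * g2"
    "X 2 ^ N * a - X 1 ^ N * a' = c * g2" "X 2 ^ N * b - X 1 ^ N * b' = - (c * g1)"
    using assms unfolding cech_corr_def by blast
  show ?thesis
  proof (rule cech_corrI)
    have "X 1 ^ N * (t * s) = t * (X 1 ^ N * s)" by (rule mult.left_commute)
    also have "\<dots> = t * a * g1 + t * b * g2" unfolding 1(1) by (simp add: algebra_simps)
    finally show "X 1 ^ N * (t * s) = t * a * g1 + t * b * g2" .
    have "X 2 ^ N * (t * s) = t * (X 2 ^ N * s)" by (rule mult.left_commute)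
    also have "\<dots> = t * a' * g1 + t * b' * g2" unfolding 1(2) by (simp add: algebra_simps)
    finally show "X 2 ^ N * (t * s) = t * a' * g1 + t * b' * g2" .
    have "X 2 ^ N * (t * a) - X 1 ^ N * (t * a') = t * (X 2 ^ N * a - X 1 ^ N * a')"
      by (simp add: algebra_simps)
    then show "X 2 ^ N * (t * a) - X 1 ^ N * (t * a') = t * c * g2" by (simp only: 1(3) mult.assoc)
    have "X 2 ^ N * (t * b) - X 1 ^ N * (t * b') = t * (X 2 ^ N * b - X 1 ^ N * b')"
      by (simp add: algebra_simps)
    then show "X 2 ^ N * (t * b) - X 1 ^ N * (t * b') = - (t * c * g1)"
      by (simp only: 1(4) mult.assoc mult_minus_right)
  qed
qed

lemma cech_corr_raise:
  assumes "cech_corr N s c"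
  shows "cech_corr (N + M) s (X 1 ^ M * (X 2 ^ M * c))"
proof -
  obtain a b a' b' where 1: "X 1 ^ N * s = a * g1 + b * g2" "X 2 ^ N * s = a' * g1 + b' * g2"
    "X 2 ^ N * a - X 1 ^ N * a' = c * g2" "X 2 ^ N * b - X 1 ^ N * b' = - (c * g1)"
    using assms unfolding cech_corr_def by blast
  have shift: "X 2 ^ (N + M) * (X 1 ^ M * u) - X 1 ^ (N + M) * (X 2 ^ M * u') =
      X 1 ^ M * (X 2 ^ M * (X 2 ^ N * u - X 1 ^ N * u'))" for u u' :: "'a spoly"
    by (simp add: power_add algebra_simps)
  show ?thesis
  proof (rule cech_corrI)
    have "X 1 ^ (N + M) * s = X 1 ^ M * (X 1 ^ N * s)" by (simp add: power_add mult_ac)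
    then show "X 1 ^ (N + M) * s = X 1 ^ M * a * g1 + X 1 ^ M * b * g2"
      unfolding 1(1) by (simp only: ring_distribs mult.assoc)
    have "X 2 ^ (N + M) * s = X 2 ^ M * (X 2 ^ N * s)" by (simp add: power_add mult_ac)
    then show "X 2 ^ (N + M) * s = X 2 ^ M * a' * g1 + X 2 ^ M * b' * g2"
      unfolding 1(2) by (simp only: ring_distribs mult.assoc)
    show "X 2 ^ (N + M) * (X 1 ^ M * a) - X 1 ^ (N + M) * (X 2 ^ M * a') =
        X 1 ^ M * (X 2 ^ M * c) * g2"
      unfolding shift 1(3) by (simp only: mult.assoc)
    show "X 2 ^ (N + M) * (X 1 ^ M * b) - X 1 ^ (N + M) * (X 2 ^ M * b') =
        - (X 1 ^ M * (X 2 ^ M * c) * g1)"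
      unfolding shift 1(4) by (simp only: mult.assoc mult_minus_right)
  qed
qed

lemma S_piece_lin: "(\<And>i. homogeneous n (w i)) \<Longrightarrow> lin w \<in> S_piece 1 (int n)"
  unfolding lin_def
proof (rule S_piece_sum)
  fix i assume "\<And>i. homogeneous n (w i)"
  then have w: "lookup (w i) k \<noteq> 0 \<Longrightarrow> mdeg k = n" for k
    by (simp add: homogeneous_def in_keys_iff)
  show "var_mp i * const_mp (w i) \<in> S_piece 1 (int n)"
    unfolding mem_S_piece_iff
    by (auto simp: var_mp_def mult_single lookup_single when_def w split: if_splits)
qed

lemma g_bidegree: "g1 \<in> S_piece 1 (int \<mu>)" "g2 \<in> S_piece 1 (int d - int \<mu>)"
proof -
  have "\<mu> \<le> d" using hb by (auto simp: hilbert_burch_def)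
  then show "g1 \<in> S_piece 1 (int \<mu>)" "g2 \<in> S_piece 1 (int d - int \<mu>)"
    using hb S_piece_lin[of \<mu> "\<lambda>i. \<phi> i 1"] S_piece_lin[of "d - \<mu>" "\<lambda>i. \<phi> i 2"]
    by (simp_all add: g1_def g2_def sym_eq_lin hilbert_burch_def of_nat_diff)
qed

text \<open>
  Take components of the four equations: \<open>c\<close> sits where \<open>c g\<^sub>1 g\<^sub>2\<close> has the bidegree of
  \<open>(x\<^sub>1x\<^sub>2)\<^sup>N s\<close>.
\<close>

lemma cech_corr_bipart:
  assumes "cech_corr N s c"
  shows "cech_corr N (bipart p q s) (bipart (p - 2) (q + 2 * int N - int d) c)"
proof -
  obtain a b a' b' where 1: "X 1 ^ N * s = a * g1 + b * g2" "X 2 ^ N * s = a' * g1 + b' * g2"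
    "X 2 ^ N * a - X 1 ^ N * a' = c * g2" "X 2 ^ N * b - X 1 ^ N * b' = - (c * g1)"
    using assms unfolding cech_corr_def by blast
  let ?n = "int N" and ?m = "int \<mu>" and ?d = "int d"
  have X: "bipart i (?n + j) (X v ^ N * u) = X v ^ N * bipart i j u" for i j v u
    using bipart_mult[OF X_power_in_S_piece[of v N], of i j u] by simp
  have g1: "bipart (1 + i) (?m + j) (u * g1) = bipart i j u * g1" for i j u
    using bipart_mult[OF g_bidegree(1), of i j u] by (simp add: mult.commute)
  have g2: "bipart (1 + i) (?d - ?m + j) (u * g2) = bipart i j u * g2" for i j u
    using bipart_mult[OF g_bidegree(2), of i j u] by (simp add: mult.commute)
  \<comment> \<open>the same rules, solved for the bidegree on the left\<close>
  note X' = X[of _ "j - ?n" for j, simplified] and g1' = g1[of "i - 1" "j - ?m" for i j, simplified]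
    and g2' = g2[of "i - 1" "j - (?d - ?m)" for i j, simplified]
  let ?a = "\<lambda>u. bipart (p - 1) (q + ?n - ?m) u" and ?b = "\<lambda>u. bipart (p - 1) (q + ?n - (?d - ?m)) u"
  let ?c = "bipart (p - 2) (q + 2 * ?n - ?d) c"
  show ?thesis
  proof (rule cech_corrI)
    show "X 1 ^ N * bipart p q s = ?a a * g1 + ?b b * g2"
      using arg_cong[OF 1(1), of "bipart p (q + ?n)"] by (simp add: bipart_add X' g1' g2')
    show "X 2 ^ N * bipart p q s = ?a a' * g1 + ?b b' * g2"
      using arg_cong[OF 1(2), of "bipart p (q + ?n)"] by (simp add: bipart_add X' g1' g2')
    have e: "q + 2 * ?n - ?m - ?n = q + ?n - ?m" "p - 1 - 1 = p - 2"
      "q + 2 * ?n - ?m - (?d - ?m) = q + 2 * ?n - ?d"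
      "q + 2 * ?n - (?d - ?m) - ?n = q + ?n - (?d - ?m)"
      "q + 2 * ?n - (?d - ?m) - ?m = q + 2 * ?n - ?d" by simp_all
    show "X 2 ^ N * ?a a - X 1 ^ N * ?a a' = ?c * g2"
      using arg_cong[OF 1(3), of "bipart (p - 1) (q + 2 * ?n - ?m)"]
      unfolding bipart_diff X' g2' e .
    show "X 2 ^ N * ?b b - X 1 ^ N * ?b b' = - (?c * g1)"
      using arg_cong[OF 1(4), of "bipart (p - 1) (q + 2 * ?n - (?d - ?m))"]
      unfolding bipart_diff bipart_uminus X' g1' e .
  qed
qed

text \<open>
  Different pairs \<open>(N, c)\<close> may represent the same fraction; the solution \<open>inv_sys N c\<close> depends on the
  class only.
\<close>

definition corr :: "'a spoly \<Rightarrow> 'a spoly \<Rightarrow> bool" where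
  "corr s h \<longleftrightarrow> (\<exists>N c. cech_corr N s c \<and> h = inv_sys N c)"

lemma corr_add:
  assumes "corr s h" "corr t k"
  shows "corr (s + t) (h + k)"
proof -
  obtain N c M e where 1: "cech_corr N s c" "h = inv_sys N c" and 2: "cech_corr M t e" "k = inv_sys M e"
    using assms unfolding corr_def by blast
  have "cech_corr (N + M) (s + t) (X 1 ^ M * (X 2 ^ M * c) + X 1 ^ N * (X 2 ^ N * e))"
    using cech_corr_add[OF cech_corr_raise[OF 1(1), of M]] cech_corr_raise[OF 2(1), of N]
    by (simp add: add.commute[of M N])
  moreover have "inv_sys (N + M) (X 1 ^ M * (X 2 ^ M * c) + X 1 ^ N * (X 2 ^ N * e)) = h + k"
    using inv_sys_raise[of N M c] inv_sys_raise[of M N e] by (simp add: inv_sys_add 1 2 add.commute[of M N])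
  ultimately show ?thesis unfolding corr_def by metis
qed

lemma corr_mult: "corr s h \<Longrightarrow> corr (t * s) (act t h)"
  unfolding corr_def using cech_corr_mult by (metis inv_sys_mult)

lemma corr_diff:
  assumes "corr s h" "corr t k"
  shows "corr (s - t) (h - k)"
proof -
  have "act (- 1) k = - k"
    using act_add_left[of 1 "- 1" k] by (simp add: act_0_left act_one eq_neg_iff_add_eq_0 add.commute)
  then have "corr (- t) (- k)" using corr_mult[OF assms(2), of "- 1"] by simp
  from corr_add[OF assms(1) this] show ?thesis by simp
qed

text \<open>
  Combining the bidegree of \<open>c\<close> with the reversal in \<open>inv_sys N\<close> cancels \<open>N\<close> and leaves the twist
  \<open>(-2, -d + 2)\<close> of the theorem.
\<close>

lemma corr_bipart:
  assumes "corr s h"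
  shows "corr (bipart p q s) (bipart (p - 2) (int d - 2 - q) h)"
proof -
  obtain N c where N: "cech_corr N s c" "h = inv_sys N c" using assms unfolding corr_def by blast
  have "bipart (p - 2) (int d - 2 - q) h = inv_sys N (bipart (p - 2) (q + 2 * int N - int d) c)"
    using bipart_inv_sys[of "p - 2" N "q + 2 * int N - int d" c] by (simp add: N algebra_simps)
  then show ?thesis using cech_corr_bipart[OF N(1)] unfolding corr_def by blast
qed

text \<open>
  The equations for \<open>c\<close> put \<open>c g\<^sub>1\<close> and \<open>c g\<^sub>2\<close> into \<open>(x\<^sub>1\<^sup>N, x\<^sub>2\<^sup>N)\<close>, the kernel of \<open>inv_sys N\<close>; the image of \<open>s\<close> in the
  domain \<open>R[t]\<close> is killed by \<open>x\<^sub>1\<^sup>N\<close>.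
\<close>

lemma corr_kernel:
  assumes "corr s h"
  shows "to_Rees s = 0" "act g1 h = 0" "act g2 h = 0"
proof -
  obtain N c where N: "cech_corr N s c" and h: "h = inv_sys N c" using assms unfolding corr_def by blast
  then obtain a b a' b' where 1: "X 1 ^ N * s = a * g1 + b * g2" "X 2 ^ N * s = a' * g1 + b' * g2"
    "X 2 ^ N * a - X 1 ^ N * a' = c * g2" "X 2 ^ N * b - X 1 ^ N * b' = - (c * g1)"
    unfolding cech_corr_def by blast
  have "X 1 ^ N * s \<in> G" unfolding G_def using 1(1) by blast
  then have "to_Rees (X 1 ^ N * s) = 0" by (rule to_Rees_G)
  moreover have "to_Rees (X 1) \<noteq> 0"
  proof -
    have "(var_mp 1 :: 'a xpoly) \<noteq> 0"
      by (metis X_def X_neq_0 single_zero)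
    then show ?thesis by (simp add: X_def to_Rees_const_var)
  qed
  ultimately show "to_Rees s = 0" by (simp add: to_Rees.mult to_Rees.power)
  have "g1 * c = X 1 ^ N * b' + X 2 ^ N * (- b)"
    using 1(4) by (simp add: algebra_simps)
  then show "act g1 h = 0" unfolding h inv_sys_mult[symmetric] inv_sys_eq_0_iff_mem_ideal by blast
  have "g2 * c = X 1 ^ N * (- a') + X 2 ^ N * a"
    using 1(3) by (simp add: algebra_simps)
  then show "act g2 h = 0" unfolding h inv_sys_mult[symmetric] inv_sys_eq_0_iff_mem_ideal by blast
qed

text \<open>Torsion of \<open>s\<close> modulo \<open>(g\<^sub>1, g\<^sub>2)\<close> gives the two local expressions; their difference is a syzygy of
  \<open>g\<^sub>1, g\<^sub>2\<close>, and \<open>c\<close> measures it.\<close>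

lemma corr_total:
  assumes "to_Rees s = 0"
  shows "\<exists>h. corr s h"
proof -
  obtain N where N: "\<forall>j. X j ^ N * s \<in> G" using kernel_to_Rees_torsion[OF assms] by blast
  obtain a b where 1: "X 1 ^ N * s = a * g1 + b * g2" using N[rule_format, of 1] unfolding G_def by blast
  obtain a' b' where 2: "X 2 ^ N * s = a' * g1 + b' * g2" using N[rule_format, of 2] unfolding G_def by blast
  have "(X 2 ^ N * a - X 1 ^ N * a') * g1 + (X 2 ^ N * b - X 1 ^ N * b') * g2 =
      X 2 ^ N * (a * g1 + b * g2) - X 1 ^ N * (a' * g1 + b' * g2)"
    by (simp add: algebra_simps)
  also have "\<dots> = 0" by (simp add: mult.left_commute flip: 1 2)
  finally obtain c where "X 2 ^ N * a - X 1 ^ N * a' = c * g2" "X 2 ^ N * b - X 1 ^ N * b' = - (c * g1)"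
    using regular_sequence by blast
  with 1 2 show ?thesis unfolding corr_def by (meson cech_corrI)
qed

text \<open>
  Lift \<open>h\<close> to a numerator \<open>c\<close>. That \<open>h\<close> is a solution says that \<open>c g\<^sub>1\<close> and \<open>c g\<^sub>2\<close> lie in \<open>(x\<^sub>1\<^sup>N, x\<^sub>2\<^sup>N)\<close>; the
  coefficients witnessing this are the \<open>a, b, a', b'\<close> sought, and coprimality of \<open>x\<^sub>1\<^sup>N\<close> and \<open>x\<^sub>2\<^sup>N\<close> then
  produces \<open>s\<close>.
\<close>

lemma corr_surj:
  assumes "act g1 h = 0" "act g2 h = 0"
  shows "\<exists>s. corr s h"
proof -
  \<comment> \<open>large enough for the box to contain all exponents of \<open>h\<close>\<close>
  define N where "N = Suc (\<Sum>(m, k)\<in>supp h. lookup k 1 + lookup k 2)"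
  have "box N k" if "cf h m k \<noteq> 0" for m k
  proof -
    have "lookup k 1 + lookup k 2 \<le> (\<Sum>(m, k)\<in>supp h. lookup k 1 + lookup k 2)"
      using that member_le_sum[of "(m, k)" "supp h" "\<lambda>(m, k). lookup k 1 + lookup k 2"]
      by (simp add: finite_supp) (simp add: supp_def)
    then show ?thesis by (simp add: box_iff[of 1 2] N_def)
  qed
  then have h: "inv_sys N (inv_sys_lift N h) = h" by (rule inv_sys_lift)
  let ?c = "inv_sys_lift N h"
  have "inv_sys N (g1 * ?c) = 0" "inv_sys N (g2 * ?c) = 0" by (simp_all add: inv_sys_mult h assms)
  then obtain p q p' q' where 1: "g1 * ?c = X 1 ^ N * p + X 2 ^ N * q" and 2: "g2 * ?c = X 1 ^ N * p' + X 2 ^ N * q'"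
    unfolding inv_sys_eq_0_iff_mem_ideal by blast
  let ?u = "q' * g1 + (- q) * g2" and ?u' = "(- p') * g1 + p * g2"
  have "X 2 ^ N * ?u - X 1 ^ N * ?u' = g1 * (X 1 ^ N * p' + X 2 ^ N * q') - g2 * (X 1 ^ N * p + X 2 ^ N * q)"
    by (simp add: algebra_simps)
  also have "\<dots> = 0" by (simp only: 1[symmetric] 2[symmetric] mult.left_commute diff_self)
  finally have u: "X 2 ^ N * ?u = X 1 ^ N * ?u'" by simp
  then have "X 1 ^ N dvd ?u" using X_power_coprime[of 1 2 N N ?u] by (metis dvd_triv_left one_neq_two)
  then obtain s where s: "?u = X 1 ^ N * s" by (auto elim: dvdE)
  have "X 1 ^ N * (X 2 ^ N * s) = X 1 ^ N * ?u'"
    using u unfolding s by (simp only: mult.left_commute)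
  then have s': "X 2 ^ N * s = ?u'" by (simp add: X_neq_0)
  have "cech_corr N s ?c"
  proof (rule cech_corrI)
    show "X 1 ^ N * s = q' * g1 + (- q) * g2" by (rule s[symmetric])
    show "X 2 ^ N * s = (- p') * g1 + p * g2" by (rule s')
    show "X 2 ^ N * q' - X 1 ^ N * (- p') = ?c * g2" using 2 by (simp add: mult.commute add.commute)
    show "X 2 ^ N * (- q) - X 1 ^ N * p = - (?c * g1)" using 1 by (simp add: mult.commute)
  qed
  then show ?thesis unfolding corr_def using h by metis
qed

text \<open>
  If \<open>c\<close> lies in \<open>(x\<^sub>1\<^sup>N, x\<^sub>2\<^sup>N)\<close>, changing \<open>(a, b)\<close> and \<open>(a', b')\<close> by multiples of the trivial syzygy
  \<open>(g\<^sub>2, - g\<^sub>1)\<close> makes the two expressions for \<open>s\<close> agree, and the denominators cancel. Conversely,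
  an expression \<open>s = r g\<^sub>1 + t g\<^sub>2\<close> differs from the two given ones by such multiples, which exhibit \<open>c\<close>
  in \<open>(x\<^sub>1\<^sup>N, x\<^sub>2\<^sup>N)\<close>.
\<close>

lemma corr_zero_iff_mem:
  assumes "corr s h"
  shows "h = 0 \<longleftrightarrow> s \<in> G"
proof -
  obtain N c where N: "cech_corr N s c" and h: "h = inv_sys N c" using assms unfolding corr_def by blast
  then obtain a b a' b' where 1: "X 1 ^ N * s = a * g1 + b * g2" "X 2 ^ N * s = a' * g1 + b' * g2"
    "X 2 ^ N * a - X 1 ^ N * a' = c * g2" "X 2 ^ N * b - X 1 ^ N * b' = - (c * g1)"
    unfolding cech_corr_def by blast
  show ?thesis
  proof
    assume "h = 0"
    then obtain r t where c: "c = X 1 ^ N * r + X 2 ^ N * t"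
      unfolding h inv_sys_eq_0_iff_mem_ideal by blast
    have "X 2 ^ N * (a - t * g2) = X 1 ^ N * (a' + r * g2)"
      using 1(3) unfolding c by (simp add: algebra_simps)
    then have "X 1 ^ N dvd a - t * g2"
      using X_power_coprime[of 1 2 N N "a - t * g2"] by (metis dvd_triv_left one_neq_two)
    then obtain e where e: "a - t * g2 = X 1 ^ N * e" by (auto elim: dvdE)
    have "X 2 ^ N * (b + t * g1) = X 1 ^ N * (b' - r * g1)"
      using 1(4) unfolding c by (simp add: algebra_simps)
    then have "X 1 ^ N dvd b + t * g1"
      using X_power_coprime[of 1 2 N N "b + t * g1"] by (metis dvd_triv_left one_neq_two)
    then obtain e' where e': "b + t * g1 = X 1 ^ N * e'" by (auto elim: dvdE)
    have "X 1 ^ N * s = (a - t * g2) * g1 + (b + t * g1) * g2"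
      using 1(1) by (simp add: algebra_simps)
    also have "\<dots> = X 1 ^ N * (e * g1 + e' * g2)" by (simp add: e e' algebra_simps)
    finally have "s = e * g1 + e' * g2" by (simp add: X_neq_0)
    then show "s \<in> G" unfolding G_def by blast
  next
    assume "s \<in> G"
    then obtain r t where s: "s = r * g1 + t * g2" unfolding G_def by blast
    have "(a - X 1 ^ N * r) * g1 + (b - X 1 ^ N * t) * g2 = 0"
      using 1(1) unfolding s by (simp add: algebra_simps)
    then obtain e where e: "a - X 1 ^ N * r = e * g2" using regular_sequence by blast
    have "(a' - X 2 ^ N * r) * g1 + (b' - X 2 ^ N * t) * g2 = 0"
      using 1(2) unfolding s by (simp add: algebra_simps)
    then obtain e' where e': "a' - X 2 ^ N * r = e' * g2" using regular_sequence by blast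
    have "c * g2 = X 2 ^ N * (a - X 1 ^ N * r) - X 1 ^ N * (a' - X 2 ^ N * r)"
      using 1(3) by (simp add: algebra_simps)
    also have "\<dots> = (X 1 ^ N * (- e') + X 2 ^ N * e) * g2"
      unfolding e e' by (simp add: algebra_simps)
    finally have "c = X 1 ^ N * (- e') + X 2 ^ N * e" using g2_nonzero by (metis mult_right_cancel)
    then show "h = 0" unfolding h inv_sys_eq_0_iff_mem_ideal by blast
  qed
qed

lemma corr_unique:
  assumes "corr s h" "corr t k"
  shows "h = k \<longleftrightarrow> s - t \<in> G"
  using corr_zero_iff_mem[OF corr_diff[OF assms]] by simp

end


section \<open>The symmetric algebra as a quotient of \<open>S\<close>\<close>

lemma lin_diff: "lin (\<lambda>i. w i - w' i) = lin w - lin w'"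
  by (simp add: lin_def single_diff right_diff_distrib sum_subtractf)

lemma lin_delta: "lin (\<lambda>l. if l = i then 1 else 0) = var_mp i"
proof -
  have "lin (\<lambda>l. if l = i then 1 else 0) = (\<Sum>l\<in>UNIV. if l = i then var_mp i else 0)"
    unfolding lin_def by (rule sum.cong) auto
  then show ?thesis by simp
qed

context hilbert_burch_ideal
begin

definition ideal_f :: "'a xpoly set" where "ideal_f = genideal type_ring (range f)"

lemma ideal_ideal_f: "ideal ideal_f type_ring"
  unfolding ideal_f_def by (rule ring.genideal_ideal[OF cring.axioms(1)[OF cring_type_ring]]) simp

lemma f_in_ideal_f: "f i \<in> ideal_f"
  using ring.genideal_self[OF cring.axioms(1)[OF cring_type_ring], of "range f"] by (auto simp: ideal_f_def)

definition coords :: "'a xpoly \<Rightarrow> 3 \<Rightarrow> 'a xpoly" where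
  "coords a = (SOME r. a = (\<Sum>i\<in>UNIV. f i * r i))"

lemma coords: "a \<in> ideal_f \<Longrightarrow> (\<Sum>i\<in>UNIV. f i * coords a i) = a"
proof -
  assume "a \<in> ideal_f"
  then have "\<exists>r. a = (\<Sum>i\<in>UNIV. f i * r i)"
    unfolding ideal_f_def genideal_type_ring_range by (auto simp: mult.commute)
  from someI_ex[OF this] show ?thesis unfolding coords_def by (rule HOL.sym)
qed

text \<open>
  The polynomials over \<open>R\<close> in the symbols \<open>X\<^sub>a\<close> with \<open>a \<in> I\<close>; \<open>Sym(I)\<close> is the quotient of this ring by the
  ideal \<open>SI\<close> of relations below.
\<close>

definition C :: "(('a xpoly \<Rightarrow>\<^sub>0 nat) \<Rightarrow>\<^sub>0 'a xpoly) set" where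
  "C = {p. \<forall>m\<in>keys p. keys m \<subseteq> ideal_f}"

lemma gen_poly_ring_eq: "gen_poly_ring ideal_f = type_ring\<lparr>carrier := C\<rparr>"
  by (simp add: gen_poly_ring_def C_def)

lemma single_in_C: "keys m \<subseteq> ideal_f \<Longrightarrow> single m r \<in> C"
  by (simp add: C_def)

lemma const_in_C: "const_mp r \<in> C"
  by (rule single_in_C) simp

lemma var_in_C: "a \<in> ideal_f \<Longrightarrow> var_mp a \<in> C"
  by (simp add: var_mp_def single_in_C)

lemma closed_subring_C: "closed_subring C"
  unfolding closed_subring_def
proof (intro conjI ballI)
  show "1 \<in> C" using const_in_C[of 1] by simp
  fix a assume a: "a \<in> C"
  show "- a \<in> C" using a by (simp add: C_def)
  fix b assume b: "b \<in> C"
  show "a + b \<in> C" using a b keys_add[of a b] by (auto simp: C_def)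
  show "a * b \<in> C" unfolding C_def
  proof clarify
    fix m v assume "m \<in> keys (a * b)" "v \<in> keys m"
    then obtain k l where "m = k + l" "k \<in> keys a" "l \<in> keys b" using keys_mult[of a b] by blast
    moreover from this(1) \<open>v \<in> keys m\<close> have "v \<in> keys k \<union> keys l" using keys_add[of k l] by blast
    ultimately show "v \<in> ideal_f" using a b by (auto simp: C_def)
  qed
qed

lemma C_closed:
  "0 \<in> C" "a \<in> C \<Longrightarrow> b \<in> C \<Longrightarrow> a + b \<in> C" "a \<in> C \<Longrightarrow> b \<in> C \<Longrightarrow> a * b \<in> C"
  "a \<in> C \<Longrightarrow> b \<in> C \<Longrightarrow> a - b \<in> C"
  using closed_subring_C const_in_C[of 0] unfolding closed_subring_def
  by (auto simp: diff_conv_add_uminus simp del: add_uminus_conv_diff)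

definition SI :: "(('a xpoly \<Rightarrow>\<^sub>0 nat) \<Rightarrow>\<^sub>0 'a xpoly) set" where
  "SI = sym_ideal ideal_f"

lemma sym_rels_subset: "sym_rels ideal_f \<subseteq> C"
  using ideal_ideal_f unfolding sym_rels_def ideal_type_ring_iff
  by (auto intro!: C_closed(3,4) const_in_C var_in_C)

lemma ideal_SI: "ideal SI (gen_poly_ring ideal_f)"
proof -
  interpret cring "gen_poly_ring ideal_f" unfolding gen_poly_ring_eq by (rule cring_subring[OF closed_subring_C])
  show ?thesis unfolding SI_def sym_ideal_def
    by (rule genideal_ideal) (use sym_rels_subset in \<open>simp add: gen_poly_ring_eq\<close>)
qed

lemma SI_closed:
  "SI \<subseteq> C" "0 \<in> SI" "a \<in> SI \<Longrightarrow> b \<in> SI \<Longrightarrow> a + b \<in> SI" "r \<in> C \<Longrightarrow> a \<in> SI \<Longrightarrow> r * a \<in> SI"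
  "a \<in> SI \<Longrightarrow> - a \<in> SI" "a \<in> SI \<Longrightarrow> b \<in> SI \<Longrightarrow> a - b \<in> SI"
proof -
  have *: "SI \<subseteq> C \<and> 0 \<in> SI \<and> (\<forall>a\<in>SI. \<forall>b\<in>SI. a + b \<in> SI) \<and> (\<forall>r\<in>C. \<forall>a\<in>SI. r * a \<in> SI)"
    using ideal_SI unfolding gen_poly_ring_eq ideal_subring_iff[OF closed_subring_C] .
  then show "SI \<subseteq> C" "0 \<in> SI" "a \<in> SI \<Longrightarrow> b \<in> SI \<Longrightarrow> a + b \<in> SI" "r \<in> C \<Longrightarrow> a \<in> SI \<Longrightarrow> r * a \<in> SI"
    by blast+
  have "- 1 \<in> C" using closed_subring_C by (auto simp: closed_subring_def)
  with * show neg: "a \<in> SI \<Longrightarrow> - a \<in> SI" for a by (metis mult_minus1)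
  with * show "a \<in> SI \<Longrightarrow> b \<in> SI \<Longrightarrow> a - b \<in> SI" by (metis diff_conv_add_uminus)
qed

lemma SI_minimal:
  assumes "J \<subseteq> C" "0 \<in> J" "\<And>a b. a \<in> J \<Longrightarrow> b \<in> J \<Longrightarrow> a + b \<in> J"
    "\<And>r a. r \<in> C \<Longrightarrow> a \<in> J \<Longrightarrow> r * a \<in> J" "sym_rels ideal_f \<subseteq> J"
  shows "SI \<subseteq> J"
proof -
  interpret cring "gen_poly_ring ideal_f" unfolding gen_poly_ring_eq by (rule cring_subring[OF closed_subring_C])
  have "ideal J (gen_poly_ring ideal_f)"
    unfolding gen_poly_ring_eq ideal_subring_iff[OF closed_subring_C] using assms by blast
  then show ?thesis unfolding SI_def sym_ideal_def by (rule genideal_minimal) (rule assms)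
qed

lemma rel_add: "a \<in> ideal_f \<Longrightarrow> b \<in> ideal_f \<Longrightarrow> var_mp (a + b) - var_mp a - var_mp b \<in> SI"
  and rel_scale: "a \<in> ideal_f \<Longrightarrow> var_mp (r * a) - const_mp r * var_mp a \<in> SI"
proof -
  interpret cring "gen_poly_ring ideal_f" unfolding gen_poly_ring_eq by (rule cring_subring[OF closed_subring_C])
  have "sym_rels ideal_f \<subseteq> SI" unfolding SI_def sym_ideal_def
    by (rule genideal_self) (use sym_rels_subset in \<open>simp add: gen_poly_ring_eq\<close>)
  then show "a \<in> ideal_f \<Longrightarrow> b \<in> ideal_f \<Longrightarrow> var_mp (a + b) - var_mp a - var_mp b \<in> SI"
    and "a \<in> ideal_f \<Longrightarrow> var_mp (r * a) - const_mp r * var_mp a \<in> SI"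
    unfolding sym_rels_def by blast+
qed

text \<open>
  The lift \<open>T\<^sub>i \<mapsto> X\<^bsub>f\<^sub>i\<^esub>\<close> of \<open>S \<rightarrow> Sym(I)\<close>. It is to be shown surjective modulo \<open>SI\<close>, with \<open>(g\<^sub>1, g\<^sub>2)\<close> the
  preimage of \<open>SI\<close>.
\<close>

definition E :: "'a spoly \<Rightarrow> ('a xpoly \<Rightarrow>\<^sub>0 nat) \<Rightarrow>\<^sub>0 'a xpoly" where
  "E = eval_mp const_mp (\<lambda>i. var_mp (f i))"

sublocale E: unital_hom E
  unfolding E_def by (rule unital_hom_eval_mp) (rule unital_hom_const_mp)

lemma E_const_var: "E (const_mp r) = const_mp r" "E (var_mp i) = var_mp (f i)"
  unfolding E_def by (rule eval_mp_const eval_mp_var; rule unital_hom_const_mp)+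

lemma E_in_C: "E s \<in> C"
proof (induction s rule: poly_mapping_induct)
  case (single m r)
  have pow: "c ^ n \<in> C" if "c \<in> C" for c n
    using const_in_C[of 1] that by (induction n) (simp_all add: C_closed)
  have "(\<Prod>v\<in>A. var_mp (f v) ^ lookup m v) \<in> C" for A
    using const_in_C[of 1]
    by (induction A rule: infinite_finite_induct) (simp_all add: C_closed pow var_in_C f_in_ideal_f)
  then show ?case
    unfolding E_def eval_mp_single[OF unital_hom_const_mp] monom_val_def
    by (intro C_closed const_in_C)
qed (simp add: E.add C_closed)

text \<open>
  The relations say that \<open>a \<mapsto> X\<^sub>a\<close> is \<open>R\<close>-linear modulo \<open>SI\<close>; the second conjunct is carried along because
  the relations are available for elements of \<open>I\<close> only.
\<close>

lemma var_sum_in_SI: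
  assumes "finite A"
  shows "var_mp (\<Sum>i\<in>A. f i * w i) - (\<Sum>i\<in>A. var_mp (f i) * const_mp (w i)) \<in> SI \<and> (\<Sum>i\<in>A. f i * w i) \<in> ideal_f"
  using assms
proof induction
  case empty
  show ?case
    using rel_scale[of "f 1" 0] f_in_ideal_f ideal_ideal_f by (simp add: ideal_type_ring_iff)
next
  case (insert i A)
  let ?t = "\<Sum>i\<in>A. f i * w i" and ?u = "\<Sum>i\<in>A. var_mp (f i) * const_mp (w i)"
  have fi: "w i * f i \<in> ideal_f" using f_in_ideal_f ideal_ideal_f by (simp add: ideal_type_ring_iff)
  have "(var_mp (w i * f i + ?t) - var_mp (w i * f i) - var_mp ?t) +
      (var_mp (w i * f i) - const_mp (w i) * var_mp (f i)) + (var_mp ?t - ?u) \<in> SI"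
    using insert.IH fi f_in_ideal_f by (intro SI_closed(3) rel_add rel_scale) auto
  moreover have "w i * f i + ?t \<in> ideal_f" using fi insert.IH ideal_ideal_f by (simp add: ideal_type_ring_iff)
  ultimately show ?case using insert.hyps by (simp add: algebra_simps)
qed

lemma E_syzygy: "(\<Sum>i\<in>UNIV. f i * w i) = 0 \<Longrightarrow> E (lin w) \<in> SI"
proof -
  assume *: "(\<Sum>i\<in>UNIV. f i * w i) = 0"
  have "var_mp 0 \<in> SI" using var_sum_in_SI[of "{}" w] by simp
  moreover have "var_mp 0 - E (lin w) \<in> SI"
    using var_sum_in_SI[of UNIV w] by (simp add: lin_def E.sum E.mult E_const_var *)
  ultimately have "var_mp 0 - (var_mp 0 - E (lin w)) \<in> SI" by (rule SI_closed)
  then show ?thesis by simp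
qed

lemma E_G: "s \<in> G \<Longrightarrow> E s \<in> SI"
  using E_syzygy[OF column_syzygy(1)] E_syzygy[OF column_syzygy(2)] E_in_C
  by (auto simp: G_def E.add E.mult g1_def g2_def sym_eq_lin intro!: SI_closed(3,4))

text \<open>A left inverse of \<open>E\<close> modulo \<open>(g\<^sub>1, g\<^sub>2)\<close>. The choice of coordinates changes \<open>\<rho>\<close> by syzygies of \<open>f\<close> only.\<close>

definition \<rho> :: "(('a xpoly \<Rightarrow>\<^sub>0 nat) \<Rightarrow>\<^sub>0 'a xpoly) \<Rightarrow> 'a spoly" where
  "\<rho> = eval_mp const_mp (\<lambda>a. lin (coords a))"

sublocale \<rho>: unital_hom \<rho>
  unfolding \<rho>_def by (rule unital_hom_eval_mp) (rule unital_hom_const_mp)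

lemma \<rho>_const_var: "\<rho> (const_mp r) = const_mp r" "\<rho> (var_mp a) = lin (coords a)"
  unfolding \<rho>_def by (rule eval_mp_const eval_mp_var; rule unital_hom_const_mp)+

lemma \<rho>_SI: "p \<in> SI \<Longrightarrow> \<rho> p \<in> G"
proof -
  have G: "0 \<in> G" "a \<in> G \<Longrightarrow> b \<in> G \<Longrightarrow> a + b \<in> G" "a \<in> G \<Longrightarrow> r * a \<in> G" for a b r
    using ideal_G unfolding ideal_type_ring_iff by blast+
  have "SI \<subseteq> {p \<in> C. \<rho> p \<in> G}"
  proof (rule SI_minimal)
    have "\<rho> r \<in> G" if "r \<in> sym_rels ideal_f" for r
      using that unfolding sym_rels_def
    proof (safe, goal_cases)
      case (1 a b)
      have "(\<Sum>i\<in>UNIV. f i * ((coords (a + b) i - coords a i) - coords b i)) =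
          (\<Sum>i\<in>UNIV. f i * coords (a + b) i) - (\<Sum>i\<in>UNIV. f i * coords a i) - (\<Sum>i\<in>UNIV. f i * coords b i)"
        by (simp add: right_diff_distrib sum_subtractf)
      also have "\<dots> = 0" using 1 ideal_ideal_f by (simp add: coords ideal_type_ring_iff)
      finally have "lin (\<lambda>i. (coords (a + b) i - coords a i) - coords b i) \<in> G" by (rule lin_syzygy_in_G)
      then show ?case by (simp add: lin_diff \<rho>.diff \<rho>_const_var)
    next
      case (2 r a)
      have "(\<Sum>i\<in>UNIV. f i * (coords (r * a) i - coords a i * r)) =
          (\<Sum>i\<in>UNIV. f i * coords (r * a) i) - (\<Sum>i\<in>UNIV. f i * coords a i) * r"
        by (simp add: right_diff_distrib sum_subtractf sum_distrib_right mult.assoc)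
      also have "\<dots> = 0" using 2 ideal_ideal_f by (simp add: coords ideal_type_ring_iff)
      finally have "lin (\<lambda>i. coords (r * a) i - coords a i * r) \<in> G" by (rule lin_syzygy_in_G)
      then show ?case by (simp add: lin_diff lin_scale \<rho>.diff \<rho>.mult \<rho>_const_var)
    qed
    then show "sym_rels ideal_f \<subseteq> {p \<in> C. \<rho> p \<in> G}" using sym_rels_subset by blast
  qed (auto simp: C_closed G \<rho>.zero \<rho>.add \<rho>.mult)
  then show "p \<in> SI \<Longrightarrow> \<rho> p \<in> G" by blast
qed

lemma \<rho>_E: "\<rho> (E s) - s \<in> G"
proof (induction s rule: poly_mapping_induct)
  case (single m r)
  have "\<rho> (E (var_mp i)) - var_mp i \<in> G" for i
  proof -
    have "(\<Sum>l\<in>UNIV. f l * (coords (f i) l - (if l = i then 1 else 0))) =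
        (\<Sum>l\<in>UNIV. f l * coords (f i) l - (if l = i then f i else 0))"
      by (rule sum.cong) (auto simp: right_diff_distrib)
    also have "\<dots> = 0" using f_in_ideal_f by (simp add: sum_subtractf coords)
    finally have "lin (\<lambda>l. coords (f i) l - (if l = i then 1 else 0)) \<in> G" by (rule lin_syzygy_in_G)
    then show ?thesis by (simp add: lin_diff lin_delta E_const_var \<rho>_const_var)
  qed
  then have "monom_val (\<lambda>i. \<rho> (E (var_mp i))) m - monom_val var_mp m \<in> G"
    by (rule ideal_monom_val_cong[OF ideal_G])
  then have "const_mp r * (monom_val (\<lambda>i. \<rho> (E (var_mp i))) m - monom_val var_mp m) \<in> G"
    using ideal_G unfolding ideal_type_ring_iff by blast
  moreover have "\<rho> (E (const_mp r * monom_val var_mp m)) = const_mp r * monom_val (\<lambda>i. \<rho> (E (var_mp i))) m"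
    by (simp only: E.mult \<rho>.mult E_const_var \<rho>_const_var unital_hom_monom_val[OF E.unital_hom_axioms]
        unital_hom_monom_val[OF \<rho>.unital_hom_axioms])
  ultimately show ?case
    by (subst (1 2) single_eq_const_times_monom) (simp only: right_diff_distrib)
next
  case (add p q)
  have "\<rho> (E (p + q)) - (p + q) = (\<rho> (E p) - p) + (\<rho> (E q) - q)" by (simp add: E.add \<rho>.add)
  then show ?case using add ideal_G unfolding ideal_type_ring_iff by metis
qed

text \<open>
  \<open>\<rho>\<close> carries \<open>SI\<close> into \<open>(g\<^sub>1, g\<^sub>2)\<close> and undoes \<open>E\<close> modulo \<open>(g\<^sub>1, g\<^sub>2)\<close>.
\<close>

lemma E_in_SI_iff: "E s \<in> SI \<longleftrightarrow> s \<in> G"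
proof
  assume "E s \<in> SI"
  then have "\<rho> (E s) \<in> G" by (rule \<rho>_SI)
  from ideal_diff[OF ideal_G this \<rho>_E[of s]] show "s \<in> G" by simp
qed (rule E_G)

text \<open>
  The set of \<open>p\<close> reached modulo \<open>SI\<close> is closed under sums and products and contains each \<open>X\<^sub>a\<close>, by
  expanding \<open>a\<close> in the generators \<open>f\<^sub>i\<close>.
\<close>

lemma E_surj:
  assumes "p \<in> C"
  shows "\<exists>s. p - E s \<in> SI"
proof -
  let ?A = "{p \<in> C. \<exists>s. p - E s \<in> SI}"
  have const: "const_mp r \<in> ?A" for r
    using const_in_C SI_closed(2) by (auto intro!: exI[of _ "const_mp r"] simp: E_const_var)
  have add: "p + q \<in> ?A" if "p \<in> ?A" "q \<in> ?A" for p q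
  proof -
    from that obtain s t where "p - E s \<in> SI" "q - E t \<in> SI" by blast
    then have "(p - E s) + (q - E t) \<in> SI" by (rule SI_closed)
    then have "(p + q) - E (s + t) \<in> SI" by (simp add: E.add algebra_simps)
    then show ?thesis using that C_closed by blast
  qed
  have mult: "p * q \<in> ?A" if "p \<in> ?A" "q \<in> ?A" for p q
  proof -
    from that obtain s t where "p - E s \<in> SI" "q - E t \<in> SI" by blast
    then have "p * (q - E t) + E t * (p - E s) \<in> SI" using that E_in_C by (intro SI_closed(3,4)) auto
    then have "p * q - E (s * t) \<in> SI" by (simp add: E.mult algebra_simps)
    then show ?thesis using that C_closed by blast
  qed
  have var: "var_mp a \<in> ?A" if "a \<in> ideal_f" for a
  proof -
    have "var_mp a - E (lin (coords a)) \<in> SI"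
      using var_sum_in_SI[of UNIV "coords a"] that by (simp add: coords lin_def E.sum E.mult E_const_var)
    then show ?thesis using var_in_C[OF that] by blast
  qed
  have mono: "single m r \<in> ?A" if "keys m \<subseteq> ideal_f" for m r
  proof -
    have "1 \<in> ?A" using const[of 1] by simp
    then have pow: "var_mp v ^ n \<in> ?A" if "v \<in> ideal_f" for v n
      using var[OF that] mult by (induction n) (simp_all only: power_0 power_Suc)
    have "(\<Prod>v\<in>B. var_mp v ^ lookup m v) \<in> ?A" if "finite B" "B \<subseteq> ideal_f" for B
      using that
    proof (induction B rule: finite_induct)
      case empty
      show ?case using \<open>1 \<in> ?A\<close> by simp
    next
      case (insert v B)
      then have "var_mp v ^ lookup m v \<in> ?A" "(\<Prod>v\<in>B. var_mp v ^ lookup m v) \<in> ?A"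
        using pow[of v] by auto
      from mult[OF this] show ?case using insert.hyps by simp
    qed
    then have "monom_val var_mp m \<in> ?A" unfolding monom_val_def using that by simp
    from mult[OF const this] show ?thesis by (simp only: single_eq_const_times_monom[symmetric])
  qed
  have "(\<Sum>m\<in>B. single m (lookup p m)) \<in> ?A" if "finite B" "B \<subseteq> keys p" for B
    using that
  proof induction
    case empty
    show ?case using const[of 0] by simp
  next
    case (insert m B)
    then have "single m (lookup p m) \<in> ?A" "(\<Sum>m\<in>B. single m (lookup p m)) \<in> ?A"
      using assms mono[of m] by (auto simp: C_def)
    from add[OF this] show ?case using insert.hyps by simp
  qed
  from this[OF finite_keys order_refl] sum_singles_superset[OF finite_keys order_refl, of p]
  show ?thesis by auto
qed

abbreviation \<pi> :: "'a spoly \<Rightarrow> (('a xpoly \<Rightarrow>\<^sub>0 nat) \<Rightarrow>\<^sub>0 'a xpoly) set" where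
  "\<pi> \<equiv> S_to_Sym ideal_f f"

lemma \<pi>_coset: "\<pi> s = a_r_coset (gen_poly_ring ideal_f) SI (E s)"
  by (simp add: S_to_Sym_def SI_def E_def)

lemma coset_eq: "a_r_coset (gen_poly_ring ideal_f) SI p = (\<lambda>h. h + p) ` SI"
  by (auto simp: a_r_coset_def' gen_poly_ring_eq type_ring_def)

lemma coset_eq_iff:
  "a_r_coset (gen_poly_ring ideal_f) SI p = a_r_coset (gen_poly_ring ideal_f) SI q \<longleftrightarrow> p - q \<in> SI"
proof
  assume "a_r_coset (gen_poly_ring ideal_f) SI p = a_r_coset (gen_poly_ring ideal_f) SI q"
  then have "0 + p \<in> (\<lambda>h. h + q) ` SI" unfolding coset_eq using SI_closed(2) by blast
  then show "p - q \<in> SI" by auto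
next
  assume pq: "p - q \<in> SI"
  have sub: "(\<lambda>h. h + p) ` SI \<subseteq> (\<lambda>h. h + q) ` SI" if "p - q \<in> SI" for p q
  proof clarify
    fix h assume "h \<in> SI"
    then have "h + (p - q) \<in> SI" using that by (rule SI_closed)
    then show "h + p \<in> (\<lambda>h. h + q) ` SI" by (intro image_eqI[of _ _ "h + (p - q)"]) simp_all
  qed
  show "a_r_coset (gen_poly_ring ideal_f) SI p = a_r_coset (gen_poly_ring ideal_f) SI q"
    unfolding coset_eq using sub[OF pq] sub[of q p] SI_closed(5)[OF pq] by simp
qed

lemma \<pi>_eq_iff: "\<pi> s = \<pi> t \<longleftrightarrow> s - t \<in> G"
  unfolding \<pi>_coset coset_eq_iff by (simp add: E_in_SI_iff flip: E.diff)

lemma carrier_Sym: "carrier (Sym ideal_f) = range \<pi>"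
proof
  interpret ideal SI "gen_poly_ring ideal_f" by (rule ideal_SI)
  have carrier: "carrier (Sym ideal_f) = a_r_coset (gen_poly_ring ideal_f) SI ` C"
    unfolding Sym_def FactRing_def SI_def[symmetric] A_RCOSETS_def'
    by (auto simp: gen_poly_ring_eq)
  show "range \<pi> \<subseteq> carrier (Sym ideal_f)" unfolding carrier \<pi>_coset using E_in_C by blast
  show "carrier (Sym ideal_f) \<subseteq> range \<pi>"
    unfolding carrier
  proof clarify
    fix p assume "p \<in> C"
    then obtain s where "p - E s \<in> SI" using E_surj by blast
    then have "a_r_coset (gen_poly_ring ideal_f) SI p = \<pi> s" by (simp add: \<pi>_coset coset_eq_iff)
    then show "a_r_coset (gen_poly_ring ideal_f) SI p \<in> range \<pi>" by blast
  qed
qed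

lemma \<pi>_hom:
  "\<pi> s \<oplus>\<^bsub>Sym ideal_f\<^esub> \<pi> t = \<pi> (s + t)" "\<pi> s \<otimes>\<^bsub>Sym ideal_f\<^esub> \<pi> t = \<pi> (s * t)" "\<zero>\<^bsub>Sym ideal_f\<^esub> = \<pi> 0"
proof -
  interpret ideal SI "gen_poly_ring ideal_f" by (rule ideal_SI)
  have hom: "a_r_coset (gen_poly_ring ideal_f) SI \<in> ring_hom (gen_poly_ring ideal_f) (Sym ideal_f)"
    unfolding Sym_def SI_def[symmetric] by (rule rcos_ring_hom)
  have E: "E s \<in> carrier (gen_poly_ring ideal_f)" for s using E_in_C by (simp add: gen_poly_ring_eq)
  show "\<pi> s \<oplus>\<^bsub>Sym ideal_f\<^esub> \<pi> t = \<pi> (s + t)"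
    using ring_hom_add[OF hom E E, of s t] by (simp add: \<pi>_coset E.add gen_poly_ring_eq type_ring_def)
  show "\<pi> s \<otimes>\<^bsub>Sym ideal_f\<^esub> \<pi> t = \<pi> (s * t)"
    using ring_hom_mult[OF hom E E, of s t] by (simp add: \<pi>_coset E.mult gen_poly_ring_eq type_ring_def)
  show "\<zero>\<^bsub>Sym ideal_f\<^esub> = \<pi> 0"
    by (simp add: Sym_def FactRing_def SI_def[symmetric] \<pi>_coset coset_eq E.zero)
qed

lemma Sym_to_Rees_\<pi>: "Sym_to_Rees (\<pi> s) = to_Rees s"
proof -
  define \<eta> :: "(('a xpoly \<Rightarrow>\<^sub>0 nat) \<Rightarrow>\<^sub>0 'a xpoly) \<Rightarrow> 'a xpoly poly"
    where "\<eta> = eval_mp (\<lambda>r. [:r:]) (\<lambda>a. Polynomial.monom a 1)"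
  interpret \<eta>: unital_hom \<eta> unfolding \<eta>_def by (rule unital_hom_eval_mp) (rule unital_hom_const_poly)
  have \<eta>: "\<eta> (const_mp r) = [:r:]" "\<eta> (var_mp a) = Polynomial.monom a 1" for r a
    unfolding \<eta>_def by (rule eval_mp_const eval_mp_var; rule unital_hom_const_poly)+
  have "SI \<subseteq> {p \<in> C. \<eta> p = 0}"
  proof (rule SI_minimal)
    have "\<eta> p = 0" if "p \<in> sym_rels ideal_f" for p
      using that by (auto simp: sym_rels_def \<eta>.diff \<eta>.mult \<eta> smult_monom simp flip: add_monom simp del: One_nat_def)
    then show "sym_rels ideal_f \<subseteq> {p \<in> C. \<eta> p = 0}" using sym_rels_subset by blast
  qed (auto simp: C_closed \<eta>.zero \<eta>.add \<eta>.mult)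
  then have "\<eta> ` \<pi> s = {\<eta> (E s)}"
    unfolding \<pi>_coset coset_eq using SI_closed(2) by (force simp: \<eta>.add)
  moreover have "\<eta> (E s) = to_Rees s"
    by (rule unital_hom_eqI[OF unital_hom_comp[OF \<eta>.unital_hom_axioms E.unital_hom_axioms] unital_hom_to_Rees])
       (simp_all add: E_const_var \<eta> to_Rees_const_var)
  ultimately show ?thesis by (simp add: Sym_to_Rees_def \<eta>_def)
qed

lemma kernel_Sym_to_Rees: "a_kernel (Sym ideal_f) (Rees ideal_f) Sym_to_Rees = \<pi> ` {s. to_Rees s = 0}"
  unfolding a_kernel_def' carrier_Sym by (auto simp: Sym_to_Rees_\<pi> Rees_def type_ring_def)

end


section \<open>Verifying bigraded module structures\<close>

text \<open>
  Pulling the structure back along the isomorphism saves checking the module axioms and the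
  uniqueness of decompositions among cosets in \<open>Sym(I)\<close>.
\<close>

lemma bigraded_iso_transport:
  fixes M :: "('a::field spoly, 'm) bigraded_module" and N :: "('a spoly, 'n) bigraded_module"
  assumes N: "is_bigraded_module N"
    and bij: "bij_betw \<psi> (carrier M) (carrier N)"
    and zero: "\<zero>\<^bsub>M\<^esub> \<in> carrier M" "\<psi> \<zero>\<^bsub>M\<^esub> = \<zero>\<^bsub>N\<^esub>"
    and add: "\<And>x y. x \<in> carrier M \<Longrightarrow> y \<in> carrier M \<Longrightarrow>
      x \<oplus>\<^bsub>M\<^esub> y \<in> carrier M \<and> \<psi> (x \<oplus>\<^bsub>M\<^esub> y) = \<psi> x \<oplus>\<^bsub>N\<^esub> \<psi> y"
    and smult: "\<And>s x. x \<in> carrier M \<Longrightarrow>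
      s \<odot>\<^bsub>M\<^esub> x \<in> carrier M \<and> \<psi> (s \<odot>\<^bsub>M\<^esub> x) = s \<odot>\<^bsub>N\<^esub> \<psi> x"
    and piece: "\<And>p q. piece M p q \<subseteq> carrier M" "\<And>p q. \<psi> ` piece M p q = piece N p q"
  shows "bigraded_iso M N"
proof -
  have mod: "Module.module type_ring N"
    and sub: "\<And>p q. subgroup (piece N p q) (add_monoid N)"
    and smult_piece: "\<And>i j p q s m. s \<in> S_piece i j \<Longrightarrow> m \<in> piece N p q \<Longrightarrow> s \<odot>\<^bsub>N\<^esub> m \<in> piece N (i + p) (j + q)"
    and decomp: "\<And>m. m \<in> carrier N \<Longrightarrow> \<exists>!c :: int \<times> int \<Rightarrow> 'n.
        (\<forall>p q. c (p, q) \<in> piece N p q) \<and> finite {k. c k \<noteq> \<zero>\<^bsub>N\<^esub>} \<and>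
        m = (\<Oplus>\<^bsub>N\<^esub>k\<in>{k. c k \<noteq> \<zero>\<^bsub>N\<^esub>}. c k)"
    using N by (auto simp: is_bigraded_module_def)
  interpret N: Module.module type_ring N by (rule mod)
  have inj: "\<psi> x = \<psi> y \<longleftrightarrow> x = y" if "x \<in> carrier M" "y \<in> carrier M" for x y
    using bij that by (auto simp: bij_betw_def inj_on_def)
  have \<psi>: "\<psi> x \<in> carrier N" if "x \<in> carrier M" for x
    using bij that by (auto simp: bij_betw_def)
  have surj: "\<exists>x\<in>carrier M. \<psi> x = y" if "y \<in> carrier N" for y
    using bij that unfolding bij_betw_def by (metis imageE)
  have eqI: "x = y" if "x \<in> carrier M" "y \<in> carrier M" "\<psi> x = \<psi> y" for x y
    using inj that by blast
  have closed: "x \<oplus>\<^bsub>M\<^esub> y \<in> carrier M" "r \<odot>\<^bsub>M\<^esub> x \<in> carrier M"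
    and hom: "\<psi> (x \<oplus>\<^bsub>M\<^esub> y) = \<psi> x \<oplus>\<^bsub>N\<^esub> \<psi> y" "\<psi> (r \<odot>\<^bsub>M\<^esub> x) = r \<odot>\<^bsub>N\<^esub> \<psi> x"
    if "x \<in> carrier M" "y \<in> carrier M" for x y r
    using add smult that by blast+
  interpret M: abelian_group M
  proof (rule abelian_groupI)
    fix x assume x: "x \<in> carrier M"
    then obtain y where y: "y \<in> carrier M" "\<psi> y = \<ominus>\<^bsub>N\<^esub> \<psi> x" using surj \<psi> by (metis N.a_inv_closed)
    have "y \<oplus>\<^bsub>M\<^esub> x = \<zero>\<^bsub>M\<^esub>"
      by (rule eqI) (simp_all add: x y zero closed hom \<psi> N.l_neg)
    with y show "\<exists>y\<in>carrier M. y \<oplus>\<^bsub>M\<^esub> x = \<zero>\<^bsub>M\<^esub>" by blast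
    show "\<zero>\<^bsub>M\<^esub> \<oplus>\<^bsub>M\<^esub> x = x"
      by (rule eqI) (simp_all add: x zero closed hom \<psi>)
    fix y assume y: "y \<in> carrier M"
    show "x \<oplus>\<^bsub>M\<^esub> y = y \<oplus>\<^bsub>M\<^esub> x"
      by (rule eqI) (simp_all add: x y closed hom \<psi> N.a_comm)
    fix z assume z: "z \<in> carrier M"
    show "(x \<oplus>\<^bsub>M\<^esub> y) \<oplus>\<^bsub>M\<^esub> z = x \<oplus>\<^bsub>M\<^esub> (y \<oplus>\<^bsub>M\<^esub> z)"
      by (rule eqI) (simp_all add: x y z closed hom \<psi> N.a_assoc)
  qed (simp_all add: zero closed)
  have modM: "Module.module type_ring M"
  proof (rule moduleI)
    show "cring type_ring" by (rule cring_type_ring)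
    show "abelian_group M" by (rule M.abelian_group_axioms)
    fix a b x assume x: "x \<in> carrier M"
    show "a \<odot>\<^bsub>M\<^esub> x \<in> carrier M" by (rule closed) (rule x)+
    show "(a \<oplus>\<^bsub>type_ring\<^esub> b) \<odot>\<^bsub>M\<^esub> x = a \<odot>\<^bsub>M\<^esub> x \<oplus>\<^bsub>M\<^esub> b \<odot>\<^bsub>M\<^esub> x"
      by (rule eqI) (use N.smult_l_distr[of a b "\<psi> x"] x in \<open>simp_all add: closed hom \<psi>\<close>)
    show "(a \<otimes>\<^bsub>type_ring\<^esub> b) \<odot>\<^bsub>M\<^esub> x = a \<odot>\<^bsub>M\<^esub> (b \<odot>\<^bsub>M\<^esub> x)"
      by (rule eqI) (use N.smult_assoc1[of a b "\<psi> x"] x in \<open>simp_all add: closed hom \<psi>\<close>)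
    show "\<one>\<^bsub>type_ring\<^esub> \<odot>\<^bsub>M\<^esub> x = x"
      by (rule eqI) (use N.smult_one[of "\<psi> x"] x in \<open>simp_all add: closed hom \<psi>\<close>)
    fix y assume y: "y \<in> carrier M"
    show "a \<odot>\<^bsub>M\<^esub> (x \<oplus>\<^bsub>M\<^esub> y) = a \<odot>\<^bsub>M\<^esub> x \<oplus>\<^bsub>M\<^esub> a \<odot>\<^bsub>M\<^esub> y"
      by (rule eqI) (use N.smult_r_distr[of a "\<psi> x" "\<psi> y"] x y in \<open>simp_all add: closed hom \<psi>\<close>)
  qed
  have piece_iff: "x \<in> piece M p q \<longleftrightarrow> x \<in> carrier M \<and> \<psi> x \<in> piece N p q" for x p q
  proof
    assume x: "x \<in> carrier M \<and> \<psi> x \<in> piece N p q"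
    then obtain y where "y \<in> piece M p q" "\<psi> y = \<psi> x" using piece(2)[of p q] by (metis imageE)
    then show "x \<in> piece M p q" using inj x piece(1) by blast
  qed (use piece in blast)
  have neg: "\<psi> (\<ominus>\<^bsub>M\<^esub> x) = \<ominus>\<^bsub>N\<^esub> \<psi> x" if "x \<in> carrier M" for x
  proof -
    have "\<psi> (\<ominus>\<^bsub>M\<^esub> x) \<oplus>\<^bsub>N\<^esub> \<psi> x = \<zero>\<^bsub>N\<^esub>"
      using add[of "\<ominus>\<^bsub>M\<^esub> x" x] that by (simp add: M.l_neg zero)
    then show ?thesis using that \<psi> by (metis M.a_inv_closed N.minus_equality)
  qed
  have subM: "subgroup (piece M p q) (add_monoid M)" for p q
  proof
    interpret P: subgroup "piece N p q" "add_monoid N" by (rule sub)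
    show "piece M p q \<subseteq> carrier (add_monoid M)" using piece(1) by simp
    show "\<one>\<^bsub>add_monoid M\<^esub> \<in> piece M p q" using P.one_closed zero by (simp add: piece_iff)
    fix x assume x: "x \<in> piece M p q"
    show "inv\<^bsub>add_monoid M\<^esub> x \<in> piece M p q"
      using x P.m_inv_closed[of "\<psi> x"] neg[of x] unfolding piece_iff a_inv_def[symmetric] by simp
    fix y assume y: "y \<in> piece M p q"
    show "x \<otimes>\<^bsub>add_monoid M\<^esub> y \<in> piece M p q"
      using x y P.m_closed[of "\<psi> x" "\<psi> y"] add[of x y] unfolding piece_iff by simp
  qed
  have finsum: "finsum M c A \<in> carrier M \<and> \<psi> (finsum M c A) = finsum N (\<lambda>k. \<psi> (c k)) A"
    if "c \<in> A \<rightarrow> carrier M" for c :: "int \<times> int \<Rightarrow> 'm" and A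
    using that
  proof (induction A rule: infinite_finite_induct)
    case (insert k A)
    then have "c k \<in> carrier M" "c \<in> A \<rightarrow> carrier M" "(\<lambda>k. \<psi> (c k)) \<in> A \<rightarrow> carrier N" using \<psi> by auto
    then show ?case using insert add \<psi> by (simp add: M.finsum_insert N.finsum_insert)
  qed (simp_all add: zero M.finsum_infinite N.finsum_infinite)
  have decompM: "\<exists>!c :: int \<times> int \<Rightarrow> 'm.
      (\<forall>p q. c (p, q) \<in> piece M p q) \<and> finite {k. c k \<noteq> \<zero>\<^bsub>M\<^esub>} \<and>
      m = (\<Oplus>\<^bsub>M\<^esub>k\<in>{k. c k \<noteq> \<zero>\<^bsub>M\<^esub>}. c k)" if m: "m \<in> carrier M" for m
  proof -
    let ?PM = "\<lambda>c. (\<forall>p q. c (p, q) \<in> piece M p q) \<and> finite {k. c k \<noteq> \<zero>\<^bsub>M\<^esub>} \<and>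
      m = (\<Oplus>\<^bsub>M\<^esub>k\<in>{k. c k \<noteq> \<zero>\<^bsub>M\<^esub>}. c k)"
    let ?PN = "\<lambda>c. (\<forall>p q. c (p, q) \<in> piece N p q) \<and> finite {k. c k \<noteq> \<zero>\<^bsub>N\<^esub>} \<and>
      \<psi> m = (\<Oplus>\<^bsub>N\<^esub>k\<in>{k. c k \<noteq> \<zero>\<^bsub>N\<^esub>}. c k)"
    have iff: "?PM c \<longleftrightarrow> (\<forall>k. c k \<in> carrier M) \<and> ?PN (\<lambda>k. \<psi> (c k))" for c
    proof (cases "\<forall>k. c k \<in> carrier M")
      case True
      then have "{k. \<psi> (c k) \<noteq> \<zero>\<^bsub>N\<^esub>} = {k. c k \<noteq> \<zero>\<^bsub>M\<^esub>}"
        using inj[OF _ zero(1)] zero(2) by auto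
      moreover have "m = finsum M c A \<longleftrightarrow> \<psi> m = finsum N (\<lambda>k. \<psi> (c k)) A" for A
        using finsum[of c A] inj[OF m, of "finsum M c A"] True by auto
      ultimately show ?thesis using True by (simp add: piece_iff)
    next
      case False
      then obtain p q where "c (p, q) \<notin> carrier M" by (metis surj_pair)
      then have "c (p, q) \<notin> piece M p q" using piece(1) by blast
      then show ?thesis using False by blast
    qed
    obtain c where c: "?PN c" and uniq: "\<And>c'. ?PN c' \<Longrightarrow> c' = c" using decomp[OF \<psi>[OF m]] by blast
    have "\<exists>x\<in>carrier M. \<psi> x = c k" for k
    proof -
      obtain p q where "k = (p, q)" by (cases k)
      then have "c k \<in> piece N p q" using c by simp
      then have "c k \<in> \<psi> ` piece M p q" by (simp only: piece(2))
      then obtain x where "x \<in> piece M p q" "c k = \<psi> x" by (rule imageE)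
      then show ?thesis using piece(1)[of p q] by auto
    qed
    then obtain c' where c': "\<And>k. c' k \<in> carrier M" "\<And>k. \<psi> (c' k) = c k" by metis
    show ?thesis
    proof (rule ex1I[of _ c'])
      show "?PM c'" unfolding iff using c c' by simp
      fix e assume "?PM e"
      then have e: "\<forall>k. e k \<in> carrier M" "?PN (\<lambda>k. \<psi> (e k))" unfolding iff by blast+
      from uniq[OF e(2)] have "\<psi> (e k) = \<psi> (c' k)" for k unfolding c'(2) by (rule fun_cong)
      then show "e = c'" using inj e(1) c'(1) by (intro ext) blast
    qed
  qed
  have "s \<odot>\<^bsub>M\<^esub> m \<in> piece M (i + p) (j + q)" if "s \<in> S_piece i j" "m \<in> piece M p q" for i j p q s m
    using that smult[of m s] smult_piece unfolding piece_iff by simp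
  then have "is_bigraded_module M"
    unfolding is_bigraded_module_def using modM subM decompM by blast
  then show ?thesis
    unfolding bigraded_iso_def using N bij add smult piece(2) by (intro conjI exI[of _ \<psi>]) auto
qed

lemma act_uminus: "act s (- h) = - act s h"
  using act_add_right[of s h "- h"] by (simp add: act_0_right eq_neg_iff_add_eq_0 add.commute)

lemma Sol_eq: "Sol (fourier (S_to_T s)) (fourier (S_to_T t)) = {h. act s h = 0 \<and> act t h = 0}"
  by (simp add: Sol_def act_def)

text \<open>
  A bihomogeneous operator maps distinct components of \<open>h\<close> to distinct components of its value, so the
  components of a solution are solutions.
\<close>

lemma is_bigraded_module_shifted_Sol:
  fixes s t :: "'a::field spoly"
  assumes s: "s \<in> S_piece i j" and t: "t \<in> S_piece i' j'"
  shows "is_bigraded_module (bg_shift (Sol_module (fourier (S_to_T s)) (fourier (S_to_T t))) a b)"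
    (is "is_bigraded_module ?N")
proof -
  define V where "V = {h. act s h = 0 \<and> act t h = 0}"
  have V: "0 \<in> V" "\<And>g h. g \<in> V \<Longrightarrow> h \<in> V \<Longrightarrow> g + h \<in> V" "\<And>h. h \<in> V \<Longrightarrow> - h \<in> V"
    by (simp_all add: V_def act_0_right act_add_right act_uminus)
  have V_act: "act r h \<in> V" if "h \<in> V" for r h
  proof -
    have "act s (act r h) = act r (act s h)" "act t (act r h) = act r (act t h)"
      by (simp_all add: mult.commute flip: act_mult)
    then show ?thesis using that by (simp add: V_def act_0_right)
  qed
  have V_bipart: "bipart p q h \<in> V" if "h \<in> V" for p q h
    using that bipart_act[OF s, of p q h] bipart_act[OF t, of p q h] by (simp add: V_def)
  have N: "carrier ?N = V" "\<zero>\<^bsub>?N\<^esub> = 0" "x \<oplus>\<^bsub>?N\<^esub> y = x + y" "r \<odot>\<^bsub>?N\<^esub> x = act r x"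
    "piece ?N p q = V \<inter> S_piece (p + a) (- (q + b))" for x y r p q
    by (simp_all add: bg_shift_def Sol_module_def Sol_eq V_def act_def)
  interpret N: abelian_group ?N
    by (rule abelian_groupI) (use V in \<open>auto simp: N intro!: bexI[of _ "- _"]\<close>)
  have neg: "\<ominus>\<^bsub>?N\<^esub> x = - x" if "x \<in> V" for x
    by (rule N.minus_equality) (use that V in \<open>auto simp: N\<close>)
  have module: "Module.module type_ring ?N"
    by (rule moduleI[OF cring_type_ring N.abelian_group_axioms])
       (auto simp: N V_act act_add_left act_add_right act_mult act_one)
  have finsum: "finsum ?N c A = sum c A" if "c \<in> A \<rightarrow> V" for c :: "int \<times> int \<Rightarrow> 'a spoly" and A
    using that
  proof (induction A rule: infinite_finite_induct)
    case (insert k A)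
    then have "c k \<in> carrier ?N" "c \<in> A \<rightarrow> carrier ?N" by (auto simp: N)
    then show ?case using insert by (simp add: N.finsum_insert N(3) Pi_iff)
  qed (simp_all add: N(2) N.finsum_infinite)
  have subgroup: "subgroup (piece ?N p q) (add_monoid ?N)" for p q
  proof
    show "piece ?N p q \<subseteq> carrier (add_monoid ?N)" by (simp add: N)
    show "\<one>\<^bsub>add_monoid ?N\<^esub> \<in> piece ?N p q" by (simp add: N V S_piece_zero)
    fix x assume x: "x \<in> piece ?N p q"
    then show "inv\<^bsub>add_monoid ?N\<^esub> x \<in> piece ?N p q"
      unfolding a_inv_def[symmetric] by (simp add: N neg V S_piece_uminus)
    fix y assume "y \<in> piece ?N p q"
    with x show "x \<otimes>\<^bsub>add_monoid ?N\<^esub> y \<in> piece ?N p q" by (simp add: N V S_piece_add)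
  qed
  have act_piece: "r \<odot>\<^bsub>?N\<^esub> h \<in> piece ?N (k + p) (l + q)"
    if "r \<in> S_piece k l" "h \<in> piece ?N p q" for k l p q r h
    using that S_piece_act[OF that(1), of h "p + a" "- (q + b)"] V_act
    by (auto simp: N algebra_simps)
  have decomp: "\<exists>!c :: int \<times> int \<Rightarrow> 'a spoly. (\<forall>p q. c (p, q) \<in> piece ?N p q) \<and> finite {k. c k \<noteq> \<zero>\<^bsub>?N\<^esub>} \<and>
      h = (\<Oplus>\<^bsub>?N\<^esub>k\<in>{k. c k \<noteq> \<zero>\<^bsub>?N\<^esub>}. c k)" if h: "h \<in> carrier ?N" for h
  proof -
    define c where "c = (\<lambda>(p, q). bipart (p + a) (- (q + b)) h)"
    have cV: "c k \<in> V" for k using h V_bipart by (simp add: c_def N split: prod.split)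
    let ?r = "\<lambda>(i, j). (i - a, - j - b)"
    have supp: "{k. c k \<noteq> 0} \<subseteq> ?r ` bidegs h"
    proof clarify
      fix p q assume "c (p, q) \<noteq> 0"
      then have "(p + a, - (q + b)) \<in> bidegs h" by (simp add: c_def bipart_nonzero_bidegs)
      then show "(p, q) \<in> ?r ` bidegs h" by (rule rev_image_eqI) simp
    qed
    have inj: "inj_on ?r (bidegs h)" by (auto simp: inj_on_def)
    have "h = (\<Sum>(i, j)\<in>bidegs h. bipart i j h)" by (rule sum_biparts) (simp_all add: finite_bidegs)
    also have "\<dots> = (\<Sum>k\<in>bidegs h. c (?r k))" by (rule sum.cong) (auto simp: c_def)
    also have "\<dots> = (\<Sum>k\<in>?r ` bidegs h. c k)" by (simp add: sum.reindex[OF inj])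
    also have "\<dots> = (\<Sum>k | c k \<noteq> 0. c k)"
      using supp by (intro sum.mono_neutral_right) (auto simp: finite_bidegs)
    finally have sum: "h = (\<Sum>k | c k \<noteq> 0. c k)" .
    show ?thesis
    proof (rule ex1I[of _ c], intro conjI allI)
      show "c (p, q) \<in> piece ?N p q" for p q
        using cV[of "(p, q)"] by (simp add: N c_def bipart_in_S_piece)
      show "finite {k. c k \<noteq> \<zero>\<^bsub>?N\<^esub>}"
        unfolding N by (rule finite_subset[OF supp]) (simp add: finite_bidegs)
      show "h = (\<Oplus>\<^bsub>?N\<^esub>k\<in>{k. c k \<noteq> \<zero>\<^bsub>?N\<^esub>}. c k)"
        unfolding N using cV sum by (subst finsum) auto
      fix e :: "int \<times> int \<Rightarrow> 'a spoly"
      assume e: "(\<forall>p q. e (p, q) \<in> piece ?N p q) \<and> finite {k. e k \<noteq> \<zero>\<^bsub>?N\<^esub>} \<and>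
        h = (\<Oplus>\<^bsub>?N\<^esub>k\<in>{k. e k \<noteq> \<zero>\<^bsub>?N\<^esub>}. e k)"
      then have eV: "e k \<in> V" and eS: "e (p, q) \<in> S_piece (p + a) (- (q + b))" for k p q
        by (cases k; auto simp: N)+
      have fin: "finite {k. e k \<noteq> 0}" using e by (simp add: N)
      have h: "h = (\<Sum>k | e k \<noteq> 0. e k)" using e eV finsum[of e "{k. e k \<noteq> 0}"] by (simp add: N)
      show "e = c"
      proof
        fix k :: "int \<times> int"
        obtain p q where k: "k = (p, q)" by (cases k)
        have "c k = (\<Sum>l | e l \<noteq> 0. bipart (p + a) (- (q + b)) (e l))"
          unfolding c_def k by (subst h) (simp add: bipart_sum)
        also have "\<dots> = (\<Sum>l | e l \<noteq> 0. if l = k then e k else 0)"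
        proof (rule sum.cong[OF HOL.refl])
          fix l :: "int \<times> int"
          obtain p' q' where l: "l = (p', q')" by (cases l)
          show "bipart (p + a) (- (q + b)) (e l) = (if l = k then e k else 0)"
            unfolding l k bipart_of_piece[OF eS] by auto
        qed
        also have "\<dots> = e k" using fin by simp
        finally show "e k = c k" ..
      qed
    qed
  qed
  show ?thesis
    unfolding is_bigraded_module_def using module subgroup act_piece decomp by blast
qed


section \<open>The isomorphism\<close>

context hilbert_burch_ideal
begin

text \<open>
  The isomorphism sends the class of \<open>s\<close> to the solution corresponding to it. For the pieces, a
  representative \<open>s\<close> of a class in a given bidegree may be replaced by its component there, and
  \<open>corr_bipart\<close> then locates the solution.
\<close>

lemma bigraded_iso_K_Sol:
  "bigraded_iso (K_module ideal_f f)
     (bg_shift (Sol_module (fourier (S_to_T g1)) (fourier (S_to_T g2))) (- 2) (- int d + 2))"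
    (is "bigraded_iso ?M ?N")
proof -
  define \<psi> where "\<psi> A = (THE h. \<exists>s. A = \<pi> s \<and> corr s h)" for A
  have \<psi>: "\<psi> (\<pi> s) = h" if "corr s h" for s h
    unfolding \<psi>_def
  proof (rule the_equality)
    show "\<exists>t. \<pi> s = \<pi> t \<and> corr t h" using that by blast
    fix k assume "\<exists>t. \<pi> s = \<pi> t \<and> corr t k"
    then show "k = h" using corr_unique[OF that] \<pi>_eq_iff by blast
  qed
  have M: "carrier ?M = \<pi> ` {s. to_Rees s = 0}" "\<zero>\<^bsub>?M\<^esub> = \<pi> 0"
    "piece ?M p q = \<pi> ` {s. to_Rees s = 0} \<inter> \<pi> ` S_piece p q" for p q
    by (simp_all add: K_module_def kernel_Sym_to_Rees \<pi>_hom)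
  have M_ops: "\<pi> s \<oplus>\<^bsub>?M\<^esub> \<pi> t = \<pi> (s + t)" "r \<odot>\<^bsub>?M\<^esub> \<pi> s = \<pi> (r * s)" for s t r
    by (simp_all add: K_module_def \<pi>_hom)
  have N: "carrier ?N = {h. act g1 h = 0 \<and> act g2 h = 0}" "\<zero>\<^bsub>?N\<^esub> = 0" "x \<oplus>\<^bsub>?N\<^esub> y = x + y"
    "r \<odot>\<^bsub>?N\<^esub> x = act r x"
    "piece ?N p q = {h. act g1 h = 0 \<and> act g2 h = 0} \<inter> S_piece (p - 2) (int d - 2 - q)" for x y r p q
    by (simp_all add: bg_shift_def Sol_module_def Sol_eq act_def algebra_simps)
  have kernel: "to_Rees s = 0" if "\<pi> s \<in> \<pi> ` {s. to_Rees s = 0}" for s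
    using that by (auto simp flip: Sym_to_Rees_\<pi>)
  show ?thesis
  proof (rule bigraded_iso_transport[where \<psi> = \<psi>])
    show "is_bigraded_module ?N" by (rule is_bigraded_module_shifted_Sol) (rule g_bidegree)+
    show "bij_betw \<psi> (carrier ?M) (carrier ?N)"
      unfolding bij_betw_def M N
    proof
      show "inj_on \<psi> (\<pi> ` {s. to_Rees s = 0})"
      proof (rule inj_onI)
        fix x y
        assume x: "x \<in> \<pi> ` {s. to_Rees s = 0}" and y: "y \<in> \<pi> ` {s. to_Rees s = 0}"
          and eq: "\<psi> x = \<psi> y"
        from x obtain s where s: "x = \<pi> s" "to_Rees s = 0" by blast
        from y obtain t where t: "y = \<pi> t" "to_Rees t = 0" by blast
        note st = s(1) t(1) s(2) t(2)
        obtain h where h: "corr s h" using corr_total s(2) by blast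
        obtain k where k: "corr t k" using corr_total t(2) by blast
        note hk = h k
        then have "h = k" using eq \<psi> st by simp
        then show "x = y" unfolding st \<pi>_eq_iff using corr_unique[OF hk] by blast
      qed
      show "\<psi> ` \<pi> ` {s. to_Rees s = 0} = {h. act g1 h = 0 \<and> act g2 h = 0}"
      proof (intro equalityI subsetI)
        fix x assume "x \<in> \<psi> ` \<pi> ` {s. to_Rees s = 0}"
        then obtain s where "x = \<psi> (\<pi> s)" "to_Rees s = 0" by blast
        then show "x \<in> {h. act g1 h = 0 \<and> act g2 h = 0}"
          using corr_total[of s] \<psi>[of s] corr_kernel[of s] by auto
      next
        fix h assume "h \<in> {h. act g1 h = 0 \<and> act g2 h = 0}"
        then obtain s where "corr s h" using corr_surj by blast
        then have "h = \<psi> (\<pi> s)" "to_Rees s = 0" using \<psi> corr_kernel(1) by auto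
        then show "h \<in> \<psi> ` \<pi> ` {s. to_Rees s = 0}" by blast
      qed
    qed
    show "\<zero>\<^bsub>?M\<^esub> \<in> carrier ?M" unfolding M using to_Rees.zero by blast
    show "\<psi> \<zero>\<^bsub>?M\<^esub> = \<zero>\<^bsub>?N\<^esub>"
    proof -
      obtain h where h: "corr 0 h" using corr_total[OF to_Rees.zero] by blast
      then have "h = 0" using corr_zero_iff_mem ideal_G by (auto simp: ideal_type_ring_iff)
      with h show ?thesis unfolding M N by (simp add: \<psi>)
    qed
    show "x \<oplus>\<^bsub>?M\<^esub> y \<in> carrier ?M \<and> \<psi> (x \<oplus>\<^bsub>?M\<^esub> y) = \<psi> x \<oplus>\<^bsub>?N\<^esub> \<psi> y"
      if xy: "x \<in> carrier ?M" "y \<in> carrier ?M" for x y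
    proof -
      obtain s t where st: "x = \<pi> s" "y = \<pi> t" "to_Rees s = 0" "to_Rees t = 0" using xy unfolding M by blast
      then obtain h k where hk: "corr s h" "corr t k" using corr_total by metis
      moreover from hk have "corr (s + t) (h + k)" by (rule corr_add)
      ultimately show ?thesis using st unfolding st(1,2) M M_ops N by (simp add: \<psi> to_Rees.add)
    qed
    show "r \<odot>\<^bsub>?M\<^esub> x \<in> carrier ?M \<and> \<psi> (r \<odot>\<^bsub>?M\<^esub> x) = r \<odot>\<^bsub>?N\<^esub> \<psi> x" if x: "x \<in> carrier ?M" for r x
    proof -
      obtain s where s: "x = \<pi> s" "to_Rees s = 0" using x unfolding M by blast
      then obtain h where "corr s h" using corr_total by blast
      moreover from this have "corr (r * s) (act r h)" by (rule corr_mult)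
      ultimately show ?thesis using s unfolding s(1) M M_ops N by (simp add: \<psi> to_Rees.mult)
    qed
    show "piece ?M p q \<subseteq> carrier ?M" for p q unfolding M by blast
    show "\<psi> ` piece ?M p q = piece ?N p q" for p q
      unfolding M N
    proof (intro equalityI subsetI)
      fix x assume "x \<in> \<psi> ` (\<pi> ` {s. to_Rees s = 0} \<inter> \<pi> ` S_piece p q)"
      then obtain A where A: "x = \<psi> A" "A \<in> \<pi> ` {s. to_Rees s = 0}" "A \<in> \<pi> ` S_piece p q" by blast
      from A(3) obtain s where "A = \<pi> s" "s \<in> S_piece p q" by (rule imageE)
      with A have s: "x = \<psi> (\<pi> s)" "s \<in> S_piece p q" "\<pi> s \<in> \<pi> ` {s. to_Rees s = 0}" by simp_all
      then obtain h where h: "corr s h" using kernel corr_total by blast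
      then have "corr s (bipart (p - 2) (int d - 2 - q) h)"
        using corr_bipart[of s h p q] s(2) by (simp add: bipart_of_piece)
      then have "bipart (p - 2) (int d - 2 - q) h = x" using \<psi> s(1) by simp
      then have "x \<in> S_piece (p - 2) (int d - 2 - q)" using bipart_in_S_piece by metis
      then show "x \<in> {h. act g1 h = 0 \<and> act g2 h = 0} \<inter> S_piece (p - 2) (int d - 2 - q)"
        using corr_kernel[OF h] \<psi>[OF h] s(1) by simp
    next
      fix h assume h: "h \<in> {h. act g1 h = 0 \<and> act g2 h = 0} \<inter> S_piece (p - 2) (int d - 2 - q)"
      then obtain s where s: "corr s h" using corr_surj by blast
      have s': "corr (bipart p q s) h"
        using corr_bipart[OF s, of p q] bipart_of_piece[of h "p - 2" "int d - 2 - q"] h by simp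
      then have "\<pi> (bipart p q s) \<in> \<pi> ` {s. to_Rees s = 0} \<inter> \<pi> ` S_piece p q"
        using corr_kernel(1) bipart_in_S_piece by blast
      then show "h \<in> \<psi> ` (\<pi> ` {s. to_Rees s = 0} \<inter> \<pi> ` S_piece p q)"
        using \<psi>[OF s'] by (metis image_eqI)
    qed
  qed
qed

end


theorem theorem1:
  fixes f :: "3 \<Rightarrow> 'a::field_char_0 xpoly"
    and I :: "'a xpoly set"
    and d \<mu> :: nat
    and \<phi> :: "3 \<Rightarrow> 2 \<Rightarrow> 'a xpoly"
    and g :: "2 \<Rightarrow> 'a spoly"
    and L :: "2 \<Rightarrow> 'a weyl_T"
  assumes I: "I = genideal type_ring (range f)"
    and minimal: "\<And>J. J \<subset> UNIV \<Longrightarrow> genideal type_ring (f ` J) \<noteq> I"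
    and homogeneous: "\<And>i. homogeneous d (f i)"
    and height: "ideal_height type_ring I = 2"
    and \<phi>: "hilbert_burch f d \<mu> \<phi>"
    and g: "\<And>k. g k = sym_eq \<phi> k"
    and L: "\<And>k. L k = fourier (S_to_T (g k))"
  shows "bigraded_iso (K_module I f) (bg_shift (Sol_module (L 1) (L 2)) (- 2) (- int d + 2))"
proof -
  interpret hilbert_burch_ideal f d \<mu> \<phi>
  proof
    show "hilbert_burch f d \<mu> \<phi>" by (rule \<phi>)
    show "f i \<noteq> 0" for i
      using minimal by (intro generator_nonzero) (simp add: I)
    show "\<exists>M r. var_mp j ^ M = (\<Sum>i\<in>UNIV. r i * f i)" for j
    proof -
      obtain j' :: 2 where "j \<noteq> j'" using exhaust_2[of j] one_neq_two by metis
      then show ?thesis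
        using X_power_in_height_two_ideal[of j j' d f] homogeneous height by (simp add: I)
    qed
  qed
  show ?thesis
    using bigraded_iso_K_Sol by (simp add: I L g ideal_f_def g1_def g2_def)
qed

end
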